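(* Let $A=\{H_1,\dots,H_m\}$, $H_i=V(\alpha_i)$ pairwise distinct, be a normal crossing hyperplane configuration in $\mathbb{C}^n$, $\alpha=\prod_{i=1}^m\alpha_i$, $\beta=(\beta_1,\dots,\beta_m)\in\mathbb{C}^m$. Let $S=\{i_1,\dots,i_k\}\subset\{1,\dots,m\}$ (possibly empty) and let $H_S=H_{i_1}\cap\dots\cap H_{i_k}$ be nonempty (with $H_\emptyset=\mathbb{C}^n$). Then: (i) There is at most one decomposition factor of the $A_n$-module $M_\alpha^\beta$ with support $H_S$. (ii) There is exactly one decomposition factor of $M_\alpha^\beta$ with support $H_S$ if and only if $\beta_{i_1},\dots,\beta_{i_k}\in\mathbb{Z}$.
   Context: $A_n$ is the $n$-th Weyl algebra over $\mathbb{C}$, and $\mathbb{C}[x]=\mathbb{C}[x_1,\dots,x_n]$. A hyperplane configuration in $\mathbb{C}^n$ is a finite set of affine hyperplanes $H_i=V(\alpha_i)$, each $\alpha_i$ a polynomial of degree one. It is a normal crossing configuration if for every point $p$ and any set of hyperplanes $H_{i_1},\dots,H_{i_k}$ of the configuration containing $p$, there is an affine change of coordinates at $p$ to new coordinates $x_1,\dots,x_n$ such that $\alpha_{i_1}=x_1,\dots,\alpha_{i_k}=x_k$ (in particular at most $n$ of the hyperplanes pass through $p$). $M_\alpha^\beta$ is the free rank one module over the localization $\mathbb{C}[x]_\alpha$ on a generator denoted $\alpha^\beta$, made into an $A_n$-module by extending $\partial_j(\alpha^\beta)=\sum_{i=1}^m\beta_i\frac{\partial_j(\alpha_i)}{\alpha_i}\alpha^\beta$,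 $j=1,\dots,n$, by the Leibniz rule; it is holonomic, hence of finite length. Decomposition factors are the Jordan–Hölder (composition) factors, counted with multiplicity. The support of a holonomic module $N$ is its support as a $\mathbb{C}[x]$-module, a closed subvariety of $\mathbb{C}^n$; "with support $H_S$" means $\mathrm{Supp}\,N=H_S$. *)

theory Defs
  imports
    "HOL-Analysis.Cartesian_Space"
    "HOL-Algebra.Module"
    "HOL-Algebra.AbelCoset"
    "HOL-Library.Poly_Mapping"
    "HOL-Computational_Algebra.Fraction_Field"
begin

section \<open>Polynomials over the complex numbers\<close>

text \<open>The variables are indexed by a finite type \<open>'n\<close>, with \<open>CARD('n)\<close> in the role of \<open>n\<close>. Like
  \<open>{1, \<dots>, n}\<close> the index type carries a linear order, which the library uses to show that the
  polynomial ring is an integral domain; nothing else below depends on the choice of the order.\<close>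

type_synonym 'n cpoly = "('n \<Rightarrow>\<^sub>0 nat) \<Rightarrow>\<^sub>0 complex"

abbreviation (input) single :: "'a \<Rightarrow> 'b \<Rightarrow> ('a \<Rightarrow>\<^sub>0 'b::zero)" where
  "single \<equiv> Poly_Mapping.single"

abbreviation (input) lookup :: "('a \<Rightarrow>\<^sub>0 'b::zero) \<Rightarrow> 'a \<Rightarrow> 'b" where
  "lookup \<equiv> Poly_Mapping.lookup"

abbreviation (input) keys :: "('a \<Rightarrow>\<^sub>0 'b::zero) \<Rightarrow> 'a set" where
  "keys \<equiv> Poly_Mapping.keys"

definition pconst :: "complex \<Rightarrow> 'n cpoly" where
  "pconst c = single 0 c"

definition pvar :: "'n \<Rightarrow> 'n cpoly" where
  "pvar i = single (single i 1) 1"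

definition peval :: "complex ^ 'n \<Rightarrow> 'n::finite cpoly \<Rightarrow> complex" where
  "peval x p = (\<Sum>e\<in>keys p. lookup p e * (\<Prod>i\<in>UNIV. (x $ i) ^ lookup e i))"

definition total_degree :: "'n::finite cpoly \<Rightarrow> nat" where
  "total_degree p = Max (insert 0 ((\<lambda>e. \<Sum>i\<in>UNIV. lookup e i) ` keys p))"

text \<open>If \<open>x\<^sub>j\<close> does not occur in a monomial, then the truncated subtraction in the exponent is
  harmless, because the coefficient is zero.\<close>

definition pderiv :: "'n \<Rightarrow> 'n cpoly \<Rightarrow> 'n cpoly" where
  "pderiv j p =
    (\<Sum>e\<in>keys p. single (e - single j 1) (of_nat (lookup e j) * lookup p e))"

definition zero_locus :: "'n::finite cpoly \<Rightarrow> (complex ^ 'n) set" where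
  "zero_locus p = {x. peval x p = 0}"

lemma pderiv_superset:
  assumes "finite A" "keys p \<subseteq> A"
  shows "pderiv j p =
    (\<Sum>e\<in>A. single (e - single j 1) (of_nat (lookup e j) * lookup p e))"
  unfolding pderiv_def
  by (rule sum.mono_neutral_left) (use assms in \<open>auto simp: in_keys_iff\<close>)

lemma pderiv_add: "pderiv j (p + q) = pderiv j p + pderiv j q"
proof -
  let ?A = "keys p \<union> keys q"
  have "keys (p + q) \<subseteq> ?A" by (rule keys_add)
  then show ?thesis
    by (simp add: pderiv_superset[of ?A] lookup_add algebra_simps single_add sum.distrib)
qed

lemma pderiv_zero [simp]: "pderiv j 0 = 0"
  by (simp add: pderiv_def)

lemma pderiv_sum: "pderiv j (sum f A) = (\<Sum>a\<in>A. pderiv j (f a))"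
  by (induction A rule: infinite_finite_induct) (auto simp: pderiv_add)

lemma pderiv_single:
  "pderiv j (single e c) =
    single (e - single j 1) (of_nat (lookup e j) * c)"
  by (subst pderiv_superset[of "{e}"]) (auto split: if_splits)

lemma cpoly_sum_single: "p = (\<Sum>e\<in>keys p. single e (lookup p e))"
  by (rule poly_mapping_eqI) (auto simp: lookup_sum lookup_single when_def in_keys_iff)

lemma exponent_diff_add:
  assumes "lookup (a :: 'n \<Rightarrow>\<^sub>0 nat) j \<noteq> 0"
  shows "a - single j 1 + b = a + b - single j 1"
  using assms by (intro poly_mapping_eqI) (auto simp: lookup_add lookup_minus lookup_single when_def)

lemma pderiv_mult_single:
  "pderiv j (single a x * single b y) =
    pderiv j (single a x) * single b y
    + single a x * pderiv j (single b y)"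
proof -
  have 1: "single (a - single j 1 + b) (of_nat (lookup a j) * x * y) =
    single (a + b - single j 1) (of_nat (lookup a j) * x * y)"
    by (cases "lookup a j = 0") (auto simp: exponent_diff_add simp del: One_nat_def)
  have 2: "single (a + (b - single j 1)) (of_nat (lookup b j) * x * y) =
    single (a + b - single j 1) (of_nat (lookup b j) * x * y)"
    using exponent_diff_add[of b j a]
    by (cases "lookup b j = 0") (auto simp: add.commute simp del: One_nat_def)
  have "single (a + b - single j 1) (of_nat (lookup (a + b) j) * (x * y)) =
    single (a + b - single j 1) (of_nat (lookup a j) * x * y)
    + single (a + b - single j 1) (of_nat (lookup b j) * x * y)"
    by (simp add: lookup_add algebra_simps flip: single_add)
  then show ?thesis
    using 1 2 by (simp add: pderiv_single mult_single mult.assoc mult.left_commute[of x])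
qed

lemma pderiv_mult: "pderiv j (p * q) = pderiv j p * q + p * pderiv j q"
proof -
  let ?s = "\<lambda>p e. single e (lookup p e)"
  have "p * q = (\<Sum>a\<in>keys p. \<Sum>b\<in>keys q. ?s p a * ?s q b)"
    by (subst cpoly_sum_single[of p], subst cpoly_sum_single[of q]) (simp add: sum_product)
  then have "pderiv j (p * q) = (\<Sum>a\<in>keys p. \<Sum>b\<in>keys q. pderiv j (?s p a) * ?s q b)
      + (\<Sum>a\<in>keys p. \<Sum>b\<in>keys q. ?s p a * pderiv j (?s q b))"
    by (simp add: pderiv_sum pderiv_mult_single sum.distrib)
  also have "(\<Sum>a\<in>keys p. \<Sum>b\<in>keys q. pderiv j (?s p a) * ?s q b) =
      pderiv j (\<Sum>a\<in>keys p. ?s p a) * (\<Sum>b\<in>keys q. ?s q b)"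
    by (simp add: pderiv_sum sum_product)
  also have "(\<Sum>a\<in>keys p. \<Sum>b\<in>keys q. ?s p a * pderiv j (?s q b)) =
      (\<Sum>a\<in>keys p. ?s p a) * pderiv j (\<Sum>b\<in>keys q. ?s q b)"
    by (simp add: pderiv_sum sum_product)
  finally show ?thesis by (simp flip: cpoly_sum_single)
qed

lemma pderiv_const [simp]: "pderiv j (pconst c) = 0"
  by (simp add: pconst_def pderiv_single)

lemma pderiv_one [simp]: "pderiv j 1 = 0"
  using pderiv_const[of j 1] by (simp add: pconst_def)

lemma pderiv_uminus: "pderiv j (- p) = - pderiv j p"
  using pderiv_add[of j p "- p"] by (simp add: eq_neg_iff_add_eq_0 add.commute)

lemma pderiv_diff: "pderiv j (p - q) = pderiv j p - pderiv j q"
  using pderiv_add[of j p "- q"] by (simp add: pderiv_uminus)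

lemma pderiv_var: "pderiv j (pvar i) = (if i = j then 1 else 0)"
  by (auto simp: pvar_def pderiv_single lookup_single when_def)

lemma pderiv_commute: "pderiv i (pderiv j p) = pderiv j (pderiv i p)"
proof -
  have "pderiv i (pderiv j (single e c)) = pderiv j (pderiv i (single e c))"
    for e c
    by (cases "i = j")
      (simp_all add: pderiv_single lookup_minus lookup_single when_def diff_diff_add
        add.commute mult.left_commute)
  then show ?thesis
    by (subst (1 2) cpoly_sum_single[of p]) (simp add: pderiv_sum)
qed


section \<open>Rational functions\<close>

definition frac_of_poly :: "'n::linorder cpoly \<Rightarrow> 'n cpoly fract" where
  "frac_of_poly p = Fract p 1"

lift_definition fderiv :: "'n::linorder \<Rightarrow> 'n cpoly fract \<Rightarrow> 'n cpoly fract"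
  is "\<lambda>j q. (pderiv j (fst q) * snd q - fst q * pderiv j (snd q), snd q * snd q)"
proof -
  fix j :: 'n and q r :: "'n cpoly \<times> 'n cpoly"
  obtain a b c d where qr: "q = (a, b)" "r = (c, d)" by (cases q, cases r)
  let ?D = "pderiv j"
  assume "fractrel q r"
  then have nz: "b \<noteq> 0" "d \<noteq> 0" and eq: "a * d = c * b" by (auto simp: qr)
  have D: "?D a * d + a * ?D d = ?D c * b + c * ?D b"
    using arg_cong[OF eq, of ?D] by (simp add: pderiv_mult)
  have "(?D a * b - a * ?D b) * (d * d) - (?D c * d - c * ?D d) * (b * b)
      = b * d * ((?D a * d + a * ?D d) - (?D c * b + c * ?D b))
        - (a * d - c * b) * (b * ?D d + ?D b * d)"
    by (simp add: algebra_simps)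
  also have "\<dots> = 0" by (simp only: D eq) simp
  finally have "(?D a * b - a * ?D b) * (d * d) = (?D c * d - c * ?D d) * (b * b)"
    by (rule eq_iff_diff_eq_0[THEN iffD2])
  moreover have "b * b \<noteq> 0" "d * d \<noteq> 0"
    using nz by auto
  ultimately show "fractrel (?D (fst q) * snd q - fst q * ?D (snd q), snd q * snd q)
      (?D (fst r) * snd r - fst r * ?D (snd r), snd r * snd r)"
    unfolding fractrel_iff fst_conv snd_conv qr by (intro conjI)
qed

lemma fderiv_Fract:
  "b \<noteq> 0 \<Longrightarrow> fderiv j (Fract a b) = Fract (pderiv j a * b - a * pderiv j b) (b * b)"
  by (simp add: Fract.abs_eq fderiv.abs_eq)

lemma frac_of_poly_add: "frac_of_poly (p + q) = frac_of_poly p + frac_of_poly q"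
  and frac_of_poly_mult: "frac_of_poly (p * q) = frac_of_poly p * frac_of_poly q"
  and frac_of_poly_zero [simp]: "frac_of_poly 0 = 0"
  and frac_of_poly_one [simp]: "frac_of_poly 1 = 1"
  and frac_of_poly_eq_0_iff [simp]: "frac_of_poly p = 0 \<longleftrightarrow> p = 0"
  and frac_of_poly_inject: "frac_of_poly p = frac_of_poly q \<longleftrightarrow> p = q"
  by (auto simp: frac_of_poly_def Zero_fract_def One_fract_def eq_fract)

lemma frac_of_poly_power: "frac_of_poly (p ^ k) = frac_of_poly p ^ k"
  by (induction k) (auto simp: frac_of_poly_mult)

lemma frac_of_poly_sum: "frac_of_poly (sum f A) = (\<Sum>a\<in>A. frac_of_poly (f a))"
  by (induction A rule: infinite_finite_induct) (auto simp: frac_of_poly_add)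

lemma fderiv_frac_of_poly: "fderiv j (frac_of_poly p) = frac_of_poly (pderiv j p)"
  by (simp add: frac_of_poly_def fderiv_Fract)

lemma fderiv_add: "fderiv j (q + r) = fderiv j q + fderiv j r"
  by (cases q, cases r)
    (simp add: fderiv_Fract eq_fract pderiv_add pderiv_mult algebra_simps)

lemma fderiv_mult: "fderiv j (q * r) = fderiv j q * r + q * fderiv j r"
  by (cases q, cases r)
    (simp add: fderiv_Fract eq_fract pderiv_mult algebra_simps)

lemma fderiv_zero [simp]: "fderiv j 0 = 0"
  using fderiv_frac_of_poly[of j 0] by simp

lemma fderiv_sum: "fderiv j (sum f A) = (\<Sum>a\<in>A. fderiv j (f a))"
  by (induction A rule: infinite_finite_induct) (auto simp: fderiv_add)

lemma fderiv_commute: "fderiv i (fderiv j q) = fderiv j (fderiv i q)"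
proof (cases q)
  case (Fract a b)
  let ?a = "frac_of_poly a" and ?b = "frac_of_poly b"
  have "fderiv i (fderiv j (q * ?b)) = fderiv j (fderiv i (q * ?b))"
  proof -
    have "q * ?b = ?a" using Fract by (simp add: frac_of_poly_def eq_fract)
    then show ?thesis by (simp add: fderiv_frac_of_poly pderiv_commute[of i j])
  qed
  moreover have "fderiv i (fderiv j ?b) = fderiv j (fderiv i ?b)"
    by (simp add: fderiv_frac_of_poly pderiv_commute[of i j])
  ultimately have "fderiv i (fderiv j q) * ?b = fderiv j (fderiv i q) * ?b"
    by (simp add: fderiv_mult fderiv_add add_ac)
  then show ?thesis using Fract by simp
qed

section \<open>The Weyl algebra\<close>

text \<open>The Weyl algebra is given by its usual presentation: it is the unital associative algebra over
  the complex numbers with generators \<open>x\<^sub>i\<close>, \<open>\<partial>\<^sub>i\<close> and relations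
  \<open>x\<^sub>i x\<^sub>j = x\<^sub>j x\<^sub>i\<close>, \<open>\<partial>\<^sub>i \<partial>\<^sub>j = \<partial>\<^sub>j \<partial>\<^sub>i\<close>,
  \<open>\<partial>\<^sub>i x\<^sub>j = x\<^sub>j \<partial>\<^sub>i + \<delta>\<^sub>i\<^sub>j\<close>. It is constructed as the set of terms in the generators modulo the least
  congruence that contains the laws of an algebra and these relations.\<close>

datatype 'n wterm =
    WConst complex | WX 'n | WD 'n | WAdd "'n wterm" "'n wterm" | WMul "'n wterm" "'n wterm"

inductive weyl_eq :: "'n wterm \<Rightarrow> 'n wterm \<Rightarrow> bool" where
  refl: "weyl_eq a a"
| sym: "weyl_eq a b \<Longrightarrow> weyl_eq b a"
| trans: "weyl_eq a b \<Longrightarrow> weyl_eq b c \<Longrightarrow> weyl_eq a c"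
| cong_add: "weyl_eq a a' \<Longrightarrow> weyl_eq b b' \<Longrightarrow> weyl_eq (WAdd a b) (WAdd a' b')"
| cong_mul: "weyl_eq a a' \<Longrightarrow> weyl_eq b b' \<Longrightarrow> weyl_eq (WMul a b) (WMul a' b')"
| add_assoc: "weyl_eq (WAdd (WAdd a b) c) (WAdd a (WAdd b c))"
| add_comm: "weyl_eq (WAdd a b) (WAdd b a)"
| add_zero: "weyl_eq (WAdd (WConst 0) a) a"
| add_neg: "weyl_eq (WAdd (WMul (WConst (- 1)) a) a) (WConst 0)"
| mul_assoc: "weyl_eq (WMul (WMul a b) c) (WMul a (WMul b c))"
| mul_one_left: "weyl_eq (WMul (WConst 1) a) a"
| mul_one_right: "weyl_eq (WMul a (WConst 1)) a"
| distrib_left: "weyl_eq (WMul a (WAdd b c)) (WAdd (WMul a b) (WMul a c))"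
| distrib_right: "weyl_eq (WMul (WAdd a b) c) (WAdd (WMul a c) (WMul b c))"
| const_add: "weyl_eq (WConst (z + w)) (WAdd (WConst z) (WConst w))"
| const_mul: "weyl_eq (WConst (z * w)) (WMul (WConst z) (WConst w))"
| const_central: "weyl_eq (WMul (WConst z) a) (WMul a (WConst z))"
| x_comm: "weyl_eq (WMul (WX i) (WX j)) (WMul (WX j) (WX i))"
| d_comm: "weyl_eq (WMul (WD i) (WD j)) (WMul (WD j) (WD i))"
| d_x: "weyl_eq (WMul (WD i) (WX j)) (WAdd (WMul (WX j) (WD i)) (WConst (if i = j then 1 else 0)))"

quotient_type 'n weyl = "'n wterm" / weyl_eq
  by (intro equivpI reflpI sympI transpI) (blast intro: weyl_eq.intros)+

text \<open>The action of terms on rational functions that lets \<open>\<partial>\<^sub>j\<close> act as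
  \<open>q \<mapsto> \<partial>q/\<partial>x\<^sub>j + \<eta>\<^sub>j q\<close>. It respects the relations as soon as the connection with form \<open>\<eta>\<close> is
  integrable.\<close>

primrec wterm_act :: "('n \<Rightarrow> 'n cpoly fract) \<Rightarrow> 'n::linorder wterm \<Rightarrow> 'n cpoly fract \<Rightarrow> 'n cpoly fract"
  where
    "wterm_act \<eta> (WConst c) q = frac_of_poly (pconst c) * q"
  | "wterm_act \<eta> (WX i) q = frac_of_poly (pvar i) * q"
  | "wterm_act \<eta> (WD j) q = fderiv j q + \<eta> j * q"
  | "wterm_act \<eta> (WAdd a b) q = wterm_act \<eta> a q + wterm_act \<eta> b q"
  | "wterm_act \<eta> (WMul a b) q = wterm_act \<eta> a (wterm_act \<eta> b q)"

lemma pconst_add: "pconst (z + w) = pconst z + pconst w"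
  and pconst_mult: "pconst (z * w) = pconst z * pconst w"
  and pconst_zero [simp]: "pconst 0 = 0"
  and pconst_one [simp]: "pconst 1 = 1"
  by (simp_all add: pconst_def single_add mult_single)

lemma frac_of_poly_pconst_minus_one: "frac_of_poly (pconst (- 1)) = - 1"
  by (simp add: pconst_def single_uminus frac_of_poly_def One_fract_def)

lemma wterm_act_add: "wterm_act \<eta> a (q + r) = wterm_act \<eta> a q + wterm_act \<eta> a r"
  by (induction a arbitrary: q r) (simp_all add: algebra_simps fderiv_add)

lemma fderiv_const_mult:
  "fderiv j (frac_of_poly (pconst c) * q) = frac_of_poly (pconst c) * fderiv j q"
  by (simp add: fderiv_mult fderiv_frac_of_poly)

lemma wterm_act_const_mult:
  "wterm_act \<eta> a (frac_of_poly (pconst c) * q) = frac_of_poly (pconst c) * wterm_act \<eta> a q"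
  by (induction a arbitrary: q) (simp_all add: fderiv_const_mult ring_distribs mult.left_commute)

lemma wterm_act_cong:
  assumes "weyl_eq a b" "\<And>i j. fderiv i (\<eta> j) = fderiv j (\<eta> i)"
  shows "wterm_act \<eta> a q = wterm_act \<eta> b q"
  using assms(1)
proof (induction arbitrary: q rule: weyl_eq.induct)
  case (add_neg a)
  then show ?case by (simp add: frac_of_poly_pconst_minus_one)
next
  case (d_comm i j)
  then show ?case
    by (simp add: fderiv_add fderiv_mult fderiv_commute[of i j] assms(2)[of i j] algebra_simps)
next
  case (d_x i j)
  then show ?case
    by (auto simp: fderiv_mult fderiv_frac_of_poly pderiv_var algebra_simps)
qed (simp_all add: wterm_act_add wterm_act_const_mult pconst_add pconst_mult frac_of_poly_add
  frac_of_poly_mult ring_distribs add_ac mult.assoc mult.left_commute)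

instantiation weyl :: (linorder) ring_1
begin

lift_definition zero_weyl :: "'a weyl" is "WConst 0" .
lift_definition one_weyl :: "'a weyl" is "WConst 1" .
lift_definition plus_weyl :: "'a weyl \<Rightarrow> 'a weyl \<Rightarrow> 'a weyl" is WAdd by (rule weyl_eq.cong_add)
lift_definition times_weyl :: "'a weyl \<Rightarrow> 'a weyl \<Rightarrow> 'a weyl" is WMul by (rule weyl_eq.cong_mul)
lift_definition uminus_weyl :: "'a weyl \<Rightarrow> 'a weyl" is "WMul (WConst (- 1))"
  by (intro weyl_eq.cong_mul weyl_eq.refl)
definition minus_weyl :: "'a weyl \<Rightarrow> 'a weyl \<Rightarrow> 'a weyl" where
  "minus_weyl a b = a + - b"

instance
proof
  fix a b c :: "'a weyl"
  show "a + b + c = a + (b + c)" by transfer (rule weyl_eq.add_assoc)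
  show "a + b = b + a" by transfer (rule weyl_eq.add_comm)
  show "0 + a = a" by transfer (rule weyl_eq.add_zero)
  show "- a + a = 0" by transfer (rule weyl_eq.add_neg)
  show "a - b = a + - b" by (rule minus_weyl_def)
  show "a * b * c = a * (b * c)" by transfer (rule weyl_eq.mul_assoc)
  show "1 * a = a" by transfer (rule weyl_eq.mul_one_left)
  show "a * 1 = a" by transfer (rule weyl_eq.mul_one_right)
  show "(a + b) * c = a * c + b * c" by transfer (rule weyl_eq.distrib_right)
  show "a * (b + c) = a * b + a * c" by transfer (rule weyl_eq.distrib_left)
  show "(0 :: 'a weyl) \<noteq> 1"
  proof transfer
    show "\<not> weyl_eq (WConst 0) (WConst 1 :: 'a wterm)"
    proof
      assume "weyl_eq (WConst 0) (WConst 1 :: 'a wterm)"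
      then have "wterm_act (\<lambda>_. 0) (WConst 0) 1 = wterm_act (\<lambda>_. 0) (WConst 1 :: 'a wterm) 1"
        by (rule wterm_act_cong) simp
      then show False by simp
    qed
  qed
qed

end

lift_definition weyl_const :: "complex \<Rightarrow> 'n weyl" is WConst .
lift_definition weyl_x :: "'n \<Rightarrow> 'n weyl" is WX .
lift_definition weyl_d :: "'n \<Rightarrow> 'n weyl" is WD .

text \<open>The inclusion of the polynomial ring. The list only serves to write a product of the commuting
  elements \<open>x\<^sub>i\<close> in a noncommutative ring.\<close>

definition weyl_of_poly :: "'n::{finite,linorder} cpoly \<Rightarrow> 'n weyl" where
  "weyl_of_poly p = (\<Sum>e\<in>keys p. weyl_const (lookup p e) *
    prod_list (map (\<lambda>i. weyl_x i ^ lookup e i) (sorted_list_of_set UNIV)))"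

section \<open>Left modules\<close>

text \<open>As usual in HOL-Algebra, the ring multiplication and unit in the record of a module are unused.\<close>

locale left_module = abelian_group M for M :: "('r::ring_1, 'a, 'z) module_scheme" (structure) +
  assumes smult_closed: "x \<in> carrier M \<Longrightarrow> r \<odot> x \<in> carrier M"
    and smult_l_distr: "x \<in> carrier M \<Longrightarrow> (r + s) \<odot> x = r \<odot> x \<oplus> s \<odot> x"
    and smult_r_distr: "x \<in> carrier M \<Longrightarrow> y \<in> carrier M \<Longrightarrow> r \<odot> (x \<oplus> y) = r \<odot> x \<oplus> r \<odot> y"
    and smult_assoc: "x \<in> carrier M \<Longrightarrow> (r * s) \<odot> x = r \<odot> (s \<odot> x)"
    and smult_one: "x \<in> carrier M \<Longrightarrow> 1 \<odot> x = x"

definition left_submodule :: "'a set \<Rightarrow> ('r::ring_1, 'a, 'z) module_scheme \<Rightarrow> bool" where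
  "left_submodule N M \<longleftrightarrow> N \<subseteq> carrier M \<and> \<zero>\<^bsub>M\<^esub> \<in> N \<and>
    (\<forall>x\<in>N. \<forall>y\<in>N. x \<oplus>\<^bsub>M\<^esub> y \<in> N) \<and> (\<forall>r. \<forall>x\<in>N. r \<odot>\<^bsub>M\<^esub> x \<in> N)"

definition quotient_module :: "('r::ring_1, 'a, 'z) module_scheme \<Rightarrow> 'a set \<Rightarrow> ('r, 'a set) module" where
  "quotient_module M N = \<lparr>carrier = a_rcosets\<^bsub>M\<^esub> N, mult = undefined, one = undefined,
    zero = N, add = set_add M, smult = \<lambda>r C. \<Union>x\<in>C. N +>\<^bsub>M\<^esub> (r \<odot>\<^bsub>M\<^esub> x)\<rparr>"

definition simple_module :: "('r::ring_1, 'a, 'z) module_scheme \<Rightarrow> bool" where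
  "simple_module M \<longleftrightarrow> carrier M \<noteq> {\<zero>\<^bsub>M\<^esub>} \<and>
    (\<forall>N. left_submodule N M \<longrightarrow> N = {\<zero>\<^bsub>M\<^esub>} \<or> N = carrier M)"

definition chain_factor ::
    "('r::ring_1, 'a, 'z) module_scheme \<Rightarrow> (nat \<Rightarrow> 'a set) \<Rightarrow> nat \<Rightarrow> ('r, 'a set) module" where
  "chain_factor M N i = quotient_module (M\<lparr>carrier := N (Suc i)\<rparr>) (N i)"

definition composition_series ::
    "('r::ring_1, 'a, 'z) module_scheme \<Rightarrow> (nat \<Rightarrow> 'a set) \<Rightarrow> nat \<Rightarrow> bool" where
  "composition_series M N l \<longleftrightarrow> N 0 = {\<zero>\<^bsub>M\<^esub>} \<and> N l = carrier M \<and>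
    (\<forall>i\<le>l. left_submodule (N i) M) \<and>
    (\<forall>i<l. N i \<subseteq> N (Suc i) \<and> simple_module (chain_factor M N i))"

definition finite_length :: "('r::ring_1, 'a, 'z) module_scheme \<Rightarrow> bool" where
  "finite_length M \<longleftrightarrow> (\<exists>N l. composition_series M N l)"

section \<open>Support of a module over the Weyl algebra\<close>

definition poly_smult ::
    "('n::{finite,linorder} weyl, 'a, 'z) module_scheme \<Rightarrow> 'n cpoly \<Rightarrow> 'a \<Rightarrow> 'a" where
  "poly_smult M f u = weyl_of_poly f \<odot>\<^bsub>M\<^esub> u"

text \<open>The localization at the maximal ideal of a point: its elements are the classes of the fractions
  \<open>u/s\<close>, with \<open>s\<close> not vanishing at the point.\<close>

definition local_fractions ::
    "('n weyl, 'a, 'z) module_scheme \<Rightarrow> complex ^ 'n::{finite,linorder} \<Rightarrow> ('a \<times> 'n cpoly) set" where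
  "local_fractions M p = carrier M \<times> {s. peval p s \<noteq> 0}"

definition local_rel ::
    "('n weyl, 'a, 'z) module_scheme \<Rightarrow> complex ^ 'n::{finite,linorder} \<Rightarrow>
      (('a \<times> 'n cpoly) \<times> ('a \<times> 'n cpoly)) set" where
  "local_rel M p = {((u, s), (v, t)). (u, s) \<in> local_fractions M p \<and> (v, t) \<in> local_fractions M p \<and>
    (\<exists>w. peval p w \<noteq> 0 \<and>
      poly_smult M w (poly_smult M t u) = poly_smult M w (poly_smult M s v))}"

definition localization_at ::
    "('n weyl, 'a, 'z) module_scheme \<Rightarrow> complex ^ 'n::{finite,linorder} \<Rightarrow> ('a \<times> 'n cpoly) set set" where
  "localization_at M p = local_fractions M p // local_rel M p"

definition module_support ::
    "('n weyl, 'a, 'z) module_scheme \<Rightarrow> (complex ^ 'n::{finite,linorder}) set" where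
  "module_support M = {p. localization_at M p \<noteq> {local_rel M p `` {(\<zero>\<^bsub>M\<^esub>, 1)}}}"

text \<open>Factors are counted by their position in the series, hence with multiplicity.\<close>

definition num_factors_with_support ::
    "('n weyl, 'a, 'z) module_scheme \<Rightarrow> (nat \<Rightarrow> 'a set) \<Rightarrow> nat \<Rightarrow>
      (complex ^ 'n::{finite,linorder}) set \<Rightarrow> nat" where
  "num_factors_with_support M N l Z = card {i. i < l \<and> module_support (chain_factor M N i) = Z}"

section \<open>Hyperplane configurations\<close>

text \<open>A configuration is given by the number \<open>m\<close> of its hyperplanes and their equations
  \<open>\<alpha>\<^sub>1, \<dots>, \<alpha>\<^sub>m\<close>.\<close>

definition hyperplane_configuration :: "nat \<Rightarrow> (nat \<Rightarrow> 'n::finite cpoly) \<Rightarrow> bool" where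
  "hyperplane_configuration m \<alpha> \<longleftrightarrow> (\<forall>i\<in>{1..m}. total_degree (\<alpha> i) = 1)"

text \<open>The coordinate functions at \<open>p\<close> of the affine change of coordinates \<open>x \<mapsto> T (x - p)\<close>.\<close>

definition affine_coord :: "complex ^ 'n ^ 'n \<Rightarrow> complex ^ 'n \<Rightarrow> 'n \<Rightarrow> 'n::finite cpoly" where
  "affine_coord T p k = (\<Sum>j\<in>UNIV. pconst (T $ k $ j) * (pvar j - pconst (p $ j)))"

text \<open>The injection \<open>\<sigma>\<close> selects the new coordinates that are the given equations.\<close>

definition normal_crossing :: "nat \<Rightarrow> (nat \<Rightarrow> 'n::finite cpoly) \<Rightarrow> bool" where
  "normal_crossing m \<alpha> \<longleftrightarrow>
    (\<forall>p. \<forall>I\<subseteq>{1..m}. p \<in> (\<Inter>i\<in>I. zero_locus (\<alpha> i)) \<longrightarrow>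
      (\<exists>T \<sigma>. invertible T \<and> inj_on \<sigma> I \<and> (\<forall>i\<in>I. \<alpha> i = affine_coord T p (\<sigma> i))))"

definition hyperplane_intersection :: "(nat \<Rightarrow> 'n::finite cpoly) \<Rightarrow> nat set \<Rightarrow> (complex ^ 'n) set" where
  "hyperplane_intersection \<alpha> S = (\<Inter>i\<in>S. zero_locus (\<alpha> i))"

section \<open>The module of a configuration\<close>

definition log_form ::
    "nat \<Rightarrow> (nat \<Rightarrow> 'n::linorder cpoly) \<Rightarrow> (nat \<Rightarrow> complex) \<Rightarrow> 'n \<Rightarrow> 'n cpoly fract" where
  "log_form m \<alpha> \<beta> j = (\<Sum>i=1..m. frac_of_poly (pconst (\<beta> i)) * Fract (pderiv j (\<alpha> i)) (\<alpha> i))"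

lemma log_form_closed: "fderiv i (log_form m \<alpha> \<beta> j) = fderiv j (log_form m \<alpha> \<beta> i)"
proof -
  have "fderiv i (Fract (pderiv j a) a) = fderiv j (Fract (pderiv i a) a)" for a :: "'a cpoly"
    by (cases "a = 0")
      (simp_all add: fderiv_Fract fract_collapse pderiv_commute[of i j] mult.commute)
  then show ?thesis by (simp add: log_form_def fderiv_sum fderiv_const_mult)
qed

text \<open>The action on \<open>q \<alpha>\<^sup>\<beta>\<close>, written in terms of the coefficient \<open>q\<close>: by the Leibniz rule,
  \<open>\<partial>\<^sub>j (q \<alpha>\<^sup>\<beta>) = (\<partial>\<^sub>j q + q \<Sum>\<^sub>i \<beta>\<^sub>i \<partial>\<^sub>j(\<alpha>\<^sub>i)/\<alpha>\<^sub>i) \<alpha>\<^sup>\<beta>\<close>.\<close>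

lift_definition weyl_act ::
    "nat \<Rightarrow> (nat \<Rightarrow> 'n::linorder cpoly) \<Rightarrow> (nat \<Rightarrow> complex) \<Rightarrow> 'n weyl \<Rightarrow> 'n cpoly fract \<Rightarrow> 'n cpoly fract"
  is "\<lambda>m \<alpha> \<beta>. wterm_act (log_form m \<alpha> \<beta>)"
  using wterm_act_cong log_form_closed by (intro ext) blast

text \<open>The localization of the polynomial ring at the powers of a nonzero polynomial, inside the field
  of rational functions.\<close>

definition poly_localization :: "'n::linorder cpoly \<Rightarrow> 'n cpoly fract set" where
  "poly_localization a = {Fract f (a ^ k) | f k. True}"

text \<open>The element \<open>q\<close> of the carrier stands for \<open>q \<alpha>\<^sup>\<beta>\<close>; in particular \<open>1\<close> is the free generator
  \<open>\<alpha>\<^sup>\<beta>\<close>.\<close>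

definition config_module ::
    "nat \<Rightarrow> (nat \<Rightarrow> 'n::linorder cpoly) \<Rightarrow> (nat \<Rightarrow> complex) \<Rightarrow> ('n weyl, 'n cpoly fract) module" where
  "config_module m \<alpha> \<beta> = \<lparr>carrier = poly_localization (\<Prod>i=1..m. \<alpha> i), mult = (*), one = 1,
    zero = 0, add = (+), smult = weyl_act m \<alpha> \<beta>\<rparr>"

lemma weyl_act_simps:
  "weyl_act m \<alpha> \<beta> (weyl_const c) q = frac_of_poly (pconst c) * q"
  "weyl_act m \<alpha> \<beta> (weyl_x i) q = frac_of_poly (pvar i) * q"
  "weyl_act m \<alpha> \<beta> (weyl_d j) q = fderiv j q + log_form m \<alpha> \<beta> j * q"
  "weyl_act m \<alpha> \<beta> (P + Q) q = weyl_act m \<alpha> \<beta> P q + weyl_act m \<alpha> \<beta> Q q"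
  "weyl_act m \<alpha> \<beta> (P * Q) q = weyl_act m \<alpha> \<beta> P (weyl_act m \<alpha> \<beta> Q q)"
  "weyl_act m \<alpha> \<beta> 1 q = q"
  "weyl_act m \<alpha> \<beta> 0 q = 0"
  by (transfer; simp)+

lemma weyl_act_add_right: "weyl_act m \<alpha> \<beta> P (q + r) = weyl_act m \<alpha> \<beta> P q + weyl_act m \<alpha> \<beta> P r"
  by transfer (rule wterm_act_add)

lemma weyl_act_sum: "weyl_act m \<alpha> \<beta> (sum f A) q = (\<Sum>a\<in>A. weyl_act m \<alpha> \<beta> (f a) q)"
  by (induction A rule: infinite_finite_induct) (auto simp: weyl_act_simps)

lemma pvar_power: "pvar i ^ k = single (single i k) 1"
  by (induction k) (simp_all add: pvar_def mult_single flip: single_add)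

lemma weyl_act_of_poly:
  fixes p :: "'n::{finite,linorder} cpoly"
  shows "weyl_act m \<alpha> \<beta> (weyl_of_poly p) q = frac_of_poly p * q"
proof -
  have pow: "weyl_act m \<alpha> \<beta> (weyl_x i ^ k) r = frac_of_poly (pvar i ^ k) * r" for i :: 'n and k r
    by (induction k arbitrary: r) (simp_all add: weyl_act_simps frac_of_poly_mult mult.assoc)
  have lst: "weyl_act m \<alpha> \<beta> (prod_list (map (\<lambda>i. weyl_x i ^ lookup e i) is)) r
      = frac_of_poly (prod_list (map (\<lambda>i. pvar i ^ lookup e i) is)) * r"
    for e :: "'n \<Rightarrow>\<^sub>0 nat" and "is" :: "'n list" and r
    by (induction "is" arbitrary: r) (simp_all add: weyl_act_simps frac_of_poly_mult mult.assoc pow)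
  have mon: "prod_list (map (\<lambda>i. pvar i ^ lookup e i) (sorted_list_of_set UNIV)) = single e 1"
    for e :: "'n \<Rightarrow>\<^sub>0 nat"
  proof -
    have "(\<Prod>i\<in>A. single (single i (lookup e i)) (1::complex)) = single (\<Sum>i\<in>A. single i (lookup e i)) 1"
      for A :: "'n set"
      by (induction A rule: infinite_finite_induct) (simp_all add: mult_single)
    moreover have "(\<Sum>i\<in>UNIV. single i (lookup e i)) = e"
      by (rule poly_mapping_eqI) (simp add: lookup_sum lookup_single when_def)
    ultimately have "(\<Prod>i\<in>UNIV. pvar i ^ lookup e i) = single e 1"
      by (simp add: pvar_power)
    then show ?thesis
      by (simp flip: prod.distinct_set_conv_list)
  qed
  have "weyl_act m \<alpha> \<beta> (weyl_of_poly p) q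
      = frac_of_poly (\<Sum>e\<in>keys p. pconst (lookup p e) * single e 1) * q"
    by (simp add: weyl_of_poly_def weyl_act_sum weyl_act_simps lst mon frac_of_poly_sum
        frac_of_poly_mult sum_distrib_right mult.assoc)
  also have "(\<Sum>e\<in>keys p. pconst (lookup p e) * single e 1) = p"
    by (simp add: pconst_def mult_single flip: cpoly_sum_single)
  finally show ?thesis .
qed

lemma poly_localization_add:
  assumes "a \<noteq> 0" "q \<in> poly_localization a" "r \<in> poly_localization a"
  shows "q + r \<in> poly_localization a"
proof -
  obtain f k g l where "q = Fract f (a ^ k)" "r = Fract g (a ^ l)"
    using assms by (auto simp: poly_localization_def)
  then have "q + r = Fract (f * a ^ l + g * a ^ k) (a ^ (k + l))"
    using assms(1) by (simp add: power_add)
  then show ?thesis unfolding poly_localization_def by blast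
qed

lemma poly_localization_mult:
  assumes "q \<in> poly_localization a" "r \<in> poly_localization a"
  shows "q * r \<in> poly_localization a"
proof -
  obtain f k g l where "q = Fract f (a ^ k)" "r = Fract g (a ^ l)"
    using assms by (auto simp: poly_localization_def)
  then have "q * r = Fract (f * g) (a ^ (k + l))"
    by (simp add: power_add)
  then show ?thesis unfolding poly_localization_def by blast
qed

lemma poly_localization_poly: "frac_of_poly f \<in> poly_localization a"
  unfolding poly_localization_def frac_of_poly_def by (auto intro!: exI[of _ f] exI[of _ "0::nat"])

lemma poly_localization_fderiv:
  assumes "a \<noteq> 0" "q \<in> poly_localization a"
  shows "fderiv j q \<in> poly_localization a"
proof -
  obtain f k where "q = Fract f (a ^ k)"
    using assms by (auto simp: poly_localization_def)
  then have "fderiv j q = Fract (pderiv j f * a ^ k - f * pderiv j (a ^ k)) (a ^ (k + k))"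
    using assms(1) by (simp add: fderiv_Fract power_add)
  then show ?thesis unfolding poly_localization_def by blast
qed

lemma poly_localization_sum:
  assumes "a \<noteq> 0" "\<And>i. i \<in> A \<Longrightarrow> g i \<in> poly_localization a"
  shows "sum g A \<in> poly_localization a"
  using assms(2)
proof (induction A rule: infinite_finite_induct)
  case (insert i A)
  then show ?case by (simp add: poly_localization_add[OF assms(1)])
qed (use poly_localization_poly[of 0 a] in auto)

lemma poly_localization_log_form:
  assumes "(\<Prod>i=1..m. \<alpha> i) \<noteq> 0"
  shows "log_form m \<alpha> \<beta> j \<in> poly_localization (\<Prod>i=1..m. \<alpha> i)"
  unfolding log_form_def
proof (intro poly_localization_sum[OF assms] poly_localization_mult poly_localization_poly)
  fix i assume i: "i \<in> {1..m}"
  let ?c = "\<Prod>i\<in>{1..m} - {i}. \<alpha> i"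
  have a: "(\<Prod>i=1..m. \<alpha> i) = ?c * \<alpha> i"
    using i by (simp add: prod.remove mult.commute)
  with assms have "?c \<noteq> 0" by auto
  then have "Fract (pderiv j (\<alpha> i)) (\<alpha> i) = Fract (?c * pderiv j (\<alpha> i)) ((\<Prod>i=1..m. \<alpha> i) ^ 1)"
    unfolding a by (simp add: mult_fract_cancel)
  then show "Fract (pderiv j (\<alpha> i)) (\<alpha> i) \<in> poly_localization (\<Prod>i=1..m. \<alpha> i)"
    unfolding poly_localization_def by blast
qed

lemma poly_localization_weyl_act:
  assumes "(\<Prod>i=1..m. \<alpha> i) \<noteq> 0" "q \<in> poly_localization (\<Prod>i=1..m. \<alpha> i)"
  shows "weyl_act m \<alpha> \<beta> P q \<in> poly_localization (\<Prod>i=1..m. \<alpha> i)"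
proof -
  have "wterm_act (log_form m \<alpha> \<beta>) t r \<in> poly_localization (\<Prod>i=1..m. \<alpha> i)"
    if "r \<in> poly_localization (\<Prod>i=1..m. \<alpha> i)" for t r
    using that
    by (induction t arbitrary: r)
      (auto intro!: poly_localization_add[OF assms(1)] poly_localization_mult poly_localization_poly
        poly_localization_fderiv[OF assms(1)] poly_localization_log_form[OF assms(1)] simp del: One_nat_def)
  then show ?thesis
    using assms(2) by transfer auto
qed

lemma left_module_config_module:
  assumes "(\<Prod>i=1..m. \<alpha> i) \<noteq> 0"
  shows "left_module (config_module m \<alpha> \<beta>)"
proof -
  let ?a = "\<Prod>i=1..m. \<alpha> i"
  have zero: "0 \<in> poly_localization ?a"
    using poly_localization_poly[of 0 ?a] by simp
  have neg: "- q \<in> poly_localization ?a" if "q \<in> poly_localization ?a" for q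
    using poly_localization_mult[OF poly_localization_poly[of "pconst (- 1)"] that]
    by (simp add: frac_of_poly_pconst_minus_one del: One_nat_def)
  let ?M = "config_module m \<alpha> \<beta>"
  have M: "carrier ?M = poly_localization ?a" "zero ?M = 0" "add ?M = (+)"
      "smult ?M = weyl_act m \<alpha> \<beta>"
    by (simp_all add: config_module_def)
  have "abelian_group ?M"
  proof (rule abelian_groupI)
    show "\<exists>r\<in>carrier ?M. r \<oplus>\<^bsub>?M\<^esub> q = \<zero>\<^bsub>?M\<^esub>" if "q \<in> carrier ?M" for q
      using that by (intro bexI[of _ "- q"]) (auto simp: M neg simp del: One_nat_def)
  qed (use zero in \<open>auto simp: M poly_localization_add[OF assms] add_ac
      simp del: One_nat_def\<close>)
  moreover have "left_module_axioms ?M"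
    by unfold_locales
      (simp_all add: M poly_localization_weyl_act[OF assms] weyl_act_simps weyl_act_add_right
        del: One_nat_def)
  ultimately show ?thesis
    by (rule left_module.intro)
qed

end

theory Submission
  imports Defs
begin

text \<open>
  The elements of the module are sums of \<open>f \<alpha>\<^sup>a \<cdot> \<alpha>\<^sup>\<beta>\<close> with a polynomial \<open>f\<close> and
  \<open>\<alpha>\<^sup>a = \<Prod>\<^sub>i \<alpha>\<^sub>i ^ a\<^sub>i\<close>, \<open>a \<in> \<int>\<^sup>m\<close>. A constant vector field \<open>v\<close> maps this to
  \<open>(v(f) \<alpha>\<^sup>a + \<Sum>\<^sub>i (a\<^sub>i + \<beta>\<^sub>i) v(\<alpha>\<^sub>i) f \<alpha>\<^sup>a / \<alpha>\<^sub>i) \<cdot> \<alpha>\<^sup>\<beta>\<close> (\<open>nabla_alpha_pow\<close>), and the proof is about the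
  factors \<open>a\<^sub>i + \<beta>\<^sub>i\<close>. If \<open>\<beta>\<^sub>i\<close> is not an integer, they never vanish, so that the exponent of \<open>\<alpha>\<^sub>i\<close> can always
  be lowered. If \<open>\<beta>\<^sub>i\<close> is an integer, say that there is a pole along \<open>H\<^sub>i\<close> when \<open>a\<^sub>i + \<beta>\<^sub>i < 0\<close>; the factor
  vanishes exactly at the exponent where differentiation would create a pole. Hence for every
  family \<open>F\<close> of sets of integral indices, the elements whose sets of poles belong to \<open>F\<close> span a submodule
  \<open>polar F\<close>.

  Adding to \<open>F\<close>, one at a time and in the order of their cardinality, the sets \<open>T\<close> of integral indices
  with nonempty \<open>H\<^sub>T\<close> gives a chain of submodules. It ends with the whole module, because poles along
  hyperplanes without a common point can be separated by partial fractions
  (\<open>polar_nonempty_flats\<close>). The step that adds \<open>T\<close> is simple with support \<open>H\<^sub>T\<close>, and \<open>T\<close> is determined by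
  \<open>H\<^sub>T\<close> (\<open>flat_inject\<close>). So the chain is a composition series (\<open>pole_filtration\<close>) in which \<open>H\<^sub>S\<close> is the support
  of exactly one factor if all \<open>\<beta>\<^sub>i\<close> with \<open>i \<in> S\<close> are integers, and of none otherwise. In every other
  composition series the supports are the same with multiplicities, by the argument of Jordan and
  Hoelder (\<open>card_support_le\<close>).

  Simplicity (\<open>all_or_nothing\<close>): let a submodule contain a nonzero class of the step. Normal crossings
  provide constant vector fields dual to the \<open>\<alpha>\<^sub>i\<close> with \<open>i \<in> T\<close>, and with them the class is brought to
  simple poles along \<open>T\<close>; derivatives tangent to \<open>H\<^sub>T\<close> and the Euler field then reduce the numerator to a
  constant. From such an element everything in the step is recovered: the nonintegral exponents are
  lowered, where a Nullstellensatz for products of affine linear polynomials replaces a choice of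
  local coordinates, and the poles along \<open>T\<close> are raised.

  Support (\<open>step_support_polar\<close>): powers of \<open>\<alpha>\<^sub>i\<close> with \<open>i \<in> T\<close> kill the classes of the step. Conversely, if
  \<open>w\<close> killed a class with simple poles along \<open>T\<close> and numerator \<open>1\<close>, then after clearing denominators
  \<open>w\<close> times a product of the other equations would vanish on \<open>H\<^sub>T\<close>, since the \<open>\<alpha>\<^sub>i\<close> with \<open>i \<in> T\<close> behave
  like variables. As \<open>H\<^sub>T\<close> is irreducible, \<open>w\<close> vanishes at every point of \<open>H\<^sub>T\<close>.
\<close>

section \<open>Polynomials: evaluation, degree, directional derivatives\<close>

lemma peval_superset:
  assumes "finite A" "keys f \<subseteq> A"
  shows "peval x f = (\<Sum>e\<in>A. lookup f e * (\<Prod>i\<in>UNIV. (x $ i) ^ lookup e i))"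
  unfolding peval_def
  by (rule sum.mono_neutral_left) (use assms in \<open>auto simp: in_keys_iff\<close>)

lemma peval_zero [simp]: "peval x 0 = 0"
  by (simp add: peval_def)

lemma peval_single: "peval x (single e c) = c * (\<Prod>i\<in>UNIV. (x $ i) ^ lookup e i)"
  by (subst peval_superset[of "{e}"]) (auto split: if_splits)

lemma peval_add: "peval x (f + g) = peval x f + peval x g"
proof -
  let ?A = "keys f \<union> keys g"
  have "keys (f + g) \<subseteq> ?A" by (rule keys_add)
  then show ?thesis
    by (simp add: peval_superset[of ?A] lookup_add algebra_simps sum.distrib)
qed

lemma peval_sum: "peval x (sum f A) = (\<Sum>a\<in>A. peval x (f a))"
  by (induction A rule: infinite_finite_induct) (auto simp: peval_add)

lemma peval_mult: "peval x (f * g) = peval x f * peval x g"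
proof -
  let ?s = "\<lambda>p e. single e (lookup p e)"
  have s: "peval x (single a c * single b d) = peval x (single a c) * peval x (single b d)"
    for a b c d
    by (simp add: mult_single peval_single lookup_add power_add prod.distrib)
  have "f * g = (\<Sum>a\<in>keys f. \<Sum>b\<in>keys g. ?s f a * ?s g b)"
    by (subst cpoly_sum_single[of f], subst cpoly_sum_single[of g]) (simp add: sum_product)
  then have "peval x (f * g)
      = peval x (\<Sum>a\<in>keys f. ?s f a) * peval x (\<Sum>b\<in>keys g. ?s g b)"
    by (simp add: peval_sum s sum_product)
  then show ?thesis by (simp flip: cpoly_sum_single)
qed

lemma peval_const [simp]: "peval x (pconst c) = c"
  by (simp add: pconst_def peval_single)

lemma peval_one [simp]: "peval x 1 = 1"
  using peval_const[of x 1] by simp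

lemma peval_var [simp]: "peval x (pvar k) = x $ k"
proof -
  have "(\<Prod>i\<in>UNIV. (x $ i) ^ lookup (single k 1) i) = (\<Prod>i\<in>{k}. x $ i)"
    by (rule prod.mono_neutral_cong_right) (auto simp: lookup_single when_def)
  then show ?thesis by (simp add: pvar_def peval_single)
qed

lemma peval_power: "peval x (f ^ k) = peval x f ^ k"
  by (induction k) (auto simp: peval_mult)

lemma peval_prod: "peval x (prod f A) = (\<Prod>a\<in>A. peval x (f a))"
  by (induction A rule: infinite_finite_induct) (auto simp: peval_mult)

lemma pconst_inject [simp]: "pconst a = pconst b \<longleftrightarrow> a = b"
  unfolding pconst_def by (metis lookup_single_eq)

lemma pconst_eq_0_iff [simp]: "pconst a = 0 \<longleftrightarrow> a = 0"
  using pconst_inject[of a 0] by simp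

lemma pconst_sum: "pconst (sum f A) = (\<Sum>a\<in>A. pconst (f a))"
  by (induction A rule: infinite_finite_induct) (auto simp: pconst_add)

lemma pconst_minus: "pconst (- c) = - pconst c"
  by (simp add: pconst_def single_uminus)

lemma pconst_diff: "pconst (c - d) = pconst c - pconst d"
  using pconst_add[of c "- d"] by (simp add: pconst_minus)

lemma total_degree_le_iff:
  "total_degree f \<le> d \<longleftrightarrow> (\<forall>e\<in>keys f. (\<Sum>i\<in>UNIV. lookup e i) \<le> d)"
  unfolding total_degree_def by (subst Max_le_iff) auto

lemma total_degree_add:
  assumes "total_degree f \<le> d" "total_degree g \<le> d"
  shows "total_degree (f + g) \<le> d"
  using assms keys_add[of f g] unfolding total_degree_le_iff by blast

lemma total_degree_sum:
  assumes "\<And>a. a \<in> A \<Longrightarrow> total_degree (f a) \<le> d"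
  shows "total_degree (sum f A) \<le> d"
  using assms
  by (induction A rule: infinite_finite_induct) (auto simp: total_degree_add, auto simp: total_degree_def)

lemma total_degree_single:
  assumes "c = 0 \<or> (\<Sum>i\<in>UNIV. lookup e i) \<le> d"
  shows "total_degree (single e c) \<le> d"
  using assms unfolding total_degree_le_iff by (auto split: if_splits)

lemma total_degree_const_mult:
  assumes "total_degree f \<le> d"
  shows "total_degree (pconst c * f) \<le> d"
proof -
  have "pconst c * f = (\<Sum>e\<in>keys f. single e (c * lookup f e))"
    by (subst cpoly_sum_single[of f]) (simp add: sum_distrib_left pconst_def mult_single)
  moreover have "total_degree (\<Sum>e\<in>keys f. single e (c * lookup f e)) \<le> d"
    by (intro total_degree_sum total_degree_single) (use assms in \<open>auto simp: total_degree_le_iff\<close>)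
  ultimately show ?thesis by simp
qed

lemma exponent_degree_diff:
  fixes e :: "'n::finite \<Rightarrow>\<^sub>0 nat"
  assumes "lookup e j \<noteq> 0"
  shows "(\<Sum>i\<in>UNIV. lookup e i) = Suc (\<Sum>i\<in>UNIV. lookup (e - single j 1) i)"
proof -
  have "lookup e i = lookup (e - single j 1) i + (if j = i then 1 else 0)" for i
    using assms by (auto simp: lookup_minus lookup_single when_def)
  then have "(\<Sum>i\<in>UNIV. lookup e i) = (\<Sum>i\<in>UNIV. lookup (e - single j 1) i + (if j = i then 1 else 0))"
    by (rule sum.cong[OF HOL.refl])
  then show ?thesis by (simp add: sum.distrib)
qed

lemma total_degree_pderiv:
  assumes "total_degree f \<le> Suc d"
  shows "total_degree (pderiv j f) \<le> d"
  unfolding pderiv_def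
proof (rule total_degree_sum, rule total_degree_single)
  fix e assume "e \<in> keys f"
  then have "(\<Sum>i\<in>UNIV. lookup e i) \<le> Suc d" using assms by (simp add: total_degree_le_iff)
  then show "of_nat (lookup e j) * lookup f e = 0 \<or> (\<Sum>i\<in>UNIV. lookup (e - single j 1) i) \<le> d"
    using exponent_degree_diff[of e j] by (cases "lookup e j = 0") auto
qed

lemma total_degree_0:
  assumes "total_degree f \<le> 0"
  shows "\<exists>c. f = pconst c"
proof -
  have "e = 0" if "e \<in> keys f" for e
    using assms that unfolding total_degree_le_iff by (intro poly_mapping_eqI) auto
  then have "keys f \<subseteq> {0}" by auto
  then have "f = single 0 (lookup f 0)"
    by (intro poly_mapping_eqI) (auto simp: lookup_single when_def in_keys_iff)
  then show ?thesis unfolding pconst_def by blast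
qed

text \<open>The Euler field centred at \<open>p\<close> multiplies the leading form of degree \<open>d\<close> by \<open>d\<close>. So it turns
  information on the first derivatives of \<open>f\<close> into information on \<open>f\<close> itself, up to lower degree.\<close>

definition euler :: "complex ^ 'n \<Rightarrow> 'n::finite cpoly \<Rightarrow> 'n cpoly" where
  "euler p f = (\<Sum>j\<in>UNIV. (pvar j - pconst (p $ j)) * pderiv j f)"

lemma total_degree_euler:
  fixes f :: "'n::finite cpoly"
  assumes "total_degree f \<le> Suc d"
  shows "total_degree (pconst (of_nat (Suc d)) * f - euler p f) \<le> d"
proof -
  have var: "pvar j * pderiv j (single e c) = single e (of_nat (lookup e j) * c)"
    for j :: 'n and e and c
  proof (cases "lookup e j = 0")
    case False
    then have "single j 1 + (e - single j 1) = e"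
      by (intro poly_mapping_eqI) (auto simp: lookup_add lookup_minus lookup_single when_def)
    then show ?thesis by (simp add: pvar_def pderiv_single mult_single)
  qed (simp add: pderiv_single)
  have "(\<Sum>j\<in>UNIV. pvar j * pderiv j f)
      = (\<Sum>j\<in>UNIV. \<Sum>e\<in>keys f. pvar j * pderiv j (single e (lookup f e)))"
    by (simp flip: sum_distrib_left pderiv_sum cpoly_sum_single)
  also have "\<dots> = (\<Sum>e\<in>keys f. \<Sum>j\<in>UNIV. single e (of_nat (lookup e j) * lookup f e))"
    by (subst sum.swap) (simp add: var)
  also have "\<dots> = (\<Sum>e\<in>keys f. single e (of_nat (\<Sum>j\<in>UNIV. lookup e j) * lookup f e))"
  proof (rule sum.cong[OF HOL.refl])
    fix e
    have "(\<Sum>j\<in>A. single e (of_nat (lookup e j) * lookup f e))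
        = single e (of_nat (\<Sum>j\<in>A. lookup e j) * lookup f e)" for A :: "'n set"
      by (induction A rule: infinite_finite_induct) (simp_all add: algebra_simps single_add)
    then show "(\<Sum>j\<in>UNIV. single e (of_nat (lookup e j) * lookup f e))
        = single e (of_nat (\<Sum>j\<in>UNIV. lookup e j) * lookup f e)" .
  qed
  finally have E: "(\<Sum>j\<in>UNIV. pvar j * pderiv j f)
      = (\<Sum>e\<in>keys f. single e (of_nat (\<Sum>j\<in>UNIV. lookup e j) * lookup f e))" .
  have "pconst (of_nat (Suc d)) * f = (\<Sum>e\<in>keys f. single e (of_nat (Suc d) * lookup f e))"
    by (subst cpoly_sum_single[of f]) (simp only: sum_distrib_left pconst_def mult_single add_0)
  then have "pconst (of_nat (Suc d)) * f - (\<Sum>j\<in>UNIV. pvar j * pderiv j f)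
      = (\<Sum>e\<in>keys f. single e ((of_nat (Suc d) - of_nat (\<Sum>j\<in>UNIV. lookup e j)) * lookup f e))"
    by (simp only: E sum_subtractf[symmetric] single_diff[symmetric] left_diff_distrib)
  moreover have "total_degree (single e
      ((of_nat (Suc d) - of_nat (\<Sum>j\<in>UNIV. lookup e j)) * lookup f e)) \<le> d" if "e \<in> keys f" for e
  proof -
    have "(\<Sum>i\<in>UNIV. lookup e i) \<le> Suc d" using assms that by (simp add: total_degree_le_iff)
    then show ?thesis
      by (cases "(\<Sum>i\<in>UNIV. lookup e i) = Suc d") (auto intro!: total_degree_single simp: total_degree_le_iff[of 0] simp del: of_nat_Suc)
  qed
  ultimately have "total_degree (pconst (of_nat (Suc d)) * f - (\<Sum>j\<in>UNIV. pvar j * pderiv j f)) \<le> d"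
    by (simp only: total_degree_sum)
  moreover have "total_degree (\<Sum>j\<in>UNIV. pconst (p $ j) * pderiv j f) \<le> d"
    by (intro total_degree_sum total_degree_const_mult total_degree_pderiv assms)
  ultimately have "total_degree ((pconst (of_nat (Suc d)) * f - (\<Sum>j\<in>UNIV. pvar j * pderiv j f))
      + (\<Sum>j\<in>UNIV. pconst (p $ j) * pderiv j f)) \<le> d"
    by (rule total_degree_add)
  then show ?thesis by (simp add: euler_def left_diff_distrib sum_subtractf algebra_simps)
qed

definition pdir :: "complex ^ 'n \<Rightarrow> 'n::finite cpoly \<Rightarrow> 'n cpoly" where
  "pdir v f = (\<Sum>j\<in>UNIV. pconst (v $ j) * pderiv j f)"

text \<open>For an affine linear \<open>f\<close> this is the constant \<open>pdir v f\<close>.\<close>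

definition slope :: "complex ^ 'n \<Rightarrow> 'n::finite cpoly \<Rightarrow> complex" where
  "slope v f = (\<Sum>j\<in>UNIV. v $ j * lookup f (single j 1))"

lemma pdir_add: "pdir v (f + g) = pdir v f + pdir v g"
  by (simp add: pdir_def pderiv_add ring_distribs sum.distrib)

lemma pdir_zero [simp]: "pdir v 0 = 0"
  by (simp add: pdir_def)

lemma pdir_one [simp]: "pdir v 1 = 0"
  by (simp add: pdir_def)

lemma pdir_mult: "pdir v (f * g) = pdir v f * g + f * pdir v g"
  by (simp add: pdir_def pderiv_mult ring_distribs sum.distrib sum_distrib_left sum_distrib_right
      mult.assoc mult.left_commute)

lemma pdir_sum: "pdir v (sum f A) = (\<Sum>a\<in>A. pdir v (f a))"
  by (induction A rule: infinite_finite_induct) (auto simp: pdir_add)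

lemma total_degree_pdir:
  assumes "total_degree f \<le> Suc d"
  shows "total_degree (pdir v f) \<le> d"
  unfolding pdir_def by (intro total_degree_sum total_degree_const_mult total_degree_pderiv assms)

lemma slope_diff: "slope (v - w) f = slope v f - slope w f"
  by (simp add: slope_def algebra_simps sum_subtractf)

lemma slope_scale: "slope (c *s v) f = c * slope v f"
  by (simp add: slope_def sum_distrib_left mult.assoc)

lemma slope_sum: "slope (\<Sum>i\<in>A. v i) f = (\<Sum>i\<in>A. slope (v i) f)"
  by (simp add: slope_def sum_component sum_distrib_right) (rule sum.swap)

lemma slope_axis: "slope (axis j 1) f = lookup f (single j 1)"
proof -
  have "slope (axis j 1) f = (\<Sum>k\<in>UNIV. if k = j then lookup f (single k 1) else 0)"
    unfolding slope_def by (rule sum.cong) (auto simp: axis_def)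
  then show ?thesis by simp
qed

lemma pdir_diff: "pdir (v - w) f = pdir v f - pdir w f"
  by (simp add: pdir_def pconst_diff algebra_simps sum_subtractf)

lemma pdir_scale: "pdir (c *s v) f = pconst c * pdir v f"
  by (simp add: pdir_def pconst_mult sum_distrib_left mult.assoc)

lemma pdir_vector_sum: "pdir (\<Sum>i\<in>A. v i) f = (\<Sum>i\<in>A. pdir (v i) f)"
  by (simp add: pdir_def sum_component pconst_sum sum_distrib_right) (rule sum.swap)

lemma pdir_axis: "pdir (axis j 1) f = pderiv j f"
proof -
  have "pdir (axis j 1) f = (\<Sum>k\<in>UNIV. if k = j then pderiv k f else 0)"
    unfolding pdir_def by (rule sum.cong) (auto simp: axis_def)
  then show ?thesis by simp
qed

lemma pdir_power: "pdir v (f ^ Suc k) = of_nat (Suc k) * f ^ k * pdir v f"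
  by (induction k) (simp_all add: pdir_mult algebra_simps)

lemma pdir_prod_zero: "(\<And>a. a \<in> A \<Longrightarrow> pdir v (f a) = 0) \<Longrightarrow> pdir v (prod f A) = 0"
  by (induction A rule: infinite_finite_induct) (auto simp: pdir_mult)

lemma affine_form:
  fixes f :: "'n::finite cpoly"
  assumes "total_degree f \<le> 1"
  shows "f = pconst (lookup f 0) + (\<Sum>j\<in>UNIV. pconst (lookup f (single j 1)) * pvar j)"
proof -
  have e: "e = 0 \<or> e \<in> range (\<lambda>j. single j 1)" if "e \<in> keys f" for e
  proof -
    have "(\<Sum>i\<in>UNIV. lookup e i) \<le> 1" using assms that by (simp add: total_degree_le_iff)
    then consider "(\<Sum>i\<in>UNIV. lookup e i) = 0" | "(\<Sum>i\<in>UNIV. lookup e i) = 1" by linarith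
    then show ?thesis
    proof cases
      case 1
      then show ?thesis by (intro disjI1 poly_mapping_eqI) auto
    next
      case 2
      then obtain j where j: "lookup e j = 1" "\<forall>i. i \<noteq> j \<longrightarrow> lookup e i = 0"
        by (subst (asm) sum_eq_1_iff) auto
      then have "e = single j 1"
        by (intro poly_mapping_eqI) (auto simp: lookup_single when_def)
      then show ?thesis by auto
    qed
  qed
  have inj: "inj (\<lambda>j::'n. single j (1::nat))"
    by (rule injI) (metis lookup_single_eq lookup_single_not_eq zero_neq_one)
  have z: "(0 :: 'n \<Rightarrow>\<^sub>0 nat) \<notin> range (\<lambda>j. single j 1)"
    by (auto dest: arg_cong[of _ _ "\<lambda>e. keys e"])
  have "f = (\<Sum>e\<in>insert 0 (range (\<lambda>j. single j 1)). single e (lookup f e))"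
    by (subst cpoly_sum_single, rule sum.mono_neutral_left) (use e in \<open>auto simp: in_keys_iff\<close>)
  also have "\<dots> = single 0 (lookup f 0) + (\<Sum>j\<in>UNIV. single (single j 1) (lookup f (single j 1)))"
    using z inj by (simp add: sum.reindex del: One_nat_def)
  finally show ?thesis by (simp add: pconst_def pvar_def mult_single)
qed

lemma pderiv_affine:
  assumes "total_degree f \<le> 1"
  shows "pderiv j f = pconst (lookup f (single j 1))"
proof -
  have "pderiv j f
      = pderiv j (pconst (lookup f 0) + (\<Sum>k\<in>UNIV. pconst (lookup f (single k 1)) * pvar k))"
    using affine_form[OF assms] by simp
  also have "\<dots> = (\<Sum>k\<in>UNIV. pconst (lookup f (single k 1)) * (if k = j then 1 else 0))"
    by (simp add: pderiv_add pderiv_sum pderiv_mult pderiv_var del: One_nat_def)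
  also have "\<dots> = (\<Sum>k\<in>UNIV. if k = j then pconst (lookup f (single k 1)) else 0)"
    by (rule sum.cong) auto
  finally show ?thesis by simp
qed

lemma pdir_affine:
  assumes "total_degree f \<le> 1"
  shows "pdir v f = pconst (slope v f)"
  by (simp add: pdir_def slope_def pderiv_affine[OF assms] pconst_sum pconst_mult)

lemma peval_affine:
  assumes "total_degree f \<le> 1"
  shows "peval x f = lookup f 0 + slope x f"
proof -
  have "peval x f
      = peval x (pconst (lookup f 0) + (\<Sum>k\<in>UNIV. pconst (lookup f (single k 1)) * pvar k))"
    using affine_form[OF assms] by simp
  then show ?thesis
    by (simp add: peval_add peval_sum peval_mult slope_def mult.commute)
qed

lemma peval_affine_line:
  assumes "total_degree f \<le> 1"
  shows "peval (x + t *s v) f = peval x f + t * slope v f"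
  by (simp add: peval_affine[OF assms] slope_def sum.distrib algebra_simps sum_distrib_left)

lemma affine_form_at:
  fixes f :: "'n::finite cpoly"
  assumes "total_degree f \<le> 1" "peval p f = 0"
  shows "f = (\<Sum>j\<in>UNIV. pconst (lookup f (single j 1)) * (pvar j - pconst (p $ j)))"
proof -
  have "lookup f 0 = - slope p f" using peval_affine[OF assms(1), of p] assms(2) by (simp add: eq_neg_iff_add_eq_0)
  then have "pconst (lookup f 0) = - (\<Sum>j\<in>UNIV. pconst (lookup f (single j 1)) * pconst (p $ j))"
    by (simp add: pconst_minus slope_def pconst_sum pconst_mult mult.commute)
  then have "pconst (lookup f 0) + (\<Sum>j\<in>UNIV. pconst (lookup f (single j 1)) * pvar j)
      = (\<Sum>j\<in>UNIV. pconst (lookup f (single j 1)) * (pvar j - pconst (p $ j)))"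
    by (simp add: right_diff_distrib sum_subtractf del: One_nat_def)
  then show ?thesis
    using affine_form[OF assms(1)] by simp
qed

section \<open>A Nullstellensatz for products of affine linear polynomials\<close>

text \<open>The coordinates of \<open>p\<close> are found one at a time: if \<open>x\<^sub>k - c\<close> lies in \<open>W\<close> for some \<open>c\<close>, this \<open>c\<close>
  is forced, and otherwise \<open>1\<close> is not a combination of \<open>W\<close> and \<open>x\<^sub>k\<close>, so that \<open>x\<^sub>k\<close> may be added to
  \<open>W\<close>. Once all \<open>x\<^sub>k - p\<^sub>k\<close> have been added, an affine polynomial in \<open>W\<close> is congruent to its value at
  \<open>p\<close>.\<close>

lemma affine_common_zero:
  fixes W :: "'n::finite cpoly set"
  assumes W: "0 \<in> W" "\<And>f g. f \<in> W \<Longrightarrow> g \<in> W \<Longrightarrow> f + g \<in> W" "\<And>c f. f \<in> W \<Longrightarrow> pconst c * f \<in> W"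
    and one: "1 \<notin> W"
  shows "\<exists>p. \<forall>f\<in>W. total_degree f \<le> 1 \<longrightarrow> peval p f = 0"
proof -
  define sub where "sub V \<longleftrightarrow> W \<subseteq> V \<and> 0 \<in> V \<and> (\<forall>f\<in>V. \<forall>g\<in>V. f + g \<in> V) \<and>
    (\<forall>c. \<forall>f\<in>V. pconst c * f \<in> V) \<and> 1 \<notin> V" for V :: "'n cpoly set"
  have "\<exists>V. sub V \<and> (\<forall>k\<in>X. \<exists>c. pvar k - pconst c \<in> V)" for X :: "'n set"
    using finite[of X]
  proof (induction X)
    case empty
    have "sub W" using assms unfolding sub_def by blast
    then show ?case by auto
  next
    case (insert k X)
    then obtain V where V: "sub V" "\<forall>k\<in>X. \<exists>c. pvar k - pconst c \<in> V" by blast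
    show ?case
    proof (cases "\<exists>c. pvar k - pconst c \<in> V")
      case True
      then show ?thesis using V by blast
    next
      case False
      define V' where "V' = {f + pconst c * pvar k | f c. f \<in> V}"
      have VV': "V \<subseteq> V'"
      proof
        fix f assume "f \<in> V"
        then show "f \<in> V'" unfolding V'_def by (intro CollectI exI[of _ f] exI[of _ 0]) simp
      qed
      have "1 \<notin> V'"
      proof
        assume "1 \<in> V'"
        then obtain f c where f: "f \<in> V" "1 = f + pconst c * pvar k" by (auto simp: V'_def)
        have "c \<noteq> 0" using f V(1) by (auto simp: sub_def)
        \<comment> \<open>So \<open>x\<^sub>k\<close> would be congruent to a constant after all.\<close>
        have "pvar k - pconst (1 / c) = pconst (- (1 / c)) * f"
        proof -
          have "pconst (1 / c) * f + pvar k = pconst (1 / c) * (f + pconst c * pvar k)"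
            using \<open>c \<noteq> 0\<close> by (simp add: ring_distribs pconst_mult[symmetric] mult.assoc[symmetric])
          also have "\<dots> = pconst (1 / c)" using f(2) by simp
          finally show ?thesis by (simp add: pconst_minus eq_diff_eq algebra_simps)
        qed
        then show False using V(1) f(1) False unfolding sub_def by metis
      qed
      moreover have "f + g \<in> V'" if fg: "f \<in> V'" "g \<in> V'" for f g
      proof -
        obtain f1 c where "f1 \<in> V" "f = f1 + pconst c * pvar k"
          using fg(1) unfolding V'_def by blast
        moreover obtain f2 d where "f2 \<in> V" "g = f2 + pconst d * pvar k"
          using fg(2) unfolding V'_def by blast
        ultimately show ?thesis using V(1) unfolding V'_def sub_def
          by (intro CollectI exI[of _ "f1 + f2"] exI[of _ "c + d"]) (auto simp: pconst_add algebra_simps)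
      qed
      moreover have "pconst d * f \<in> V'" if fV: "f \<in> V'" for f d
      proof -
        obtain f1 c where "f1 \<in> V" "f = f1 + pconst c * pvar k"
          using fV unfolding V'_def by blast
        then show ?thesis using V(1) unfolding V'_def sub_def
          by (intro CollectI exI[of _ "pconst d * f1"] exI[of _ "d * c"]) (auto simp: pconst_mult algebra_simps)
      qed
      ultimately have "sub V'" using VV' V(1) unfolding sub_def by blast
      moreover have "pvar k - pconst 0 \<in> V'"
      proof -
        have "0 \<in> V" using V(1) by (simp add: sub_def)
        then show ?thesis unfolding V'_def by (intro CollectI exI[of _ 0] exI[of _ 1]) simp
      qed
      ultimately show ?thesis using V(2) VV' by blast
    qed
  qed
  then obtain V where V: "sub V" "\<forall>k\<in>UNIV. \<exists>c. pvar k - pconst c \<in> V" by blast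
  from bchoice[OF V(2)] obtain p' where p': "\<And>k. pvar k - pconst (p' k) \<in> V" by blast
  define p where "p = (\<chi> k. p' k)"
  have sum: "sum h A \<in> V" if "\<And>a. a \<in> A \<Longrightarrow> h a \<in> V" for h and A :: "'n set"
    using that by (induction A rule: infinite_finite_induct) (use V(1) in \<open>auto simp: sub_def\<close>)
  have "peval p f = 0" if f: "f \<in> W" "total_degree f \<le> 1" for f
  proof (rule ccontr)
    assume nz: "peval p f \<noteq> 0"
    define g where "g = (\<Sum>j\<in>UNIV. pconst (lookup f (single j 1)) * (pvar j - pconst (p $ j)))"
    have "g \<in> V" unfolding g_def
      by (rule sum) (use V(1) p' in \<open>auto simp: sub_def p_def\<close>)
    then have "f + pconst (- 1) * g \<in> V"
      using V(1) f(1) unfolding sub_def by blast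
    moreover have "f + pconst (- 1) * g = pconst (peval p f)"
    proof -
      have "f - g = pconst (lookup f 0) + (\<Sum>j\<in>UNIV. pconst (lookup f (single j 1)) * pconst (p $ j))"
        by (subst (1) affine_form[OF f(2)])
          (simp add: g_def right_diff_distrib sum_subtractf del: One_nat_def)
      then show ?thesis
        by (simp add: peval_affine[OF f(2)] pconst_minus pconst_add slope_def pconst_sum pconst_mult mult.commute)
    qed
    ultimately have "pconst (1 / peval p f) * pconst (peval p f) \<in> V"
      using V(1) by (simp add: sub_def)
    then show False using nz V(1) by (simp add: pconst_mult[symmetric] sub_def)
  qed
  then show ?thesis by blast
qed

definition poly_ideal :: "'n cpoly set \<Rightarrow> bool" where
  "poly_ideal J \<longleftrightarrow> 0 \<in> J \<and> (\<forall>f\<in>J. \<forall>g\<in>J. f + g \<in> J) \<and> (\<forall>f. \<forall>g\<in>J. f * g \<in> J)"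

text \<open>Induction on \<open>I\<close>: an \<open>\<alpha>\<^sub>i\<close> that generates a proper ideal together with \<open>J\<close> is added to \<open>J\<close>, and any
  other \<open>\<alpha>\<^sub>i\<close> is invertible modulo \<open>J\<close> and can be cancelled from all products. In the end only the
  affine polynomials in \<open>J\<close> matter.\<close>

lemma affine_products_common_zero:
  fixes \<alpha> :: "'i \<Rightarrow> 'n::finite cpoly"
  assumes "finite I" "\<And>i. i \<in> I \<Longrightarrow> total_degree (\<alpha> i) \<le> 1" and "poly_ideal J" "1 \<notin> J"
  shows "\<exists>p. \<forall>R\<subseteq>I. (\<Prod>i\<in>R. \<alpha> i) \<in> J \<longrightarrow> (\<exists>i\<in>R. peval p (\<alpha> i) = 0)"
proof -
  have "\<exists>p. (\<forall>f\<in>J. total_degree f \<le> 1 \<longrightarrow> peval p f = 0) \<and>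
      (\<forall>R\<subseteq>I. (\<Prod>i\<in>R. \<alpha> i) \<in> J \<longrightarrow> (\<exists>i\<in>R. peval p (\<alpha> i) = 0))"
    using assms
  proof (induction I arbitrary: J)
    case empty
    then show ?case using affine_common_zero[of J] by (auto simp: poly_ideal_def)
  next
    case (insert i I)
    define J' where "J' = {f + g * \<alpha> i | f g. f \<in> J}"
    have J: "poly_ideal J" "1 \<notin> J" using insert.prems by auto
    show ?case
    proof (cases "1 \<in> J'")
      case False
      have JJ': "f \<in> J'" if "f \<in> J" for f
        using that unfolding J'_def by (intro CollectI exI[of _ f] exI[of _ 0]) simp
      have "f + g \<in> J'" if fg: "f \<in> J'" "g \<in> J'" for f g
      proof -
        obtain f1 c where "f1 \<in> J" "f = f1 + c * \<alpha> i"
          using fg(1) unfolding J'_def by blast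
        moreover obtain f2 d where "f2 \<in> J" "g = f2 + d * \<alpha> i"
          using fg(2) unfolding J'_def by blast
        ultimately show ?thesis using J(1) unfolding J'_def poly_ideal_def
          by (intro CollectI exI[of _ "f1 + f2"] exI[of _ "c + d"]) (auto simp: algebra_simps)
      qed
      moreover have "d * f \<in> J'" if fV: "f \<in> J'" for f d
      proof -
        obtain f1 c where "f1 \<in> J" "f = f1 + c * \<alpha> i"
          using fV unfolding J'_def by blast
        then show ?thesis using J(1) unfolding J'_def poly_ideal_def
          by (intro CollectI exI[of _ "d * f1"] exI[of _ "d * c"]) (auto simp: algebra_simps)
      qed
      ultimately have "poly_ideal J'" using J(1) JJ' unfolding poly_ideal_def by blast
      with insert.IH[of J'] insert.prems False obtain p where
        p: "\<forall>f\<in>J'. total_degree f \<le> 1 \<longrightarrow> peval p f = 0"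
          "\<forall>R\<subseteq>I. (\<Prod>i\<in>R. \<alpha> i) \<in> J' \<longrightarrow> (\<exists>i\<in>R. peval p (\<alpha> i) = 0)" by blast
      have "\<alpha> i \<in> J'"
        using J(1) unfolding J'_def poly_ideal_def
        by (intro CollectI exI[of _ 0] exI[of _ 1]) simp
      then have "peval p (\<alpha> i) = 0" using p(1) insert.prems(1) by auto
      then have "\<exists>k\<in>R. peval p (\<alpha> k) = 0" if "R \<subseteq> insert i I" "(\<Prod>i\<in>R. \<alpha> i) \<in> J" for R
        using that p(2) JJ' by (cases "i \<in> R") blast+
      then show ?thesis using p(1) JJ' by blast
    next
      case True
      then obtain f g where fg: "f \<in> J" "1 = f + g * \<alpha> i" by (auto simp: J'_def)
      obtain p where p: "\<forall>f\<in>J. total_degree f \<le> 1 \<longrightarrow> peval p f = 0"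
          "\<forall>R\<subseteq>I. (\<Prod>i\<in>R. \<alpha> i) \<in> J \<longrightarrow> (\<exists>i\<in>R. peval p (\<alpha> i) = 0)"
        using insert.IH[of J] insert.prems by blast
      have "\<exists>k\<in>R. peval p (\<alpha> k) = 0" if R: "R \<subseteq> insert i I" "(\<Prod>i\<in>R. \<alpha> i) \<in> J" for R
      proof (cases "i \<in> R")
        case True
        let ?P = "\<Prod>i\<in>R - {i}. \<alpha> i"
        \<comment> \<open>Modulo \<open>J\<close> the factor \<open>\<alpha> i\<close> has the inverse \<open>g\<close>.\<close>
        have "finite R" using R(1) insert.hyps(1) finite_subset by blast
        then have "\<alpha> i * ?P \<in> J" using R(2) True by (simp add: prod.remove)
        then have "?P * f + g * (\<alpha> i * ?P) \<in> J" using J(1) fg(1) by (simp add: poly_ideal_def)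
        also have "?P * f + g * (\<alpha> i * ?P) = (f + g * \<alpha> i) * ?P" by (simp add: algebra_simps)
        finally have "?P \<in> J" using fg(2) by simp
        then show ?thesis using p(2) R(1) by (metis Diff_iff Diff_subset_conv insert_is_Un)
      qed (use p R in blast)
      then show ?thesis using p(1) by blast
    qed
  qed
  then show ?thesis by blast
qed

section \<open>Submodules, factors and supports in terms of rational functions\<close>

text \<open>Since the Weyl algebra is generated by the polynomials and the derivations, its submodules can be
  described without terms of the Weyl algebra.\<close>

definition connection_submodule ::
    "('n \<Rightarrow> 'n cpoly fract) \<Rightarrow> 'n::linorder cpoly fract set \<Rightarrow> bool" where
  "connection_submodule \<eta> N \<longleftrightarrow> 0 \<in> N \<and> (\<forall>q\<in>N. \<forall>r\<in>N. q + r \<in> N) \<and>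
    (\<forall>f. \<forall>q\<in>N. frac_of_poly f * q \<in> N) \<and> (\<forall>j. \<forall>q\<in>N. fderiv j q + \<eta> j * q \<in> N)"

lemma connection_submoduleD:
  assumes "connection_submodule \<eta> N"
  shows "0 \<in> N" "q \<in> N \<Longrightarrow> r \<in> N \<Longrightarrow> q + r \<in> N" "q \<in> N \<Longrightarrow> frac_of_poly f * q \<in> N"
    "q \<in> N \<Longrightarrow> fderiv j q + \<eta> j * q \<in> N" "q \<in> N \<Longrightarrow> - q \<in> N"
    "q \<in> N \<Longrightarrow> r \<in> N \<Longrightarrow> q - r \<in> N"
proof -
  show *: "0 \<in> N" "q \<in> N \<Longrightarrow> r \<in> N \<Longrightarrow> q + r \<in> N" "q \<in> N \<Longrightarrow> frac_of_poly f * q \<in> N"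
    "q \<in> N \<Longrightarrow> fderiv j q + \<eta> j * q \<in> N" for q r f
    using assms by (auto simp: connection_submodule_def)
  show neg: "q \<in> N \<Longrightarrow> - q \<in> N" for q
    using *(3)[of q "pconst (- 1)"] by (simp add: frac_of_poly_pconst_minus_one)
  show "q \<in> N \<Longrightarrow> r \<in> N \<Longrightarrow> q - r \<in> N"
    using *(2)[of q "- r"] neg[of r] by simp
qed

lemma connection_submodule_sum:
  assumes "connection_submodule \<eta> N" "\<And>a. a \<in> A \<Longrightarrow> h a \<in> N"
  shows "sum h A \<in> N"
  using assms(2)
  by (induction A rule: infinite_finite_induct) (auto simp: connection_submoduleD[OF assms(1)])

lemma connection_submodule_unscale:
  assumes "connection_submodule \<eta> N" "c \<noteq> 0" "frac_of_poly (pconst c) * q \<in> N"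
  shows "q \<in> N"
proof -
  have "frac_of_poly (pconst (1 / c)) * (frac_of_poly (pconst c) * q) \<in> N"
    using assms by (blast intro: connection_submoduleD)
  moreover have "frac_of_poly (pconst (1 / c)) * (frac_of_poly (pconst c) * q) = q"
    using assms(2) by (simp add: mult.assoc[symmetric] frac_of_poly_mult[symmetric] pconst_mult[symmetric])
  ultimately show ?thesis by simp
qed

lemma connection_submodule_Int:
  "connection_submodule \<eta> A \<Longrightarrow> connection_submodule \<eta> B \<Longrightarrow> connection_submodule \<eta> (A \<inter> B)"
  unfolding connection_submodule_def by auto

lemma connection_submodule_plus:
  assumes "connection_submodule \<eta> A" "connection_submodule \<eta> B"
  shows "connection_submodule \<eta> {a + b | a b. a \<in> A \<and> b \<in> B}"
proof -
  note A = connection_submoduleD[OF assms(1)] and B = connection_submoduleD[OF assms(2)]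
  let ?N = "{a + b | a b. a \<in> A \<and> b \<in> B}"
  have I: "q \<in> ?N" if "a \<in> A" "b \<in> B" "q = a + b" for a b q
    using that by blast
  show ?thesis
    unfolding connection_submodule_def
  proof (intro conjI ballI allI)
    show "0 \<in> ?N" by (rule I[OF A(1) B(1)]) simp
  next
    fix q r assume "q \<in> ?N" "r \<in> ?N"
    then obtain a b c d where "a \<in> A" "b \<in> B" "c \<in> A" "d \<in> B" "q = a + b" "r = c + d" by blast
    then show "q + r \<in> ?N"
      by (intro I[of "a + c" "b + d"] A(2) B(2)) (simp_all add: add_ac)
  next
    fix f q assume "q \<in> ?N"
    then obtain a b where "a \<in> A" "b \<in> B" "q = a + b" by blast
    then show "frac_of_poly f * q \<in> ?N"
      by (intro I[of "frac_of_poly f * a" "frac_of_poly f * b"] A(3) B(3)) (simp_all add: ring_distribs)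
  next
    fix j q assume "q \<in> ?N"
    then obtain a b where "a \<in> A" "b \<in> B" "q = a + b" by blast
    then show "fderiv j q + \<eta> j * q \<in> ?N"
      by (intro I[OF A(4)[of a j] B(4)[of b j]]) (simp_all add: ring_distribs fderiv_add add_ac)
  qed
qed

lemma left_submodule_config_module_iff:
  fixes \<alpha> :: "nat \<Rightarrow> 'n::{finite,linorder} cpoly"
  shows "left_submodule N (config_module m \<alpha> \<beta>) \<longleftrightarrow>
    N \<subseteq> poly_localization (\<Prod>i=1..m. \<alpha> i) \<and> connection_submodule (log_form m \<alpha> \<beta>) N"
proof
  assume "left_submodule N (config_module m \<alpha> \<beta>)"
  then have N: "N \<subseteq> poly_localization (\<Prod>i=1..m. \<alpha> i)" "0 \<in> N" "\<forall>x\<in>N. \<forall>y\<in>N. x + y \<in> N"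
      "\<And>P q. q \<in> N \<Longrightarrow> weyl_act m \<alpha> \<beta> P q \<in> N"
    by (auto simp: left_submodule_def config_module_def)
  have "frac_of_poly f * q \<in> N" if "q \<in> N" for f q
    using N(4)[OF that, of "weyl_of_poly f"] by (simp add: weyl_act_of_poly)
  moreover have "fderiv j q + log_form m \<alpha> \<beta> j * q \<in> N" if "q \<in> N" for j q
    using N(4)[OF that, of "weyl_d j"] by (simp add: weyl_act_simps)
  ultimately show "N \<subseteq> poly_localization (\<Prod>i=1..m. \<alpha> i) \<and> connection_submodule (log_form m \<alpha> \<beta>) N"
    using N unfolding connection_submodule_def by blast
next
  assume N: "N \<subseteq> poly_localization (\<Prod>i=1..m. \<alpha> i) \<and> connection_submodule (log_form m \<alpha> \<beta>) N"
  then have D: "connection_submodule (log_form m \<alpha> \<beta>) N" by blast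
  have "wterm_act (log_form m \<alpha> \<beta>) t q \<in> N" if "q \<in> N" for t q
    using that by (induction t arbitrary: q) (auto intro: connection_submoduleD[OF D])
  then have "weyl_act m \<alpha> \<beta> P q \<in> N" if "q \<in> N" for P q
    using that by (transfer fixing: N) blast
  then show "left_submodule N (config_module m \<alpha> \<beta>)"
    using N connection_submoduleD[OF D] by (auto simp: left_submodule_def config_module_def)
qed

text \<open>The next two notions express, without cosets, that the quotient of \<open>B\<close> by \<open>A\<close> is simple and that it
  has a given support: the localization of the quotient at \<open>p\<close> is nonzero exactly if some class is not
  killed by any polynomial that is nonzero at \<open>p\<close>.\<close>

definition simple_step ::
    "('n \<Rightarrow> 'n cpoly fract) \<Rightarrow> 'n::linorder cpoly fract set \<Rightarrow> 'n cpoly fract set \<Rightarrow> bool" where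
  "simple_step \<eta> A B \<longleftrightarrow> A \<subset> B \<and>
    (\<forall>C. connection_submodule \<eta> C \<longrightarrow> A \<subseteq> C \<longrightarrow> C \<subseteq> B \<longrightarrow> C = A \<or> C = B)"

definition step_support ::
    "'n cpoly fract set \<Rightarrow> 'n cpoly fract set \<Rightarrow> (complex ^ 'n::{finite,linorder}) set" where
  "step_support A B = {p. \<exists>u\<in>B. \<forall>w. peval p w \<noteq> 0 \<longrightarrow> frac_of_poly w * u \<notin> A}"

locale config_factor =
  fixes m :: nat and \<alpha> :: "nat \<Rightarrow> 'n::{finite,linorder} cpoly" and \<beta> :: "nat \<Rightarrow> complex"
    and N :: "nat \<Rightarrow> 'n cpoly fract set" and i :: nat
  assumes sub_lower: "connection_submodule (log_form m \<alpha> \<beta>) (N i)"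
    and sub_upper: "connection_submodule (log_form m \<alpha> \<beta>) (N (Suc i))"
    and lower_le_upper: "N i \<subseteq> N (Suc i)"
begin

abbreviation "A \<equiv> N i"
abbreviation "B \<equiv> N (Suc i)"
abbreviation "Q \<equiv> chain_factor (config_module m \<alpha> \<beta>) N i"

definition residue_class :: "'n cpoly fract \<Rightarrow> 'n cpoly fract set" where
  "residue_class x = (\<lambda>a. a + x) ` A"

lemmas lowerD = connection_submoduleD[OF sub_lower]
lemmas upperD = connection_submoduleD[OF sub_upper]

lemma residue_class_eq_iff: "residue_class x = residue_class y \<longleftrightarrow> x - y \<in> A"
proof
  assume "residue_class x = residue_class y"
  moreover have "x \<in> residue_class x"
    unfolding residue_class_def using lowerD(1) by (intro image_eqI[of _ _ 0]) auto
  ultimately obtain a where "a \<in> A" "x = a + y" unfolding residue_class_def by auto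
  then show "x - y \<in> A" by simp
next
  have *: "residue_class x \<subseteq> residue_class y" if "x - y \<in> A" for x y
  proof
    fix z assume "z \<in> residue_class x"
    then obtain a where a: "a \<in> A" "z = a + x" by (auto simp: residue_class_def)
    then have "z = (a + (x - y)) + y" by simp
    then show "z \<in> residue_class y" unfolding residue_class_def using lowerD(2)[OF a(1) that] by blast
  qed
  assume "x - y \<in> A"
  moreover from this have "y - x \<in> A" using lowerD(5)[of "x - y"] by simp
  ultimately show "residue_class x = residue_class y" using *[of x y] *[of y x] by blast
qed

lemma residue_class_zero: "residue_class 0 = A"
  by (simp add: residue_class_def)

lemma residue_class_eq_lower_iff: "residue_class x = A \<longleftrightarrow> x \<in> A"
  using residue_class_eq_iff[of x 0] by (simp add: residue_class_zero)

lemma factor_simps: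
  "carrier Q = residue_class ` B"
  "zero Q = A"
  "add Q (residue_class x) (residue_class y) = residue_class (x + y)"
  "smult Q P (residue_class x) = residue_class (weyl_act m \<alpha> \<beta> P x)"
proof -
  have coset: "A +>\<^bsub>config_module m \<alpha> \<beta>\<lparr>carrier := B\<rparr>\<^esub> x = residue_class x" for x
    by (auto simp: a_r_coset_def r_coset_def residue_class_def config_module_def)
  show "carrier Q = residue_class ` B"
    unfolding chain_factor_def quotient_module_def A_RCOSETS_def RCOSETS_def
    using coset by (auto simp: a_r_coset_def)
  show "zero Q = A" by (simp add: chain_factor_def quotient_module_def)
  show "add Q (residue_class x) (residue_class y) = residue_class (x + y)"
  proof -
    have "add Q (residue_class x) (residue_class y) = {h + k |h k. h \<in> residue_class x \<and> k \<in> residue_class y}"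
      by (auto simp: chain_factor_def quotient_module_def set_add_def set_mult_def config_module_def)
    also have "\<dots> = residue_class (x + y)"
    proof (intro equalityI subsetI)
      fix z assume "z \<in> {h + k |h k. h \<in> residue_class x \<and> k \<in> residue_class y}"
      then obtain a b where ab: "a \<in> A" "b \<in> A" "z = (a + x) + (b + y)" by (auto simp: residue_class_def)
      then have "z = (a + b) + (x + y)" by (simp add: algebra_simps)
      then show "z \<in> residue_class (x + y)" unfolding residue_class_def using lowerD(2)[OF ab(1,2)] by blast
    next
      fix z assume "z \<in> residue_class (x + y)"
      then obtain a where a: "a \<in> A" "z = (a + x) + (0 + y)" by (auto simp: residue_class_def algebra_simps)
      then show "z \<in> {h + k |h k. h \<in> residue_class x \<and> k \<in> residue_class y}"
        unfolding residue_class_def using lowerD(1) by blast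
    qed
    finally show ?thesis .
  qed
  show "smult Q P (residue_class x) = residue_class (weyl_act m \<alpha> \<beta> P x)"
  proof -
    have act: "weyl_act m \<alpha> \<beta> P a \<in> A" if "a \<in> A" for a
    proof -
      have "wterm_act (log_form m \<alpha> \<beta>) t q \<in> A" if "q \<in> A" for t q
        using that by (induction t arbitrary: q) (auto intro: lowerD)
      then show ?thesis using that by (transfer fixing: N i) blast
    qed
    have "smult Q P (residue_class x) = (\<Union>y\<in>residue_class x. residue_class (weyl_act m \<alpha> \<beta> P y))"
      using coset by (auto simp: chain_factor_def quotient_module_def config_module_def)
    also have "\<dots> = (\<Union>y\<in>residue_class x. residue_class (weyl_act m \<alpha> \<beta> P x))"
    proof (intro SUP_cong HOL.refl)
      fix y assume "y \<in> residue_class x"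
      then obtain a where "a \<in> A" "y = a + x" by (auto simp: residue_class_def)
      then show "residue_class (weyl_act m \<alpha> \<beta> P y) = residue_class (weyl_act m \<alpha> \<beta> P x)"
        using act by (simp add: residue_class_eq_iff weyl_act_add_right)
    qed
    also have "\<dots> = residue_class (weyl_act m \<alpha> \<beta> P x)"
      using lowerD(1) by (auto simp: residue_class_def)
    finally show ?thesis .
  qed
qed

lemma poly_smult_factor: "poly_smult Q f (residue_class x) = residue_class (frac_of_poly f * x)"
  by (simp add: poly_smult_def factor_simps weyl_act_of_poly)

lemma left_submodule_factor:
  assumes C: "connection_submodule (log_form m \<alpha> \<beta>) C" "C \<subseteq> B"
  shows "left_submodule (residue_class ` C) Q"
proof -
  have act: "weyl_act m \<alpha> \<beta> P q \<in> C" if "q \<in> C" for P q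
  proof -
    have "wterm_act (log_form m \<alpha> \<beta>) t q \<in> C" if "q \<in> C" for t q
      using that by (induction t arbitrary: q) (auto intro: connection_submoduleD[OF C(1)])
    then show ?thesis using that by (transfer fixing: C) blast
  qed
  have "A \<in> residue_class ` C"
    using connection_submoduleD(1)[OF C(1)] residue_class_zero by blast
  then show ?thesis
    using C(2) act connection_submoduleD(2)[OF C(1)]
    by (auto simp: left_submodule_def factor_simps)
qed

lemma connection_submodule_preimage:
  assumes X: "left_submodule X Q"
  shows "connection_submodule (log_form m \<alpha> \<beta>) {x \<in> B. residue_class x \<in> X}"
proof -
  have add: "residue_class (x + y) \<in> X" if "residue_class x \<in> X" "residue_class y \<in> X" for x y
    using X that unfolding left_submodule_def by (metis factor_simps(3))
  have act: "residue_class (weyl_act m \<alpha> \<beta> P x) \<in> X" if "residue_class x \<in> X" for x P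
    using X that unfolding left_submodule_def by (metis factor_simps(4))
  have poly: "residue_class (frac_of_poly f * x) \<in> X" if "residue_class x \<in> X" for x f
    using act[OF that, of "weyl_of_poly f"] by (simp add: weyl_act_of_poly)
  have der: "residue_class (fderiv j x + log_form m \<alpha> \<beta> j * x) \<in> X" if "residue_class x \<in> X" for x j
    using act[OF that, of "weyl_d j"] by (simp add: weyl_act_simps)
  have zero: "residue_class 0 \<in> X"
    using X by (simp add: residue_class_zero left_submodule_def factor_simps)
  show ?thesis
    unfolding connection_submodule_def using zero add poly der upperD(1-4) by simp
qed

lemma simple_factor_iff: "simple_module Q \<longleftrightarrow> simple_step (log_form m \<alpha> \<beta>) A B"
proof
  assume S: "simple_module Q"
  have "A \<noteq> B"
  proof
    assume "A = B"
    then have "carrier Q = {A}"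
      using residue_class_eq_lower_iff upperD(1) by (auto simp: factor_simps intro!: image_eqI[of _ _ 0])
    then show False using S by (simp add: simple_module_def factor_simps)
  qed
  moreover have "C = A \<or> C = B"
    if C: "connection_submodule (log_form m \<alpha> \<beta>) C" "A \<subseteq> C" "C \<subseteq> B" for C
  proof -
    have "residue_class ` C = {A} \<or> residue_class ` C = residue_class ` B"
      using S left_submodule_factor[OF C(1,3)] by (auto simp: simple_module_def factor_simps)
    then show ?thesis
    proof
      assume "residue_class ` C = {A}"
      then have "C \<subseteq> A" using residue_class_eq_lower_iff by blast
      then show ?thesis using C(2) by blast
    next
      assume e: "residue_class ` C = residue_class ` B"
      have "b \<in> C" if b: "b \<in> B" for b
      proof -
        have "residue_class b \<in> residue_class ` C" using b e by simp
        then obtain c where c: "c \<in> C" "residue_class b = residue_class c" by (rule imageE)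
        then have "b - c \<in> C" using residue_class_eq_iff C(2) by blast
        then have "(b - c) + c \<in> C" using connection_submoduleD(2)[OF C(1)] c(1) by blast
        then show ?thesis by simp
      qed
      then show ?thesis using C(3) by blast
    qed
  qed
  ultimately show "simple_step (log_form m \<alpha> \<beta>) A B"
    using lower_le_upper by (auto simp: simple_step_def)
next
  assume S: "simple_step (log_form m \<alpha> \<beta>) A B"
  have "carrier Q \<noteq> {A}"
  proof
    assume "carrier Q = {A}"
    then have "residue_class ` B = {A}" by (simp add: factor_simps)
    then have "residue_class x = A" if "x \<in> B" for x using that by blast
    then have "B \<subseteq> A" using residue_class_eq_lower_iff by blast
    then show False using S by (auto simp: simple_step_def)
  qed
  moreover have "X = {A} \<or> X = residue_class ` B" if X: "left_submodule X Q" for X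
  proof -
    let ?C = "{x \<in> B. residue_class x \<in> X}"
    have XB: "X \<subseteq> residue_class ` B" and AX: "A \<in> X" using X by (auto simp: left_submodule_def factor_simps)
    have "A \<subseteq> ?C"
    proof
      fix x assume "x \<in> A"
      then have "residue_class x = A" "x \<in> B"
        using residue_class_eq_lower_iff lower_le_upper by auto
      then show "x \<in> ?C" using AX by simp
    qed
    then have "?C = A \<or> ?C = B"
      using S connection_submodule_preimage[OF X] unfolding simple_step_def by blast
    then show ?thesis
    proof
      assume "?C = A"
      then have "X \<subseteq> {A}" using XB residue_class_eq_lower_iff by blast
      then show ?thesis using AX by blast
    next
      assume "?C = B"
      then show ?thesis using XB by blast
    qed
  qed
  ultimately show "simple_module Q" by (simp add: simple_module_def factor_simps)
qed

lemma module_support_factor: "module_support Q = step_support A B"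
proof -
  have "localization_at Q p = {local_rel Q p `` {(A, 1)}}
      \<longleftrightarrow> (\<forall>x\<in>B. \<exists>w. peval p w \<noteq> 0 \<and> frac_of_poly w * x \<in> A)" for p
  proof
    let ?R = "local_rel Q p" and ?F = "local_fractions Q p"
    have A: "(A, 1) \<in> ?F"
      using upperD(1) by (auto simp: local_fractions_def factor_simps residue_class_zero[symmetric])
    {
      assume e: "localization_at Q p = {?R `` {(A, 1)}}"
      show "\<forall>x\<in>B. \<exists>w. peval p w \<noteq> 0 \<and> frac_of_poly w * x \<in> A"
      proof
        fix x assume "x \<in> B"
        then have x: "(residue_class x, 1) \<in> ?F" by (auto simp: local_fractions_def factor_simps)
        then have "?R `` {(residue_class x, 1)} \<in> localization_at Q p"
          unfolding localization_at_def by (rule quotientI)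
        then have "?R `` {(residue_class x, 1)} = ?R `` {(A, 1)}" using e by simp
        moreover have "(residue_class x, 1) \<in> ?R `` {(residue_class x, 1)}"
          using x by (auto simp: local_rel_def intro!: exI[of _ 1])
        ultimately have "((A, 1), (residue_class x, 1)) \<in> ?R" by blast
        then obtain w where w: "peval p w \<noteq> 0"
          "poly_smult Q w (poly_smult Q 1 (residue_class 0)) = poly_smult Q w (poly_smult Q 1 (residue_class x))"
          by (auto simp: local_rel_def residue_class_zero)
        then have "0 - frac_of_poly w * x \<in> A"
          by (simp add: poly_smult_factor residue_class_eq_iff)
        then have "frac_of_poly w * x \<in> A" using lowerD(5) by force
        then show "\<exists>w. peval p w \<noteq> 0 \<and> frac_of_poly w * x \<in> A" using w(1) by blast
      qed
    }
    {
      assume k: "\<forall>x\<in>B. \<exists>w. peval p w \<noteq> 0 \<and> frac_of_poly w * x \<in> A"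
      have rel: "(c, d) \<in> ?R" if cd: "c \<in> ?F" "d \<in> ?F" for c d
      proof -
        obtain x s where c: "c = (residue_class x, s)" "x \<in> B"
          using cd(1) by (auto simp: local_fractions_def factor_simps)
        obtain y t where d: "d = (residue_class y, t)" "y \<in> B"
          using cd(2) by (auto simp: local_fractions_def factor_simps)
        obtain v where v: "peval p v \<noteq> 0" "frac_of_poly v * x \<in> A" using k c(2) by blast
        obtain w where w: "peval p w \<noteq> 0" "frac_of_poly w * y \<in> A" using k d(2) by blast
        have "frac_of_poly (v * w) * (frac_of_poly t * x) \<in> A"
          using lowerD(3)[OF v(2), of "w * t"] by (simp add: frac_of_poly_mult mult_ac)
        moreover have "frac_of_poly (v * w) * (frac_of_poly s * y) \<in> A"
          using lowerD(3)[OF w(2), of "v * s"] by (simp add: frac_of_poly_mult mult_ac)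
        ultimately have "poly_smult Q (v * w) (poly_smult Q t (residue_class x))
            = poly_smult Q (v * w) (poly_smult Q s (residue_class y))"
          by (simp add: poly_smult_factor residue_class_eq_iff lowerD(6))
        moreover have "peval p (v * w) \<noteq> 0" using v(1) w(1) by (simp add: peval_mult)
        ultimately show ?thesis
          using cd unfolding c(1) d(1) local_rel_def by blast
      qed
      have "?R `` {c} = ?F" if "c \<in> ?F" for c
        using rel[OF that] by (auto simp: local_rel_def)
      then show "localization_at Q p = {?R `` {(A, 1)}}"
        using A by (auto simp: localization_at_def quotient_def)
    }
  qed
  then show ?thesis
    unfolding module_support_def step_support_def by (auto simp: factor_simps)
qed

end

section \<open>Products of powers of the equations and their derivatives\<close>

lemma Fract_eq_divide: "Fract f g = frac_of_poly f / frac_of_poly g"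
  by (simp add: frac_of_poly_def)

lemma frac_of_poly_prod: "frac_of_poly (prod f A) = (\<Prod>a\<in>A. frac_of_poly (f a))"
  by (induction A rule: infinite_finite_induct) (auto simp: frac_of_poly_mult)

lemma frac_of_poly_uminus: "frac_of_poly (- f) = - frac_of_poly f"
  by (simp add: frac_of_poly_def)

lemma frac_of_poly_diff: "frac_of_poly (f - g) = frac_of_poly f - frac_of_poly g"
  using frac_of_poly_add[of f "- g"] by (simp add: frac_of_poly_uminus)

lemma frac_of_poly_of_nat: "frac_of_poly (pconst (of_nat k)) = of_nat k"
  by (induction k) (auto simp: pconst_add frac_of_poly_add)

lemma frac_of_poly_of_int: "frac_of_poly (pconst (of_int k)) = of_int k"
  by (cases k rule: int_cases2) (auto simp: frac_of_poly_of_nat pconst_minus frac_of_poly_uminus)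

lemma fderiv_one [simp]: "fderiv j 1 = 0"
  using fderiv_frac_of_poly[of j 1] by simp

lemma fderiv_power: "q \<noteq> 0 \<Longrightarrow> fderiv j (q ^ k) = of_nat k * q ^ k * (fderiv j q / q)"
  by (induction k) (auto simp: fderiv_mult field_simps)

lemma fderiv_powi:
  assumes "q \<noteq> 0"
  shows "fderiv j (q powi k) = of_int k * q powi k * (fderiv j q / q)"
proof (cases "k \<ge> 0")
  case True
  then show ?thesis using fderiv_power[OF assms, of j "nat k"] by (simp add: power_int_def)
next
  case False
  define n where "n = nat (- k)"
  have k: "k = - int n" using False by (simp add: n_def)
  have "fderiv j (q ^ n * q powi k) = 0"
    using assms by (simp add: k power_int_minus)
  then have "q ^ n * fderiv j (q powi k) = - (of_nat n * q ^ n * (fderiv j q / q)) * q powi k"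
    by (simp add: fderiv_mult fderiv_power[OF assms] eq_neg_iff_add_eq_0 add.commute)
  also have "\<dots> = q ^ n * (of_int k * q powi k * (fderiv j q / q))"
    by (simp add: k)
  finally show ?thesis
    by (rule mult_left_cancel[THEN iffD1, rotated]) (use assms in simp)
qed

lemma fderiv_prod:
  assumes "finite A" "\<And>a. a \<in> A \<Longrightarrow> f a \<noteq> 0"
  shows "fderiv j (prod f A) = prod f A * (\<Sum>a\<in>A. fderiv j (f a) / f a)"
  using assms
proof (induction A)
  case (insert a A)
  then have "fderiv j (prod f (insert a A))
      = fderiv j (f a) * prod f A + f a * (prod f A * (\<Sum>a\<in>A. fderiv j (f a) / f a))"
    by (simp add: fderiv_mult)
  also have "\<dots> = f a * prod f A * (fderiv j (f a) / f a + (\<Sum>a\<in>A. fderiv j (f a) / f a))"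
    using insert.prems by (simp add: ring_distribs)
  finally show ?case using insert.hyps by simp
qed simp

locale arrangement =
  fixes m :: nat and \<alpha> :: "nat \<Rightarrow> 'n::{finite,linorder} cpoly" and \<beta> :: "nat \<Rightarrow> complex"
  assumes configuration: "hyperplane_configuration m \<alpha>"
    and crossing: "normal_crossing m \<alpha>"
begin

lemma degree_le: "i \<in> {1..m} \<Longrightarrow> total_degree (\<alpha> i) \<le> 1"
  using configuration by (simp add: hyperplane_configuration_def)

lemma equation_nonzero: "i \<in> {1..m} \<Longrightarrow> \<alpha> i \<noteq> 0"
proof
  assume i: "i \<in> {1..m}" "\<alpha> i = 0"
  then have "total_degree (0 :: 'n cpoly) = 1"
    using configuration unfolding hyperplane_configuration_def by metis
  then show False by (simp add: total_degree_def)
qed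

lemma frac_equation_nonzero: "i \<in> {1..m} \<Longrightarrow> frac_of_poly (\<alpha> i) \<noteq> 0"
  using equation_nonzero by simp

definition alpha_pow :: "(nat \<Rightarrow> int) \<Rightarrow> 'n cpoly fract" where
  "alpha_pow a = (\<Prod>i\<in>{1..m}. frac_of_poly (\<alpha> i) powi a i)"

lemma alpha_pow_cong: "(\<And>i. i \<in> {1..m} \<Longrightarrow> a i = b i) \<Longrightarrow> alpha_pow a = alpha_pow b"
  unfolding alpha_pow_def by (rule prod.cong) auto

lemma alpha_pow_add: "alpha_pow (\<lambda>i. a i + b i) = alpha_pow a * alpha_pow b"
  unfolding alpha_pow_def prod.distrib[symmetric]
  by (rule prod.cong) (auto simp: power_int_add equation_nonzero simp del: One_nat_def)

lemma alpha_pow_nonneg: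
  assumes "\<And>i. i \<in> {1..m} \<Longrightarrow> a i \<ge> 0"
  shows "alpha_pow a = frac_of_poly (\<Prod>i\<in>{1..m}. \<alpha> i ^ nat (a i))"
  unfolding alpha_pow_def frac_of_poly_prod
  by (rule prod.cong) (use assms in \<open>auto simp: power_int_def frac_of_poly_power\<close>)

lemma alpha_pow_le:
  assumes "\<And>i. i \<in> {1..m} \<Longrightarrow> a i \<le> b i"
  shows "alpha_pow b = frac_of_poly (\<Prod>i\<in>{1..m}. \<alpha> i ^ nat (b i - a i)) * alpha_pow a"
  using alpha_pow_add[of "\<lambda>i. b i - a i" a] alpha_pow_nonneg[of "\<lambda>i. b i - a i"] assms by simp

lemma alpha_pow_shift:
  assumes "i \<in> {1..m}"
  shows "alpha_pow (a(i := a i + k)) = frac_of_poly (\<alpha> i) powi k * alpha_pow a"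
proof -
  have "alpha_pow (a(i := a i + k)) = alpha_pow (\<lambda>j. (if j = i then k else 0) + a j)"
    by (rule alpha_pow_cong) auto
  also have "\<dots> = alpha_pow (\<lambda>j. if j = i then k else 0) * alpha_pow a" by (rule alpha_pow_add)
  also have "alpha_pow (\<lambda>j. if j = i then k else 0) = (\<Prod>j\<in>{1..m}. if j = i then frac_of_poly (\<alpha> i) powi k else 1)"
    unfolding alpha_pow_def by (rule prod.cong) auto
  also have "\<dots> = frac_of_poly (\<alpha> i) powi k" using assms by simp
  finally show ?thesis .
qed

lemma alpha_pow_raise: "i \<in> {1..m} \<Longrightarrow> frac_of_poly (\<alpha> i) * alpha_pow a = alpha_pow (a(i := a i + 1))"
  using alpha_pow_shift[of i a 1] by simp

lemma alpha_pow_lower: "i \<in> {1..m} \<Longrightarrow> alpha_pow a / frac_of_poly (\<alpha> i) = alpha_pow (a(i := a i - 1))"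
  using alpha_pow_shift[of i a "- 1"] by (simp add: power_int_minus field_simps)

definition nabla :: "(complex, 'n) vec \<Rightarrow> 'n cpoly fract \<Rightarrow> 'n cpoly fract" where
  "nabla v q = (\<Sum>j\<in>UNIV. frac_of_poly (pconst (v $ j)) * (fderiv j q + log_form m \<alpha> \<beta> j * q))"

lemma nabla_in_submodule:
  assumes "connection_submodule (log_form m \<alpha> \<beta>) N" "q \<in> N"
  shows "nabla v q \<in> N"
  unfolding nabla_def using assms by (intro connection_submodule_sum) (auto intro: connection_submoduleD)

lemma nabla_add: "nabla v (q + r) = nabla v q + nabla v r"
  by (simp add: nabla_def fderiv_add ring_distribs sum.distrib add_ac)

lemma nabla_zero [simp]: "nabla v 0 = 0"
  by (simp add: nabla_def)

lemma nabla_axis: "nabla (axis j 1) q = fderiv j q + log_form m \<alpha> \<beta> j * q"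
proof -
  have "nabla (axis j 1) q = (\<Sum>k\<in>UNIV. if k = j then fderiv k q + log_form m \<alpha> \<beta> k * q else 0)"
    unfolding nabla_def by (rule sum.cong) (auto simp: axis_def)
  then show ?thesis by simp
qed

lemma fderiv_alpha_pow:
  "fderiv j (alpha_pow a) = alpha_pow a * (\<Sum>i\<in>{1..m}. of_int (a i) * (fderiv j (frac_of_poly (\<alpha> i)) / frac_of_poly (\<alpha> i)))"
proof -
  have "fderiv j (alpha_pow a) = alpha_pow a * (\<Sum>i\<in>{1..m}. fderiv j (frac_of_poly (\<alpha> i) powi a i) / frac_of_poly (\<alpha> i) powi a i)"
    unfolding alpha_pow_def by (rule fderiv_prod) (use frac_equation_nonzero in auto)
  also have "(\<Sum>i\<in>{1..m}. fderiv j (frac_of_poly (\<alpha> i) powi a i) / frac_of_poly (\<alpha> i) powi a i)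
      = (\<Sum>i\<in>{1..m}. of_int (a i) * (fderiv j (frac_of_poly (\<alpha> i)) / frac_of_poly (\<alpha> i)))"
    by (rule sum.cong) (use frac_equation_nonzero in \<open>simp_all add: fderiv_powi del: One_nat_def\<close>)
  finally show ?thesis .
qed

text \<open>The logarithmic derivative of a product of powers is the sum of those of its factors: the
  exponents \<open>a\<^sub>i\<close> come from the coefficient and the \<open>\<beta>\<^sub>i\<close> from the connection, and only their sums
  matter.\<close>

lemma nabla_alpha_pow:
  "nabla v (frac_of_poly f * alpha_pow a) = frac_of_poly (pdir v f) * alpha_pow a +
    (\<Sum>i\<in>{1..m}. frac_of_poly (pconst ((of_int (a i) + \<beta> i) * slope v (\<alpha> i)) * f) * alpha_pow (a(i := a i - 1)))"
proof -
  let ?K = "\<lambda>c. frac_of_poly (pconst c) :: 'n cpoly fract"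
  have one: "fderiv j (frac_of_poly f * alpha_pow a) + log_form m \<alpha> \<beta> j * (frac_of_poly f * alpha_pow a)
      = frac_of_poly (pderiv j f) * alpha_pow a +
        (\<Sum>i\<in>{1..m}. ?K (of_int (a i) + \<beta> i) * frac_of_poly (pderiv j (\<alpha> i)) * (frac_of_poly f * alpha_pow (a(i := a i - 1))))"
    for j
  proof -
    have "log_form m \<alpha> \<beta> j = (\<Sum>i\<in>{1..m}. ?K (\<beta> i) * (fderiv j (frac_of_poly (\<alpha> i)) / frac_of_poly (\<alpha> i)))"
      by (simp add: log_form_def Fract_eq_divide fderiv_frac_of_poly del: One_nat_def)
    then have "fderiv j (frac_of_poly f * alpha_pow a) + log_form m \<alpha> \<beta> j * (frac_of_poly f * alpha_pow a)
        = frac_of_poly (pderiv j f) * alpha_pow a + (frac_of_poly f * alpha_pow a) *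
          ((\<Sum>i\<in>{1..m}. of_int (a i) * (fderiv j (frac_of_poly (\<alpha> i)) / frac_of_poly (\<alpha> i)))
          + (\<Sum>i\<in>{1..m}. ?K (\<beta> i) * (fderiv j (frac_of_poly (\<alpha> i)) / frac_of_poly (\<alpha> i))))"
      by (simp add: fderiv_mult fderiv_frac_of_poly fderiv_alpha_pow algebra_simps del: One_nat_def)
    also have "(\<Sum>i\<in>{1..m}. of_int (a i) * (fderiv j (frac_of_poly (\<alpha> i)) / frac_of_poly (\<alpha> i)))
          + (\<Sum>i\<in>{1..m}. ?K (\<beta> i) * (fderiv j (frac_of_poly (\<alpha> i)) / frac_of_poly (\<alpha> i)))
        = (\<Sum>i\<in>{1..m}. ?K (of_int (a i) + \<beta> i) * (frac_of_poly (pderiv j (\<alpha> i)) / frac_of_poly (\<alpha> i)))"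
      by (simp only: sum.distrib[symmetric] frac_of_poly_of_int[symmetric] ring_distribs pconst_add
          frac_of_poly_add fderiv_frac_of_poly)
    also have "(frac_of_poly f * alpha_pow a) * \<dots>
        = (\<Sum>i\<in>{1..m}. ?K (of_int (a i) + \<beta> i) * frac_of_poly (pderiv j (\<alpha> i)) * (frac_of_poly f * (alpha_pow a / frac_of_poly (\<alpha> i))))"
      unfolding sum_distrib_left by (rule sum.cong) simp_all
    also have "\<dots> = (\<Sum>i\<in>{1..m}. ?K (of_int (a i) + \<beta> i) * frac_of_poly (pderiv j (\<alpha> i)) * (frac_of_poly f * alpha_pow (a(i := a i - 1))))"
      by (rule sum.cong) (simp_all add: alpha_pow_lower del: One_nat_def)
    finally show ?thesis .
  qed
  have slope: "(\<Sum>j\<in>UNIV. ?K (v $ j) * frac_of_poly (pderiv j (\<alpha> i))) = ?K (slope v (\<alpha> i))" if "i \<in> {1..m}" for i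
    using pdir_affine[OF degree_le[OF that], of v]
    by (simp add: pdir_def frac_of_poly_sum[symmetric] frac_of_poly_mult[symmetric])
  have "nabla v (frac_of_poly f * alpha_pow a) = (\<Sum>j\<in>UNIV. ?K (v $ j) * (frac_of_poly (pderiv j f) * alpha_pow a)) +
      (\<Sum>j\<in>UNIV. \<Sum>i\<in>{1..m}. ?K (v $ j) * (?K (of_int (a i) + \<beta> i) * frac_of_poly (pderiv j (\<alpha> i)) * (frac_of_poly f * alpha_pow (a(i := a i - 1)))))"
    unfolding nabla_def one ring_distribs sum.distrib sum_distrib_left ..
  also have "(\<Sum>j\<in>UNIV. ?K (v $ j) * (frac_of_poly (pderiv j f) * alpha_pow a)) = frac_of_poly (pdir v f) * alpha_pow a"
    by (simp add: pdir_def frac_of_poly_sum frac_of_poly_mult sum_distrib_right mult.assoc)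
  also have "(\<Sum>j\<in>UNIV. \<Sum>i\<in>{1..m}. ?K (v $ j) * (?K (of_int (a i) + \<beta> i) * frac_of_poly (pderiv j (\<alpha> i)) * (frac_of_poly f * alpha_pow (a(i := a i - 1)))))
     = (\<Sum>i\<in>{1..m}. ?K (of_int (a i) + \<beta> i) * (\<Sum>j\<in>UNIV. ?K (v $ j) * frac_of_poly (pderiv j (\<alpha> i))) * (frac_of_poly f * alpha_pow (a(i := a i - 1))))"
    by (subst sum.swap) (simp add: sum_distrib_left sum_distrib_right mult_ac)
  also have "\<dots> = (\<Sum>i\<in>{1..m}. frac_of_poly (pconst ((of_int (a i) + \<beta> i) * slope v (\<alpha> i)) * f) * alpha_pow (a(i := a i - 1)))"
    by (rule sum.cong) (simp_all add: slope pconst_mult frac_of_poly_mult mult.assoc del: One_nat_def)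
  finally show ?thesis .
qed

text \<open>Normal crossings enter the proof only through these dual systems of constant vector fields. They are
  columns of the inverse of the coordinate change that turns the equations into coordinates.\<close>

lemma dual_directions:
  assumes "R \<subseteq> {1..m}" "\<And>i. i \<in> R \<Longrightarrow> peval p (\<alpha> i) = 0"
  obtains d where "\<And>i k. i \<in> R \<Longrightarrow> k \<in> R \<Longrightarrow> slope (d i) (\<alpha> k) = (if i = k then 1 else 0)"
proof -
  have "p \<in> (\<Inter>i\<in>R. zero_locus (\<alpha> i))" using assms(2) by (auto simp: zero_locus_def)
  then obtain T \<sigma> where T: "invertible T" "inj_on \<sigma> R" "\<forall>i\<in>R. \<alpha> i = affine_coord T p (\<sigma> i)"
    using crossing[unfolded normal_crossing_def, rule_format, OF assms(1)] by blast
  obtain T' where T': "T ** T' = mat 1" using T(1) unfolding invertible_def by blast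
  have coeff: "lookup (\<alpha> k) (single j 1) = T $ (\<sigma> k) $ j" if k: "k \<in> R" for k j
  proof -
    have "pderiv j (affine_coord T p (\<sigma> k)) = (\<Sum>l\<in>UNIV. pconst (T $ \<sigma> k $ l) * (if l = j then 1 else 0))"
      by (simp add: affine_coord_def pderiv_sum pderiv_mult pderiv_diff pderiv_var)
    also have "\<dots> = (\<Sum>l\<in>UNIV. if l = j then pconst (T $ \<sigma> k $ l) else 0)"
      by (rule sum.cong) auto
    finally have "pderiv j (\<alpha> k) = pconst (T $ \<sigma> k $ j)" using T(3) k by simp
    moreover have "k \<in> {1..m}" using k assms(1) by blast
    ultimately show ?thesis by (simp add: pderiv_affine[OF degree_le] del: One_nat_def)
  qed
  define d where "d i = (\<chi> j. T' $ j $ \<sigma> i)" for i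
  have "slope (d i) (\<alpha> k) = (if i = k then 1 else 0)" if ik: "i \<in> R" "k \<in> R" for i k
  proof -
    have "slope (d i) (\<alpha> k) = (\<Sum>j\<in>UNIV. T $ \<sigma> k $ j * T' $ j $ \<sigma> i)"
      unfolding slope_def d_def coeff[OF ik(2)] by (simp add: mult.commute)
    also have "\<dots> = (T ** T') $ \<sigma> k $ \<sigma> i" by (simp add: matrix_matrix_mult_def)
    finally show ?thesis using T(2) ik unfolding T' by (auto simp: mat_def inj_on_def)
  qed
  then show thesis by (rule that)
qed

definition integral :: "nat set" where
  "integral = {i \<in> {1..m}. \<beta> i \<in> \<int>}"

text \<open>Only meaningful for integral \<open>i\<close>, where \<open>shift i\<close> is \<open>\<beta>\<^sub>i\<close> as an integer.\<close>

definition shift :: "nat \<Rightarrow> int" where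
  "shift i = \<lfloor>Re (\<beta> i)\<rfloor>"

lemma integral_subset: "integral \<subseteq> {1..m}"
  by (auto simp: integral_def)

lemma finite_integral: "finite integral"
  using integral_subset finite_subset by blast

lemma shift: "i \<in> integral \<Longrightarrow> \<beta> i = of_int (shift i)"
  by (auto simp: integral_def shift_def elim!: Ints_cases)

lemma exponent_zero_iff:
  assumes "i \<in> {1..m}"
  shows "of_int k + \<beta> i = 0 \<longleftrightarrow> i \<in> integral \<and> k + shift i = 0"
proof
  assume "of_int k + \<beta> i = 0"
  then have b: "\<beta> i = of_int (- k)" by (simp add: eq_neg_iff_add_eq_0 add.commute)
  then have "i \<in> integral" using assms by (auto simp: integral_def)
  then show "i \<in> integral \<and> k + shift i = 0" using b by (simp add: shift_def)
next
  assume "i \<in> integral \<and> k + shift i = 0"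
  then show "of_int k + \<beta> i = 0" using shift[of i] by (metis of_int_0 of_int_add)
qed

text \<open>For integral \<open>i\<close> the exponent of \<open>\<alpha>\<^sub>i\<close> in \<open>\<alpha>\<^sup>a \<alpha>\<^sup>\<beta>\<close> is \<open>a i + shift i\<close>.\<close>

definition poles :: "(nat \<Rightarrow> int) \<Rightarrow> nat set" where
  "poles a = {i \<in> integral. a i + shift i < 0}"

lemma poles_lower:
  assumes "i \<in> {1..m}" "of_int (a i) + \<beta> i \<noteq> 0"
  shows "poles (a(i := a i - 1)) = poles a"
  using assms exponent_zero_iff[OF assms(1), of "a i"] by (auto simp: poles_def split: if_splits)

text \<open>The additive span of the \<open>f \<alpha>\<^sup>a\<close> whose sets of poles belong to \<open>F\<close>. Adding one such element at a time
  gives an induction with a single step.\<close>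

inductive_set polar :: "nat set set \<Rightarrow> 'n cpoly fract set" for F where
  zero: "0 \<in> polar F"
| step: "q \<in> polar F \<Longrightarrow> poles a \<in> F \<Longrightarrow> q + frac_of_poly f * alpha_pow a \<in> polar F"

lemma polar_gen: "poles a \<in> F \<Longrightarrow> frac_of_poly f * alpha_pow a \<in> polar F"
  using polar.step[OF polar.zero] by simp

lemma polar_add:
  assumes "q \<in> polar F" "r \<in> polar F"
  shows "q + r \<in> polar F"
  using assms(2)
  by (induction) (use assms(1) in \<open>auto simp: add.assoc[symmetric] intro: polar.step\<close>)

lemma polar_mono: "F \<subseteq> G \<Longrightarrow> polar F \<subseteq> polar G"
proof
  fix q assume "F \<subseteq> G" "q \<in> polar F"
  show "q \<in> polar G" using \<open>q \<in> polar F\<close>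
    by (induction) (use \<open>F \<subseteq> G\<close> in \<open>auto intro: polar.intros\<close>)
qed

lemma polar_least:
  assumes "0 \<in> C" "\<And>q r. q \<in> C \<Longrightarrow> r \<in> C \<Longrightarrow> q + r \<in> C"
    and "\<And>f a. poles a \<in> F \<Longrightarrow> frac_of_poly f * alpha_pow a \<in> C"
  shows "polar F \<subseteq> C"
proof
  fix q assume "q \<in> polar F"
  then show "q \<in> C" by induction (use assms in auto)
qed

lemma polar_sum: "(\<And>a. a \<in> A \<Longrightarrow> h a \<in> polar F) \<Longrightarrow> sum h A \<in> polar F"
  by (induction A rule: infinite_finite_induct) (auto intro: polar_add polar.zero)

text \<open>A derivative changes the set of poles only in terms that have the coefficient zero.\<close>

lemma nabla_gen_in_polar:
  assumes "poles a \<in> F"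
  shows "nabla v (frac_of_poly f * alpha_pow a) \<in> polar F"
  unfolding nabla_alpha_pow
proof (intro polar_add polar_sum)
  fix i assume i: "i \<in> {1..m}"
  show "frac_of_poly (pconst ((of_int (a i) + \<beta> i) * slope v (\<alpha> i)) * f) * alpha_pow (a(i := a i - 1)) \<in> polar F"
  proof (cases "of_int (a i) + \<beta> i = 0")
    case False
    then show ?thesis using assms i by (intro polar_gen) (simp add: poles_lower del: One_nat_def)
  qed (simp add: polar.zero)
qed (intro polar_gen assms)

lemma polar_submodule: "connection_submodule (log_form m \<alpha> \<beta>) (polar F)"
  unfolding connection_submodule_def
proof (intro conjI ballI allI polar.zero)
  fix q r assume "q \<in> polar F" "r \<in> polar F"
  then show "q + r \<in> polar F" by (rule polar_add)
next
  fix f q assume "q \<in> polar F"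
  then show "frac_of_poly f * q \<in> polar F"
  proof induction
    case (step q a g)
    then show ?case
      using polar_add[OF step.IH polar_gen[OF step.hyps(2), of "f * g"]]
      by (simp add: ring_distribs frac_of_poly_mult mult.assoc)
  qed (simp add: polar.zero)
next
  fix j q assume "q \<in> polar F"
  then have "nabla (axis j 1) q \<in> polar F"
    by induction (auto simp: nabla_add polar.zero intro!: polar_add nabla_gen_in_polar)
  then show "fderiv j q + log_form m \<alpha> \<beta> j * q \<in> polar F" by (simp add: nabla_axis)
qed

lemmas polarD = connection_submoduleD[OF polar_submodule]

lemma polar_divide:
  assumes "l \<in> {1..m} - integral" "q \<in> polar F"
  shows "q / frac_of_poly (\<alpha> l) \<in> polar F"
  using assms(2)
proof induction
  case (step q a f)
  have "poles (a(l := a l - 1)) = poles a" using assms(1) by (auto simp: poles_def)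
  then have "frac_of_poly f * alpha_pow (a(l := a l - 1)) \<in> polar F" using step.hyps(2) by (intro polar_gen) simp
  moreover have "alpha_pow a / frac_of_poly (\<alpha> l) = alpha_pow (a(l := a l - 1))"
    using assms(1) by (intro alpha_pow_lower) simp
  then have "(q + frac_of_poly f * alpha_pow a) / frac_of_poly (\<alpha> l)
      = q / frac_of_poly (\<alpha> l) + frac_of_poly f * alpha_pow (a(l := a l - 1))"
    by (simp only: add_divide_distrib times_divide_eq_right[symmetric])
  ultimately show ?case using polar_add[OF step.IH] by simp
qed (simp add: polar.zero)

lemma alpha_pow_uniform: "alpha_pow (\<lambda>_. - int k) = Fract 1 ((\<Prod>i=1..m. \<alpha> i) ^ k)"
proof -
  let ?P = "(\<Prod>i=1..m. \<alpha> i) ^ k"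
  have "alpha_pow (\<lambda>_. int k) = frac_of_poly ?P"
    by (subst alpha_pow_nonneg) (simp_all add: prod_power_distrib)
  moreover have "alpha_pow (\<lambda>_. int k) * alpha_pow (\<lambda>_. - int k) = 1"
    unfolding alpha_pow_add[symmetric] by (simp add: alpha_pow_def)
  moreover have "frac_of_poly ?P \<noteq> 0" using equation_nonzero by (simp del: One_nat_def)
  ultimately show ?thesis by (simp add: Fract_eq_divide eq_divide_eq mult.commute)
qed

lemma polar_subset_localization: "polar F \<subseteq> poly_localization (\<Prod>i=1..m. \<alpha> i)"
proof (rule polar_least)
  let ?P = "\<Prod>i=1..m. \<alpha> i"
  have nz: "?P \<noteq> 0" using equation_nonzero by (simp del: One_nat_def)
  show "0 \<in> poly_localization ?P" using poly_localization_poly[of 0 ?P] by simp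
  show "q + r \<in> poly_localization ?P" if "q \<in> poly_localization ?P" "r \<in> poly_localization ?P" for q r
    using that by (rule poly_localization_add[OF nz])
  fix f a
  define k where "k = Max (insert 0 ((\<lambda>i. nat (- a i)) ` {1..m}))"
  have k: "- int k \<le> a i" if "i \<in> {1..m}" for i
  proof -
    have "nat (- a i) \<le> k" unfolding k_def using that by (intro Max_ge) auto
    then show ?thesis by linarith
  qed
  have "alpha_pow (\<lambda>_. - int k) = Fract 1 (?P ^ k)" by (rule alpha_pow_uniform)
  then have "alpha_pow (\<lambda>_. - int k) \<in> poly_localization ?P" unfolding poly_localization_def by blast
  moreover have "alpha_pow a = frac_of_poly (\<Prod>i\<in>{1..m}. \<alpha> i ^ nat (a i - (- int k))) * alpha_pow (\<lambda>_. - int k)"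
    using k by (rule alpha_pow_le)
  ultimately show "frac_of_poly f * alpha_pow a \<in> poly_localization ?P"
    by (auto intro!: poly_localization_mult poly_localization_poly)
qed

lemma localization_eq_polar: "poly_localization (\<Prod>i=1..m. \<alpha> i) = polar (Pow integral)"
proof (intro equalityI polar_subset_localization subsetI)
  let ?P = "\<Prod>i=1..m. \<alpha> i"
  fix q assume "q \<in> poly_localization ?P"
  then obtain f k where "q = Fract f (?P ^ k)" by (auto simp: poly_localization_def)
  then have "q = frac_of_poly f * alpha_pow (\<lambda>_. - int k)"
    by (simp add: alpha_pow_uniform Fract_eq_divide)
  then show "q \<in> polar (Pow integral)" by (auto intro!: polar_gen simp: poles_def)
qed

end

section \<open>The steps of the filtration by poles are simple\<close>

context arrangement
begin

abbreviation "nonintegral \<equiv> {1..m} - integral"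

text \<open>Simple poles along \<open>T\<close>, and neither poles nor zeros along the other integral hyperplanes. The
  nonintegral exponents are left free.\<close>

definition reduced :: "nat set \<Rightarrow> (nat \<Rightarrow> int) \<Rightarrow> bool" where
  "reduced T a \<longleftrightarrow> (\<forall>i\<in>T. a i + shift i = - 1) \<and> (\<forall>i\<in>integral - T. a i + shift i = 0)"

lemma poles_reduced: "T \<subseteq> integral \<Longrightarrow> reduced T a \<Longrightarrow> poles a = T"
  unfolding poles_def reduced_def by force

text \<open>Over the common denominator with the smaller exponents, finitely many terms with poles along \<open>T\<close> become
  one. Zeros along the other integral hyperplanes are absorbed into the numerator; this makes the
  corresponding factors \<open>a\<^sub>i + \<beta>\<^sub>i\<close> vanish, so that these hyperplanes disappear from all derivatives.\<close>

lemma polar_insert_decompose: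
  assumes T: "T \<subseteq> integral" and "q \<in> polar (insert T F)"
  obtains r f a where "r \<in> polar F" "poles a = T" "\<forall>i\<in>integral - T. a i + shift i = 0"
    "q = r + frac_of_poly f * alpha_pow a"
proof -
  from assms(2) have "\<exists>r f a. r \<in> polar F \<and> poles a = T \<and> (\<forall>i\<in>integral - T. a i + shift i = 0) \<and>
      q = r + frac_of_poly f * alpha_pow a"
  proof induction
    case zero
    let ?a = "\<lambda>i. - shift i - (if i \<in> T then 1 else 0)"
    have "poles ?a = T" using T by (auto simp: poles_def)
    moreover have "\<forall>i\<in>integral - T. ?a i + shift i = 0" by simp
    ultimately show ?case
      by (intro exI[of _ 0] exI[of _ "0"] exI[of _ ?a]) (auto intro: polar.zero)
  next
    case (step q b g)
    then obtain r f a where IH: "r \<in> polar F" "poles a = T" "\<forall>i\<in>integral - T. a i + shift i = 0"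
      "q = r + frac_of_poly f * alpha_pow a" by blast
    show ?case
    proof (cases "poles b \<in> F")
      case True
      then have "r + frac_of_poly g * alpha_pow b \<in> polar F" using IH(1) polar.step by blast
      then show ?thesis using IH by (intro exI[of _ "r + frac_of_poly g * alpha_pow b"] exI[of _ f] exI[of _ a]) simp
    next
      case False
      then have b: "poles b = T" using step.hyps(2) by simp
      let ?c = "\<lambda>i. min (a i) (b i)"
      let ?P = "\<lambda>a. \<Prod>i\<in>{1..m}. \<alpha> i ^ nat (a i - ?c i)"
      have 1: "alpha_pow a = frac_of_poly (?P a) * alpha_pow ?c"
        by (rule alpha_pow_le) simp
      have 2: "alpha_pow b = frac_of_poly (?P b) * alpha_pow ?c"
        by (rule alpha_pow_le) simp
      have nz: "b i + shift i \<ge> 0" if "i \<in> integral - T" for i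
        using b that by (auto simp: poles_def)
      have "poles ?c = T"
      proof (intro equalityI subsetI)
        fix i assume "i \<in> poles ?c"
        then have "i \<in> poles a \<or> i \<in> poles b" by (auto simp: poles_def min_def split: if_splits)
        then show "i \<in> T" using IH(2) b by blast
      next
        fix i assume "i \<in> T"
        then have "i \<in> poles a" using IH(2) by blast
        then show "i \<in> poles ?c" by (auto simp: poles_def)
      qed
      moreover have "\<forall>i\<in>integral - T. ?c i + shift i = 0"
      proof
        fix i assume i: "i \<in> integral - T"
        have "a i + shift i = 0" using IH(3) i by blast
        then show "?c i + shift i = 0" using nz[OF i] by (auto simp: min_def)
      qed
      moreover have "q + frac_of_poly g * alpha_pow b
          = r + frac_of_poly (f * ?P a + g * ?P b) * alpha_pow ?c"
        unfolding IH(4) by (subst 1, subst 2) (simp only: frac_of_poly_add frac_of_poly_mult ring_distribs mult.assoc add.assoc)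
      ultimately show ?thesis using IH(1) by blast
    qed
  qed
  then show thesis using that by blast
qed

lemma nabla_alpha_pow_split:
  assumes T: "T \<subseteq> integral" and a: "\<forall>i\<in>integral - T. a i + shift i = 0"
  shows "nabla v (frac_of_poly f * alpha_pow a) = frac_of_poly (pdir v f) * alpha_pow a
    + (\<Sum>i\<in>T. frac_of_poly (pconst (of_int (a i + shift i) * slope v (\<alpha> i)) * f) * alpha_pow (a(i := a i - 1)))
    + (\<Sum>i\<in>nonintegral. frac_of_poly (pconst ((of_int (a i) + \<beta> i) * slope v (\<alpha> i)) * f) * alpha_pow (a(i := a i - 1)))"
proof -
  let ?t = "\<lambda>i. frac_of_poly (pconst ((of_int (a i) + \<beta> i) * slope v (\<alpha> i)) * f) * alpha_pow (a(i := a i - 1))"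
  have "sum ?t {1..m} = sum ?t integral + sum ?t nonintegral"
    using integral_subset by (subst sum.subset_diff[of integral]) (auto simp: add.commute)
  also have "sum ?t integral = sum ?t T"
  proof (rule sum.mono_neutral_right[OF finite_integral T])
    show "\<forall>i\<in>integral - T. ?t i = 0"
    proof
      fix i assume i: "i \<in> integral - T"
      then have "of_int (a i) + \<beta> i = 0" using a exponent_zero_iff[of i "a i"] integral_subset by blast
      then show "?t i = 0" by simp
    qed
  qed
  also have "sum ?t T = (\<Sum>i\<in>T. frac_of_poly (pconst (of_int (a i + shift i) * slope v (\<alpha> i)) * f) * alpha_pow (a(i := a i - 1)))"
  proof (rule sum.cong[OF HOL.refl])
    fix i assume "i \<in> T"
    then have "of_int (a i) + \<beta> i = of_int (a i + shift i)" using T shift[of i] by auto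
    then show "?t i = frac_of_poly (pconst (of_int (a i + shift i) * slope v (\<alpha> i)) * f) * alpha_pow (a(i := a i - 1))"
      by simp
  qed
  finally show ?thesis unfolding nabla_alpha_pow by (simp only: add.assoc)
qed

lemma alpha_pow_raise_set:
  assumes "R \<subseteq> {1..m}"
  shows "frac_of_poly (\<Prod>i\<in>R. \<alpha> i) * alpha_pow a = alpha_pow (\<lambda>i. if i \<in> R then a i + 1 else a i)"
proof -
  have "(\<Prod>i\<in>R. \<alpha> i) = (\<Prod>i\<in>{1..m}. \<alpha> i ^ nat (if i \<in> R then 1 else 0))"
    using assms by (intro prod.mono_neutral_cong_left) auto
  also have "frac_of_poly \<dots> = alpha_pow (\<lambda>i. if i \<in> R then 1 else 0)"
    by (subst alpha_pow_nonneg) auto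
  also have "\<dots> * alpha_pow a = alpha_pow (\<lambda>i. (if i \<in> R then 1 else 0) + a i)"
    by (rule alpha_pow_add[symmetric])
  also have "\<dots> = alpha_pow (\<lambda>i. if i \<in> R then a i + 1 else a i)"
    by (rule alpha_pow_cong) auto
  finally show ?thesis .
qed

lemma polar_cancel:
  assumes "R \<subseteq> nonintegral" "frac_of_poly (\<Prod>i\<in>R. \<alpha> i) * q \<in> polar F"
  shows "q \<in> polar F"
proof -
  have "finite R" using assms(1) finite_subset by blast
  then show ?thesis using assms
  proof (induction R arbitrary: q)
    case (insert l R)
    have l: "l \<in> {1..m} - integral" using insert.prems by blast
    then have nz: "frac_of_poly (\<alpha> l) \<noteq> 0" by (intro frac_equation_nonzero) blast
    have "frac_of_poly (\<Prod>i\<in>insert l R. \<alpha> i) * q / frac_of_poly (\<alpha> l) \<in> polar F"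
      using l insert.prems(2) by (rule polar_divide)
    also have "frac_of_poly (\<Prod>i\<in>insert l R. \<alpha> i) * q / frac_of_poly (\<alpha> l) = frac_of_poly (\<Prod>i\<in>R. \<alpha> i) * q"
      using nz insert.hyps by (simp add: frac_of_poly_mult)
    finally show ?case using insert.IH insert.prems by blast
  qed simp
qed

end

text \<open>The setting of one step of the filtration: the integral hyperplanes in \<open>T\<close> meet in a point, all
  proper subsets of \<open>T\<close> have been admitted before, and \<open>C\<close> is a submodule above this stage.\<close>

locale polar_step = arrangement m \<alpha> \<beta>
  for m and \<alpha> :: "nat \<Rightarrow> 'n::{finite,linorder} cpoly" and \<beta> +
  fixes T :: "nat set" and F :: "nat set set" and p :: "(complex, 'n) vec" and C :: "'n cpoly fract set"
  assumes T_integral: "T \<subseteq> integral"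
    and proper_subsets: "\<And>T'. T' \<subset> T \<Longrightarrow> T' \<in> F"
    and point: "\<And>i. i \<in> T \<Longrightarrow> peval p (\<alpha> i) = 0"
    and submodule: "connection_submodule (log_form m \<alpha> \<beta>) C"
    and above: "polar F \<subseteq> C"
begin

lemmas CD = connection_submoduleD[OF submodule]

lemma T_subset: "T \<subseteq> {1..m}"
  using T_integral integral_subset by blast

lemma finite_T: "finite T"
  using T_subset finite_subset by blast

lemma kill_pole:
  assumes "poles a = T" "i \<in> T" "a i + shift i = - 1"
  shows "frac_of_poly (\<alpha> i * f) * alpha_pow a \<in> polar F"
proof -
  have "poles (a(i := a i + 1)) = T - {i}"
    using assms by (auto simp: poles_def)
  then have "poles (a(i := a i + 1)) \<in> F" using assms(2) by (auto intro: proper_subsets)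
  then have "frac_of_poly f * alpha_pow (a(i := a i + 1)) \<in> polar F" by (rule polar_gen)
  moreover have "frac_of_poly f * alpha_pow (a(i := a i + 1)) = frac_of_poly (\<alpha> i * f) * alpha_pow a"
    using assms(2) T_subset alpha_pow_raise[of i a, symmetric] by (auto simp: frac_of_poly_mult)
  ultimately show ?thesis by simp
qed

lemma pole_order_decreases:
  assumes "i \<in> T" "a i + shift i < 0"
  shows "(\<Sum>k\<in>T. nat (- ((a(i := a i + 1)) k + shift k))) < (\<Sum>k\<in>T. nat (- (a k + shift k)))"
  using finite_T by (rule sum_strict_mono_ex1) (use assms in auto)

text \<open>If \<open>\<alpha>\<^sub>i u\<close> has fallen into the previous stage although the pole of \<open>u\<close> along \<open>H\<^sub>i\<close> is not simple, then
  differentiating \<open>\<alpha>\<^sub>i u\<close> in the direction dual to \<open>\<alpha>\<^sub>i\<close> shows that \<open>u\<close> is congruent to an element with a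
  smaller pole. So a nonzero class contains an element with simple poles.\<close>

lemma reduce_pole_order:
  assumes "poles a = T" "\<forall>i\<in>integral - T. a i + shift i = 0"
    and "frac_of_poly f * alpha_pow a \<in> C - polar F"
  shows "\<exists>f a. reduced T a \<and> frac_of_poly f * alpha_pow a \<in> C - polar F"
  using assms
proof (induction "\<Sum>i\<in>T. nat (- (a i + shift i))" arbitrary: f a rule: less_induct)
  case less
  show ?case
  proof (cases "\<forall>i\<in>T. a i + shift i = - 1")
    case True
    then show ?thesis using less.prems unfolding reduced_def by blast
  next
    case False
    then obtain i where i: "i \<in> T" "a i + shift i \<noteq> - 1" by blast
    have "i \<in> poles a" using i(1) less.prems(1) by simp
    with i(2) have i2: "a i + shift i < - 1" by (simp add: poles_def)
    have im: "i \<in> {1..m}" using i(1) T_subset by blast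
    obtain d where d: "\<And>i k. i \<in> T \<Longrightarrow> k \<in> T \<Longrightarrow> slope (d i) (\<alpha> k) = (if i = k then 1 else 0)"
      using dual_directions[OF T_subset point] by blast
    define b where "b = a(i := a i + 1)"
    have ab: "b(i := b i - 1) = a" by (auto simp: b_def)
    have b: "poles b = T" "\<forall>i\<in>integral - T. b i + shift i = 0"
      using less.prems(1,2) i i2 by (auto simp: b_def poles_def)
    have less_b: "(\<Sum>i\<in>T. nat (- (b i + shift i))) < (\<Sum>i\<in>T. nat (- (a i + shift i)))"
      unfolding b_def by (rule pole_order_decreases) (use i i2 in auto)
    have bC: "frac_of_poly f * alpha_pow b \<in> C"
    proof -
      have "frac_of_poly f * alpha_pow b = frac_of_poly (\<alpha> i) * (frac_of_poly f * alpha_pow a)"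
        unfolding b_def alpha_pow_raise[OF im, symmetric] by simp
      moreover have "frac_of_poly (\<alpha> i) * (frac_of_poly f * alpha_pow a) \<in> C"
        using less.prems(3) CD(3) by blast
      ultimately show ?thesis by (simp only:)
    qed
    show ?thesis
    proof (cases "frac_of_poly f * alpha_pow b \<in> polar F")
      case False
      then show ?thesis using less.hyps[OF less_b b] bC by blast
    next
      case True
      define c where "c = complex_of_int (b i + shift i)"
      have "b i + shift i \<noteq> 0" using i2 by (simp add: b_def)
      then have c: "c \<noteq> 0" unfolding c_def of_int_eq_0_iff .
      let ?rest = "\<Sum>k\<in>nonintegral. frac_of_poly (pconst ((of_int (b k) + \<beta> k) * slope (d i) (\<alpha> k)) * f) * alpha_pow (b(k := b k - 1))"
      have "(\<Sum>k\<in>T. frac_of_poly (pconst (of_int (b k + shift k) * slope (d i) (\<alpha> k)) * f) * alpha_pow (b(k := b k - 1)))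
          = (\<Sum>k\<in>T. if k = i then frac_of_poly (pconst c * f) * alpha_pow a else 0)"
        by (rule sum.cong) (use d i(1) in \<open>auto simp: c_def ab[unfolded fun_upd_def] fun_upd_def\<close>)
      also have "\<dots> = frac_of_poly (pconst c * f) * alpha_pow a"
        using i(1) finite_T by simp
      finally have N: "nabla (d i) (frac_of_poly f * alpha_pow b) = frac_of_poly (pdir (d i) f) * alpha_pow b
          + frac_of_poly (pconst c * f) * alpha_pow a + ?rest"
        using nabla_alpha_pow_split[OF T_integral b(2), of "d i" f] by simp
      have "?rest \<in> polar F"
      proof (rule polar_sum)
        fix k assume k: "k \<in> nonintegral"
        then have "frac_of_poly f * alpha_pow b / frac_of_poly (\<alpha> k) \<in> polar F"
          using True by (intro polar_divide) auto
        then have "frac_of_poly f * alpha_pow (b(k := b k - 1)) \<in> polar F"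
          using k alpha_pow_lower[of k b] by (simp del: fun_upd_apply flip: times_divide_eq_right)
        then show "frac_of_poly (pconst ((of_int (b k) + \<beta> k) * slope (d i) (\<alpha> k)) * f) * alpha_pow (b(k := b k - 1)) \<in> polar F"
          by (simp add: frac_of_poly_mult mult.assoc polarD(3))
      qed
      moreover have "nabla (d i) (frac_of_poly f * alpha_pow b) \<in> polar F"
        using polar_submodule True by (rule nabla_in_submodule)
      ultimately have "nabla (d i) (frac_of_poly f * alpha_pow b) - ?rest \<in> polar F"
        using polarD(6) by blast
      then have S: "frac_of_poly (pdir (d i) f) * alpha_pow b + frac_of_poly (pconst c) * (frac_of_poly f * alpha_pow a) \<in> polar F"
        by (simp add: N frac_of_poly_mult mult.assoc)
      have "frac_of_poly (pdir (d i) f) * alpha_pow b \<in> C"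
      proof -
        have "frac_of_poly (pconst c) * (frac_of_poly f * alpha_pow a) \<in> C" using less.prems(3) CD(3) by blast
        then have "(frac_of_poly (pdir (d i) f) * alpha_pow b + frac_of_poly (pconst c) * (frac_of_poly f * alpha_pow a))
            - frac_of_poly (pconst c) * (frac_of_poly f * alpha_pow a) \<in> C"
          using S above CD(6) by blast
        then show ?thesis by simp
      qed
      moreover have "frac_of_poly (pdir (d i) f) * alpha_pow b \<notin> polar F"
      proof
        assume "frac_of_poly (pdir (d i) f) * alpha_pow b \<in> polar F"
        then have "(frac_of_poly (pdir (d i) f) * alpha_pow b + frac_of_poly (pconst c) * (frac_of_poly f * alpha_pow a))
            - frac_of_poly (pdir (d i) f) * alpha_pow b \<in> polar F"
          using S polarD(6) by blast
        then have "frac_of_poly (pconst c) * (frac_of_poly f * alpha_pow a) \<in> polar F" by simp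
        then show False
          using connection_submodule_unscale[OF polar_submodule c] less.prems(3) by blast
      qed
      ultimately show ?thesis using less.hyps[OF less_b b] by blast
    qed
  qed
qed

text \<open>Derivatives along \<open>H\<^sub>T\<close> lower the degree of the numerator, while multiples of the \<open>\<alpha>\<^sub>i\<close> with \<open>i\<close> in \<open>T\<close>
  do not matter. If all these derivatives vanish modulo the previous stage, then so does the Euler
  derivative at a point of \<open>H\<^sub>T\<close>. It agrees with a multiple of \<open>f\<close> up to lower degree, so that the degree can be
  lowered in this case as well.\<close>

lemma reduce_degree:
  assumes "total_degree f \<le> n" "reduced T a" "frac_of_poly f * alpha_pow a \<in> C - polar F"
  shows "\<exists>a. reduced T a \<and> alpha_pow a \<in> C"
  using assms
proof (induction n arbitrary: f a)
  case 0
  then obtain c where c: "f = pconst c" using total_degree_0 by blast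
  have "c \<noteq> 0" using 0(3) polar.zero by (auto simp: c)
  then have "alpha_pow a \<in> C"
    using connection_submodule_unscale[OF submodule] 0(3) c by blast
  then show ?case using 0(2) by blast
next
  case (Suc n)
  obtain d where d: "\<And>i k. i \<in> T \<Longrightarrow> k \<in> T \<Longrightarrow> slope (d i) (\<alpha> k) = (if i = k then 1 else 0)"
    using dual_directions[OF T_subset point] by blast
  \<comment> \<open>The coordinate fields, made tangent to \<open>H\<^sub>T\<close> by subtracting multiples of the dual fields.\<close>
  define w where "w j = axis j 1 - (\<Sum>i\<in>T. lookup (\<alpha> i) (single j 1) *s d i)" for j
  have tangent: "slope (w j) (\<alpha> k) = 0" if k: "k \<in> T" for j k
  proof -
    have "(\<Sum>i\<in>T. lookup (\<alpha> i) (single j 1) * slope (d i) (\<alpha> k)) = (\<Sum>i\<in>T. if i = k then lookup (\<alpha> k) (single j 1) else 0)"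
      by (rule sum.cong) (use d k in auto)
    also have "\<dots> = lookup (\<alpha> k) (single j 1)" using k finite_T by simp
    finally show ?thesis by (simp add: w_def slope_diff slope_sum slope_scale slope_axis del: One_nat_def)
  qed
  have poles_a: "poles a = T" using T_integral Suc.prems(2) by (rule poles_reduced)
  show ?case
  proof (cases "\<exists>j. frac_of_poly (pdir (w j) f) * alpha_pow a \<notin> polar F")
    case True
    then obtain j where j: "frac_of_poly (pdir (w j) f) * alpha_pow a \<notin> polar F" by blast
    let ?g = "\<Prod>l\<in>nonintegral. \<alpha> l"
    let ?b = "\<lambda>i. if i \<in> nonintegral then a i + 1 else a i"
    let ?rest = "\<Sum>k\<in>nonintegral. frac_of_poly (pconst ((of_int (a k) + \<beta> k) * slope (w j) (\<alpha> k)) * f) * alpha_pow (a(k := a k - 1))"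
    have gb: "frac_of_poly ?g * alpha_pow a = alpha_pow ?b"
      by (rule alpha_pow_raise_set) blast
    have "(\<Sum>i\<in>T. frac_of_poly (pconst (of_int (a i + shift i) * slope (w j) (\<alpha> i)) * f) * alpha_pow (a(i := a i - 1))) = 0"
      by (rule sum.neutral) (simp add: tangent)
    then have N: "nabla (w j) (frac_of_poly f * alpha_pow a) = frac_of_poly (pdir (w j) f) * alpha_pow a + ?rest"
      using nabla_alpha_pow_split[OF T_integral, of a "w j" f] Suc.prems(2) by (simp add: reduced_def)
    have "frac_of_poly ?g * ?rest \<in> C"
      unfolding sum_distrib_left
    proof (rule connection_submodule_sum[OF submodule])
      fix k assume k: "k \<in> nonintegral"
      let ?c = "pconst ((of_int (a k) + \<beta> k) * slope (w j) (\<alpha> k))"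
      have km: "k \<in> {1..m}" using k by blast
      have "?g = (\<Prod>l\<in>nonintegral - {k}. \<alpha> l) * \<alpha> k"
        using k by (subst prod.remove[of nonintegral k]) (simp_all add: mult.commute)
      then have "frac_of_poly ?g = frac_of_poly (\<Prod>l\<in>nonintegral - {k}. \<alpha> l) * frac_of_poly (\<alpha> k)"
        by (simp only: frac_of_poly_mult)
      then have "frac_of_poly ?g * (frac_of_poly (?c * f) * alpha_pow (a(k := a k - 1)))
          = frac_of_poly (?c * (\<Prod>l\<in>nonintegral - {k}. \<alpha> l)) * (frac_of_poly f * alpha_pow a)"
        unfolding alpha_pow_lower[OF km, symmetric] using frac_equation_nonzero[OF km]
        by (simp add: frac_of_poly_mult)
      then show "frac_of_poly ?g * (frac_of_poly (?c * f) * alpha_pow (a(k := a k - 1))) \<in> C"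
        using Suc.prems(3) CD(3) by simp
    qed
    moreover have "frac_of_poly ?g * nabla (w j) (frac_of_poly f * alpha_pow a) \<in> C"
      using nabla_in_submodule[OF submodule] Suc.prems(3) CD(3) by blast
    ultimately have "frac_of_poly ?g * nabla (w j) (frac_of_poly f * alpha_pow a) - frac_of_poly ?g * ?rest \<in> C"
      using CD(6) by blast
    then have "frac_of_poly ?g * (frac_of_poly (pdir (w j) f) * alpha_pow a) \<in> C"
      by (simp only: N ring_distribs add_diff_cancel_right')
    moreover have "frac_of_poly ?g * (frac_of_poly (pdir (w j) f) * alpha_pow a) \<notin> polar F"
      using polar_cancel[of nonintegral] j by blast
    ultimately have "frac_of_poly (pdir (w j) f) * alpha_pow ?b \<in> C - polar F"
      unfolding gb[symmetric] by (simp add: mult.left_commute)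
    moreover have "reduced T ?b" using Suc.prems(2) T_integral by (auto simp: reduced_def)
    moreover have "total_degree (pdir (w j) f) \<le> n" using Suc.prems(1) by (rule total_degree_pdir)
    ultimately show ?thesis using Suc.IH by blast
  next
    case False
    have "euler p f = (\<Sum>j\<in>UNIV. (pvar j - pconst (p $ j)) * pdir (w j) f) + (\<Sum>i\<in>T. \<alpha> i * pdir (d i) f)"
    proof -
      have "pdir (w j) f = pderiv j f - (\<Sum>i\<in>T. pconst (lookup (\<alpha> i) (single j 1)) * pdir (d i) f)" for j
        by (simp add: w_def pdir_diff pdir_axis pdir_vector_sum pdir_scale del: One_nat_def)
      then have "(\<Sum>j\<in>UNIV. (pvar j - pconst (p $ j)) * pdir (w j) f)
          = euler p f - (\<Sum>j\<in>UNIV. \<Sum>i\<in>T. (pvar j - pconst (p $ j)) * (pconst (lookup (\<alpha> i) (single j 1)) * pdir (d i) f))"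
        by (simp add: euler_def right_diff_distrib sum_subtractf sum_distrib_left del: One_nat_def)
      also have "(\<Sum>j\<in>UNIV. \<Sum>i\<in>T. (pvar j - pconst (p $ j)) * (pconst (lookup (\<alpha> i) (single j 1)) * pdir (d i) f))
          = (\<Sum>i\<in>T. (\<Sum>j\<in>UNIV. pconst (lookup (\<alpha> i) (single j 1)) * (pvar j - pconst (p $ j))) * pdir (d i) f)"
        by (subst sum.swap) (simp add: sum_distrib_left sum_distrib_right mult_ac del: One_nat_def)
      also have "\<dots> = (\<Sum>i\<in>T. \<alpha> i * pdir (d i) f)"
      proof (rule sum.cong[OF HOL.refl])
        fix i assume "i \<in> T"
        then have "\<alpha> i = (\<Sum>j\<in>UNIV. pconst (lookup (\<alpha> i) (single j 1)) * (pvar j - pconst (p $ j)))"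
          using T_subset point by (intro affine_form_at degree_le) auto
        then show "(\<Sum>j\<in>UNIV. pconst (lookup (\<alpha> i) (single j 1)) * (pvar j - pconst (p $ j))) * pdir (d i) f
            = \<alpha> i * pdir (d i) f" by simp
      qed
      finally show ?thesis by simp
    qed
    then have "frac_of_poly (euler p f) * alpha_pow a
        = (\<Sum>j\<in>UNIV. frac_of_poly (pvar j - pconst (p $ j)) * (frac_of_poly (pdir (w j) f) * alpha_pow a))
          + (\<Sum>i\<in>T. frac_of_poly (\<alpha> i * pdir (d i) f) * alpha_pow a)"
      by (simp only: frac_of_poly_add frac_of_poly_sum semiring_class.distrib_right sum_distrib_right frac_of_poly_mult mult.assoc)
    also have "\<dots> \<in> polar F"
    proof (rule polar_add)
      show "(\<Sum>j\<in>UNIV. frac_of_poly (pvar j - pconst (p $ j)) * (frac_of_poly (pdir (w j) f) * alpha_pow a)) \<in> polar F"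
        by (rule polar_sum, rule polarD(3)) (use False in blast)
      show "(\<Sum>i\<in>T. frac_of_poly (\<alpha> i * pdir (d i) f) * alpha_pow a) \<in> polar F"
        using poles_a Suc.prems(2) by (intro polar_sum kill_pole) (auto simp: reduced_def)
    qed
    finally have E: "frac_of_poly (euler p f) * alpha_pow a \<in> polar F" .
    define g where "g = pconst (of_nat (Suc n)) * f - euler p f"
    have g: "frac_of_poly (pconst (of_nat (Suc n))) * (frac_of_poly f * alpha_pow a)
        = frac_of_poly g * alpha_pow a + frac_of_poly (euler p f) * alpha_pow a"
      by (simp add: g_def frac_of_poly_diff frac_of_poly_mult algebra_simps del: of_nat_Suc)
    have "frac_of_poly g * alpha_pow a \<in> C"
    proof -
      have "frac_of_poly (pconst (of_nat (Suc n))) * (frac_of_poly f * alpha_pow a) \<in> C"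
        using Suc.prems(3) CD(3) by blast
      then have "frac_of_poly (pconst (of_nat (Suc n))) * (frac_of_poly f * alpha_pow a) - frac_of_poly (euler p f) * alpha_pow a \<in> C"
        using CD(6) E above by blast
      then show ?thesis unfolding g by simp
    qed
    moreover have "frac_of_poly g * alpha_pow a \<notin> polar F"
    proof
      assume "frac_of_poly g * alpha_pow a \<in> polar F"
      then have "frac_of_poly (pconst (of_nat (Suc n))) * (frac_of_poly f * alpha_pow a) \<in> polar F"
        unfolding g using E by (rule polar_add)
      moreover have "(of_nat (Suc n) :: complex) \<noteq> 0" by (simp del: of_nat_Suc)
      ultimately have "frac_of_poly f * alpha_pow a \<in> polar F"
        using connection_submodule_unscale[OF polar_submodule] by blast
      then show False using Suc.prems(3) by blast
    qed
    moreover have "total_degree g \<le> n"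
      unfolding g_def using Suc.prems(1) by (rule total_degree_euler)
    ultimately show ?thesis using Suc.IH Suc.prems(2) by blast
  qed
qed

text \<open>The exponent of a nonintegral \<open>\<alpha>\<^sub>l\<close> can be lowered because \<open>a\<^sub>l + \<beta>\<^sub>l\<close> is not zero. If the ideal \<open>J\<close> of
  the possible numerators over \<open>\<alpha>\<^sub>l\<close> were proper, the products of equations in it would have a common
  zero; but differentiating in a direction dual to \<open>\<alpha>\<^sub>l\<close> at this point gives a product in \<open>J\<close> that does not
  vanish there.\<close>

lemma lower_nonintegral:
  assumes a: "reduced T a" "alpha_pow a \<in> C" and l: "l \<in> nonintegral"
  shows "alpha_pow (a(l := a l - 1)) \<in> C"
proof (rule ccontr)
  assume not: "alpha_pow (a(l := a l - 1)) \<notin> C"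
  define b where "b = a(l := a l - 1)"
  have lm: "l \<in> {1..m}" using l by blast
  have ab: "frac_of_poly (\<alpha> l) * alpha_pow b = alpha_pow a"
    unfolding alpha_pow_raise[OF lm] by (simp add: b_def)
  have lT: "l \<notin> T" using l T_integral by blast
  then have "reduced T b" using a(1) l by (auto simp: reduced_def b_def)
  then have poles_b: "poles b = T" and b1: "\<And>i. i \<in> T \<Longrightarrow> b i + shift i = - 1"
    using poles_reduced[OF T_integral] by (auto simp: reduced_def)
  define J where "J = {s. frac_of_poly s * alpha_pow b \<in> C}"
  have "poly_ideal J"
    using CD by (auto simp: poly_ideal_def J_def frac_of_poly_add frac_of_poly_mult ring_distribs mult.assoc)
  moreover have "1 \<notin> J" using not by (simp add: J_def b_def)
  ultimately obtain x where x: "\<And>R. R \<subseteq> {1..m} \<Longrightarrow> (\<Prod>i\<in>R. \<alpha> i) \<in> J \<Longrightarrow> \<exists>i\<in>R. peval x (\<alpha> i) = 0"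
    using affine_products_common_zero[of "{1..m}" \<alpha> J] degree_le by blast
  define E where "E = {i \<in> {1..m}. peval x (\<alpha> i) = 0}"
  have "l \<in> E"
    using x[of "{l}"] a(2) lm ab by (simp add: E_def J_def)
  have "T \<subseteq> E"
  proof
    fix i assume i: "i \<in> T"
    have "frac_of_poly (\<alpha> i * 1) * alpha_pow b \<in> polar F"
      using poles_b i b1[OF i] by (rule kill_pole)
    then have "\<alpha> i \<in> J" using above by (auto simp: J_def)
    then show "i \<in> E" using x[of "{i}"] i T_subset by (auto simp: E_def)
  qed
  have E: "E \<subseteq> {1..m}" "\<And>i. i \<in> E \<Longrightarrow> peval x (\<alpha> i) = 0" by (auto simp: E_def)
  obtain d where d: "\<And>i k. i \<in> E \<Longrightarrow> k \<in> E \<Longrightarrow> slope (d i) (\<alpha> k) = (if i = k then 1 else 0)"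
    using dual_directions[OF E] by blast
  let ?v = "d l"
  \<comment> \<open>The field \<open>d l\<close> kills all equations of hyperplanes through \<open>x\<close> but \<open>\<alpha> l\<close>, and \<open>r\<close> clears the
    denominators that come from the other hyperplanes.\<close>
  define R where "R = nonintegral - E"
  define r where "r = (\<Prod>i\<in>R. \<alpha> i)"
  define c where "c k = (of_int (a k) + \<beta> k) * slope ?v (\<alpha> k)" for k
  have "(\<Sum>i\<in>T. frac_of_poly (pconst (of_int (a i + shift i) * slope ?v (\<alpha> i)) * 1) * alpha_pow (a(i := a i - 1))) = 0"
  proof (rule sum.neutral, rule ballI)
    fix i assume "i \<in> T"
    then have "slope ?v (\<alpha> i) = 0" using d[OF \<open>l \<in> E\<close>, of i] \<open>T \<subseteq> E\<close> lT by auto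
    then show "frac_of_poly (pconst (of_int (a i + shift i) * slope ?v (\<alpha> i)) * 1) * alpha_pow (a(i := a i - 1)) = 0"
      by simp
  qed
  then have N: "nabla ?v (alpha_pow a) = (\<Sum>k\<in>nonintegral. frac_of_poly (pconst (c k)) * alpha_pow (a(k := a k - 1)))"
    using nabla_alpha_pow_split[OF T_integral, of a ?v 1] a(1) by (simp add: reduced_def c_def)
  have "frac_of_poly r * (frac_of_poly (pconst (c k)) * alpha_pow (a(k := a k - 1))) \<in> C" if k: "k \<in> nonintegral - {l}" for k
  proof (cases "k \<in> E")
    case True
    then have "c k = 0" using d[OF \<open>l \<in> E\<close>, of k] k by (auto simp: c_def)
    then show ?thesis using CD(1) by simp
  next
    case False
    then have kR: "k \<in> R" and km: "k \<in> {1..m}" using k by (auto simp: R_def)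
    have "finite R" by (simp add: R_def)
    then have "frac_of_poly r = frac_of_poly (\<Prod>i\<in>R - {k}. \<alpha> i) * frac_of_poly (\<alpha> k)"
      using kR by (simp add: r_def prod.remove[of R k] frac_of_poly_mult mult.commute)
    then have "frac_of_poly r * (frac_of_poly (pconst (c k)) * alpha_pow (a(k := a k - 1)))
        = frac_of_poly (pconst (c k) * (\<Prod>i\<in>R - {k}. \<alpha> i)) * alpha_pow a"
      unfolding alpha_pow_lower[OF km, symmetric] using frac_equation_nonzero[OF km]
      by (simp add: frac_of_poly_mult)
    then show ?thesis using a(2) CD(3) by simp
  qed
  then have rest: "(\<Sum>k\<in>nonintegral - {l}. frac_of_poly r * (frac_of_poly (pconst (c k)) * alpha_pow (a(k := a k - 1)))) \<in> C"
    by (intro connection_submodule_sum[OF submodule])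
  have "frac_of_poly r * nabla ?v (alpha_pow a) \<in> C"
    using nabla_in_submodule[OF submodule a(2)] CD(3) by blast
  also have "frac_of_poly r * nabla ?v (alpha_pow a) = frac_of_poly r * (frac_of_poly (pconst (c l)) * alpha_pow b)
      + (\<Sum>k\<in>nonintegral - {l}. frac_of_poly r * (frac_of_poly (pconst (c k)) * alpha_pow (a(k := a k - 1))))"
    unfolding N sum_distrib_left b_def using l by (subst sum.remove[of nonintegral l]) auto
  finally have "frac_of_poly r * (frac_of_poly (pconst (c l)) * alpha_pow b) \<in> C"
    by (drule_tac CD(6)[OF _ rest]) (simp only: add_diff_cancel_right')
  then have "frac_of_poly (pconst (c l)) * (frac_of_poly r * alpha_pow b) \<in> C"
    by (simp add: mult.left_commute)
  moreover have "c l \<noteq> 0"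
    using exponent_zero_iff[OF lm, of "a l"] l d[OF \<open>l \<in> E\<close> \<open>l \<in> E\<close>] by (simp add: c_def)
  ultimately have "r \<in> J"
    using connection_submodule_unscale[OF submodule] by (simp add: J_def)
  then show False using x[of R] by (auto simp: r_def R_def E_def)
qed

text \<open>Raising exponents is multiplication by polynomials, so with the preceding lemma all nonintegral
  exponents can be reached.\<close>

lemma reduced_in_submodule:
  assumes a: "reduced T a" "alpha_pow a \<in> C" and "reduced T b"
  shows "alpha_pow b \<in> C"
  using assms(3)
proof (induction "\<Sum>l\<in>nonintegral. nat (a l - b l)" arbitrary: b rule: less_induct)
  case less
  have int: "a i = b i" if "i \<in> integral" for i
    using a(1) less.prems that unfolding reduced_def by (cases "i \<in> T") force+
  show ?case
  proof (cases "\<forall>l\<in>nonintegral. a l \<le> b l")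
    case True
    have "a i \<le> b i" if "i \<in> {1..m}" for i
      using True int that by (cases "i \<in> integral") auto
    then show ?thesis using alpha_pow_le[of a b] a(2) CD(3) by simp
  next
    case False
    then obtain l where l: "l \<in> nonintegral" "b l < a l" by force
    let ?b = "b(l := b l + 1)"
    have lT: "l \<notin> T" using l T_integral by blast
    have r: "reduced T ?b" using less.prems l lT by (auto simp: reduced_def)
    have "(\<Sum>k\<in>nonintegral. nat (a k - ?b k)) < (\<Sum>k\<in>nonintegral. nat (a k - b k))"
      by (rule sum_strict_mono_ex1) (use l in auto)
    then have "alpha_pow ?b \<in> C" using r by (rule less.hyps)
    then have "alpha_pow (?b(l := ?b l - 1)) \<in> C" using lower_nonintegral[OF r _ l(1)] by blast
    then show ?thesis by simp
  qed
qed

text \<open>Conversely the pole along \<open>H\<^sub>i\<close> grows under the derivative dual to \<open>\<alpha>\<^sub>i\<close>.\<close>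

lemma raise_pole_order:
  assumes red: "\<And>a. reduced T a \<Longrightarrow> alpha_pow a \<in> C"
    and "poles a = T" "\<forall>i\<in>integral - T. a i + shift i = 0"
  shows "alpha_pow a \<in> C"
  using assms(2,3)
proof (induction "\<Sum>i\<in>T. nat (- (a i + shift i))" arbitrary: a rule: less_induct)
  case less
  show ?case
  proof (cases "\<forall>i\<in>T. a i + shift i = - 1")
    case True
    then show ?thesis using less.prems red unfolding reduced_def by blast
  next
    case False
    then obtain i where i: "i \<in> T" "a i + shift i \<noteq> - 1" by blast
    have "i \<in> poles a" using i(1) less.prems(1) by simp
    with i(2) have i2: "a i + shift i < - 1" by (simp add: poles_def)
    obtain d where d: "\<And>i k. i \<in> T \<Longrightarrow> k \<in> T \<Longrightarrow> slope (d i) (\<alpha> k) = (if i = k then 1 else 0)"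
      using dual_directions[OF T_subset point] by blast
    define b where "b = a(i := a i + 1)"
    have ab: "b(i := b i - 1) = a" by (auto simp: b_def)
    have b: "poles b = T" "\<forall>i\<in>integral - T. b i + shift i = 0"
      using less.prems(1,2) i i2 by (auto simp: b_def poles_def)
    have less_b: "(\<Sum>i\<in>T. nat (- (b i + shift i))) < (\<Sum>i\<in>T. nat (- (a i + shift i)))"
      unfolding b_def by (rule pole_order_decreases) (use i i2 in auto)
    have bC: "alpha_pow b \<in> C" by (rule less.hyps[OF less_b b])
    define c where "c = complex_of_int (b i + shift i)"
    have "b i + shift i \<noteq> 0" using i2 by (simp add: b_def)
    then have c: "c \<noteq> 0" unfolding c_def of_int_eq_0_iff .
    let ?rest = "\<Sum>k\<in>nonintegral. frac_of_poly (pconst ((of_int (b k) + \<beta> k) * slope (d i) (\<alpha> k)) * 1) * alpha_pow (b(k := b k - 1))"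
    have "(\<Sum>k\<in>T. frac_of_poly (pconst (of_int (b k + shift k) * slope (d i) (\<alpha> k)) * 1) * alpha_pow (b(k := b k - 1)))
        = (\<Sum>k\<in>T. if k = i then frac_of_poly (pconst c) * alpha_pow a else 0)"
      by (rule sum.cong) (use d i(1) in \<open>auto simp: c_def ab[unfolded fun_upd_def] fun_upd_def\<close>)
    also have "\<dots> = frac_of_poly (pconst c) * alpha_pow a"
      using i(1) finite_T by simp
    finally have N: "nabla (d i) (alpha_pow b) = frac_of_poly (pconst c) * alpha_pow a + ?rest"
      using nabla_alpha_pow_split[OF T_integral b(2), of "d i" 1] by simp
    have "?rest \<in> C"
    proof (intro connection_submodule_sum[OF submodule] CD(3))
      fix k assume k: "k \<in> nonintegral"
      let ?b = "b(k := b k - 1)"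
      have "k \<notin> T" using k T_integral by blast
      have "(\<Sum>i\<in>T. nat (- (?b i + shift i))) = (\<Sum>i\<in>T. nat (- (b i + shift i)))"
        by (rule sum.cong) (use \<open>k \<notin> T\<close> in auto)
      moreover have "poles ?b = T" "\<forall>i\<in>integral - T. ?b i + shift i = 0"
        using b k by (auto simp: poles_def)
      ultimately show "alpha_pow ?b \<in> C" using less_b by (intro less.hyps) simp_all
    qed
    moreover have "nabla (d i) (alpha_pow b) \<in> C" using submodule bC by (rule nabla_in_submodule)
    ultimately have "nabla (d i) (alpha_pow b) - ?rest \<in> C" by (intro CD(6))
    then have "frac_of_poly (pconst c) * alpha_pow a \<in> C" unfolding N by simp
    then show ?thesis using connection_submodule_unscale[OF submodule c] by blast
  qed
qed

lemma all_or_nothing: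
  assumes "C \<subseteq> polar (insert T F)"
  shows "C = polar F \<or> C = polar (insert T F)"
proof (cases "C \<subseteq> polar F")
  case False
  then obtain q where q: "q \<in> C" "q \<notin> polar F" by blast
  then obtain r f a where rfa: "r \<in> polar F" "poles a = T" "\<forall>i\<in>integral - T. a i + shift i = 0"
    "q = r + frac_of_poly f * alpha_pow a"
    using polar_insert_decompose[OF T_integral] assms by blast
  have "q - r \<in> C" using q(1) rfa(1) above CD(6) by blast
  then have "frac_of_poly f * alpha_pow a \<in> C - polar F"
    using q(2) rfa(1,4) polar_add by auto
  then obtain a where "reduced T a" "alpha_pow a \<in> C"
    using reduce_pole_order[OF rfa(2,3)] reduce_degree[OF order.refl] by blast
  then have red: "alpha_pow b \<in> C" if "reduced T b" for b
    using reduced_in_submodule that by blast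
  have "polar (insert T F) \<subseteq> C"
  proof (rule polar_least)
    fix f a assume "poles a \<in> insert T F"
    then consider "poles a \<in> F" | "poles a = T" by blast
    then show "frac_of_poly f * alpha_pow a \<in> C"
    proof cases
      case 1
      then show ?thesis using polar_gen above by blast
    next
      case 2
      let ?b = "\<lambda>i. if i \<in> integral - T then - shift i else a i"
      have b: "poles ?b = T" "\<forall>i\<in>integral - T. ?b i + shift i = 0"
        using 2 T_integral by (auto simp: poles_def)
      then have "alpha_pow ?b \<in> C" using red raise_pole_order by blast
      moreover have "?b i \<le> a i" for i
        using 2 by (auto simp: poles_def)
      ultimately have "alpha_pow a \<in> C"
        using alpha_pow_le[of ?b a] CD(3) by simp
      then show ?thesis by (rule CD(3))
    qed
  qed (use CD in blast)+
  then show ?thesis using assms by blast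
qed (use above in blast)

end

section \<open>The supports of the steps\<close>

lemma of_nat_cpoly: "(of_nat k :: 'n cpoly) = pconst (of_nat k)"
  by (induction k) (auto simp: pconst_add)

lemma nat_lower_bound:
  assumes "finite A"
  shows "\<exists>K0::nat. \<forall>K\<ge>K0. \<forall>k\<in>A. (e k :: int) + int K \<ge> 0"
proof (intro exI[of _ "\<Sum>k\<in>A. nat (- e k)"] allI impI ballI)
  fix K k assume "(\<Sum>k\<in>A. nat (- e k)) \<le> K" "k \<in> A"
  moreover have "nat (- e k) \<le> (\<Sum>k\<in>A. nat (- e k))"
    using \<open>k \<in> A\<close> assms by (intro member_le_sum) auto
  ultimately show "e k + int K \<ge> 0" by linarith
qed

context arrangement
begin

abbreviation flat :: "nat set \<Rightarrow> (complex, 'n) vec set" where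
  "flat \<equiv> hyperplane_intersection \<alpha>"

lemma flat_iff: "p \<in> flat T \<longleftrightarrow> (\<forall>i\<in>T. peval p (\<alpha> i) = 0)"
  by (simp add: hyperplane_intersection_def zero_locus_def)

text \<open>The equations \<open>\<alpha>\<^sub>i\<close> with \<open>i\<close> in \<open>T\<close> behave like variables: a derivative in the direction dual to \<open>\<alpha>\<^sub>l\<close>
  lowers \<open>n\<^sub>l\<close> by one, and when all \<open>n\<^sub>i\<close> are \<open>1\<close>, then \<open>h\<close> lies in the ideal of the \<open>\<alpha>\<^sub>i\<close>.\<close>

lemma vanishes_on_flat:
  assumes T: "T \<subseteq> {1..m}" and p: "p \<in> flat T"
    and "\<And>i. i \<in> T \<Longrightarrow> n i \<ge> 1"
    and "h * (\<Prod>i\<in>T. \<alpha> i ^ (n i - 1)) = (\<Sum>i\<in>T. g i * \<alpha> i ^ n i)"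
  shows "peval p h = 0"
proof -
  have finT: "finite T" using T finite_subset by blast
  obtain d where d: "\<And>i k. i \<in> T \<Longrightarrow> k \<in> T \<Longrightarrow> slope (d i) (\<alpha> k) = (if i = k then 1 else 0)"
    using dual_directions[OF T, of p] p by (auto simp: flat_iff)
  have pd: "pdir (d i) (\<alpha> k) = (if i = k then 1 else 0)" if "i \<in> T" "k \<in> T" for i k
    using d[OF that] pdir_affine[OF degree_le] T that by auto
  show ?thesis using assms(3,4)
  proof (induction "\<Sum>i\<in>T. n i" arbitrary: n g rule: less_induct)
    case less
    show ?case
    proof (cases "\<forall>i\<in>T. n i = 1")
      case True
      then have "h = (\<Sum>i\<in>T. g i * \<alpha> i)" using less.prems(2) by simp
      then show ?thesis using p by (simp add: peval_sum peval_mult flat_iff)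
    next
      case False
      then obtain l where l: "l \<in> T" "n l \<noteq> 1" by blast
      then obtain k where k: "n l = Suc (Suc k)"
        using less.prems(1)[OF l(1)] by (cases "n l" rule: nat.exhaust) (auto simp: neq0_conv Suc_le_eq gr0_conv_Suc)
      define P where "P = (\<Prod>i\<in>T - {l}. \<alpha> i ^ (n i - 1))"
      have dP: "pdir (d l) P = 0" unfolding P_def
      proof (rule pdir_prod_zero)
        fix i assume i: "i \<in> T - {l}"
        show "pdir (d l) (\<alpha> i ^ (n i - 1)) = 0"
          using pd[OF l(1), of i] i by (cases "n i - 1") (auto simp del: power_Suc simp: pdir_power)
      qed
      define c where "c = complex_of_nat (Suc k)"
      have c: "c \<noteq> 0" by (simp add: c_def del: of_nat_Suc)
      let ?n = "n(l := n l - 1)"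
      define g' where "g' i = (if i = l then pdir (d l) (g l) * \<alpha> l + of_nat (n l) * g l - pdir (d l) h * P else pdir (d l) (g i))" for i
      have prod: "(\<Prod>i\<in>T. \<alpha> i ^ (n i - 1)) = \<alpha> l ^ Suc k * P"
        unfolding P_def using finT l(1) k by (simp add: prod.remove)
      have prod': "(\<Prod>i\<in>T. \<alpha> i ^ (?n i - 1)) = \<alpha> l ^ k * P"
      proof -
        have "(\<Prod>i\<in>T - {l}. \<alpha> i ^ (?n i - 1)) = P"
          unfolding P_def by (rule prod.cong) auto
        then show ?thesis using finT l(1) k by (simp add: prod.remove[of T l])
      qed
      have "pdir (d l) (h * (\<alpha> l ^ Suc k * P)) = pdir (d l) (\<Sum>i\<in>T. g i * \<alpha> i ^ n i)"
        using less.prems(2) by (simp only: prod)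
      also have "pdir (d l) (\<Sum>i\<in>T. g i * \<alpha> i ^ n i) = (\<Sum>i\<in>T. pdir (d l) (g i * \<alpha> i ^ n i))"
        by (rule pdir_sum)
      also have "\<dots> = pdir (d l) (g l * \<alpha> l ^ n l) + (\<Sum>i\<in>T - {l}. pdir (d l) (g i * \<alpha> i ^ n i))"
        using finT l(1) by (rule sum.remove)
      also have "(\<Sum>i\<in>T - {l}. pdir (d l) (g i * \<alpha> i ^ n i)) = (\<Sum>i\<in>T - {l}. g' i * \<alpha> i ^ ?n i)"
      proof (rule sum.cong[OF HOL.refl])
        fix i assume i: "i \<in> T - {l}"
        have "pdir (d l) (\<alpha> i ^ n i) = 0"
          using pd[OF l(1), of i] i by (cases "n i") (auto simp del: power_Suc simp: pdir_power)
        then show "pdir (d l) (g i * \<alpha> i ^ n i) = g' i * \<alpha> i ^ ?n i"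
          using i by (simp add: pdir_mult g'_def)
      qed
      also have "pdir (d l) (g l * \<alpha> l ^ n l) = pdir (d l) (g l) * \<alpha> l ^ n l + of_nat (n l) * g l * \<alpha> l ^ Suc k"
        using pd[OF l(1) l(1)] unfolding k by (simp only: pdir_mult pdir_power) (simp add: mult_ac)
      also have "pdir (d l) (h * (\<alpha> l ^ Suc k * P)) = pdir (d l) h * (\<alpha> l ^ Suc k * P) + h * (of_nat (Suc k) * \<alpha> l ^ k * P)"
        using pd[OF l(1) l(1)] dP by (simp only: pdir_mult pdir_power) simp
      finally have "of_nat (Suc k) * (h * (\<alpha> l ^ k * P))
          = (pdir (d l) (g l) * \<alpha> l + of_nat (n l) * g l - pdir (d l) h * P) * \<alpha> l ^ Suc k + (\<Sum>i\<in>T - {l}. g' i * \<alpha> i ^ ?n i)"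
        unfolding k by (simp add: algebra_simps del: of_nat_Suc)
      also have "(pdir (d l) (g l) * \<alpha> l + of_nat (n l) * g l - pdir (d l) h * P) * \<alpha> l ^ Suc k = g' l * \<alpha> l ^ ?n l"
        by (simp add: g'_def k)
      also have "g' l * \<alpha> l ^ ?n l + (\<Sum>i\<in>T - {l}. g' i * \<alpha> i ^ ?n i) = (\<Sum>i\<in>T. g' i * \<alpha> i ^ ?n i)"
        using finT l(1) by (rule sum.remove[symmetric])
      finally have "pconst c * (h * (\<alpha> l ^ k * P)) = (\<Sum>i\<in>T. g' i * \<alpha> i ^ ?n i)"
        by (simp only: of_nat_cpoly c_def)
      then have "pconst (1 / c) * (pconst c * (h * (\<alpha> l ^ k * P))) = pconst (1 / c) * (\<Sum>i\<in>T. g' i * \<alpha> i ^ ?n i)"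
        by (rule arg_cong)
      then have eqn: "h * (\<Prod>i\<in>T. \<alpha> i ^ (?n i - 1)) = (\<Sum>i\<in>T. (pconst (1 / c) * g' i) * \<alpha> i ^ ?n i)"
        unfolding prod' using c
        by (simp only: mult.assoc[symmetric] pconst_mult[symmetric] sum_distrib_left) simp
      have lt: "(\<Sum>i\<in>T. ?n i) < (\<Sum>i\<in>T. n i)"
        using finT by (rule sum_strict_mono_ex1) (use l k in auto)
      have ge: "?n i \<ge> 1" if "i \<in> T" for i using less.prems(1)[OF that] k by auto
      show ?thesis by (rule less.hyps[OF lt ge eqn])
    qed
  qed
qed

text \<open>Move from \<open>p\<close> a little in a direction tangent to \<open>H\<^sub>T\<close> and transversal to the other hyperplanes
  through \<open>p\<close>.\<close>

lemma generic_point: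
  assumes T: "T \<subseteq> {1..m}" and p: "p \<in> flat T" and w: "peval p w \<noteq> 0"
  obtains x where "x \<in> flat T" "peval x w \<noteq> 0" "\<And>k. k \<in> {1..m} - T \<Longrightarrow> peval x (\<alpha> k) \<noteq> 0"
proof -
  define E where "E = {i \<in> {1..m}. peval p (\<alpha> i) = 0}"
  have E: "E \<subseteq> {1..m}" "\<And>i. i \<in> E \<Longrightarrow> peval p (\<alpha> i) = 0" by (auto simp: E_def)
  have TE: "T \<subseteq> E" using T p by (auto simp: E_def flat_iff)
  have finE: "finite E" using E(1) finite_subset by blast
  obtain d where d: "\<And>i k. i \<in> E \<Longrightarrow> k \<in> E \<Longrightarrow> slope (d i) (\<alpha> k) = (if i = k then 1 else 0)"
    using dual_directions[OF E] by blast
  define v where "v = (\<Sum>k\<in>E - T. d k)"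
  have v: "slope v (\<alpha> k) = (if k \<in> T then 0 else 1)" if k: "k \<in> E" for k
  proof -
    have "slope v (\<alpha> k) = (\<Sum>i\<in>E - T. if i = k then 1 else 0)"
      unfolding v_def slope_sum by (rule sum.cong) (use d k in auto)
    then show ?thesis using k finE by simp
  qed
  have cont: "((\<lambda>t. peval (p + t *s v) f) \<longlongrightarrow> peval (p + 0 *s v) f) (at 0)" for f
  proof -
    have "isCont (\<lambda>t. peval (p + t *s v) f) 0"
      unfolding peval_def vector_add_component vector_smult_component by (intro continuous_intros)
    then show ?thesis by (simp only: isCont_def)
  qed
  have near: "\<forall>\<^sub>F t in at 0. peval (p + t *s v) f \<noteq> 0" if "peval p f \<noteq> 0" for f
    using tendsto_imp_eventually_ne[OF cont, of f 0] that by simp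
  have "\<forall>\<^sub>F t in at 0. \<forall>k\<in>{1..m} - T. peval (p + t *s v) (\<alpha> k) \<noteq> 0"
  proof (subst eventually_ball_finite_distrib, simp, rule ballI)
    fix k assume k: "k \<in> {1..m} - T"
    show "\<forall>\<^sub>F t in at 0. peval (p + t *s v) (\<alpha> k) \<noteq> 0"
    proof (cases "k \<in> E")
      case True
      then have "peval (p + t *s v) (\<alpha> k) = t" for t
        using E k v[OF True] by (subst peval_affine_line[OF degree_le]) auto
      then show ?thesis by (simp add: eventually_at_filter)
    next
      case False
      then show ?thesis using near k by (auto simp: E_def)
    qed
  qed
  with near[OF w] have "\<forall>\<^sub>F t in at 0. peval (p + t *s v) w \<noteq> 0 \<and> (\<forall>k\<in>{1..m} - T. peval (p + t *s v) (\<alpha> k) \<noteq> 0)"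
    by eventually_elim blast
  then obtain t where t: "peval (p + t *s v) w \<noteq> 0" "\<forall>k\<in>{1..m} - T. peval (p + t *s v) (\<alpha> k) \<noteq> 0"
    using eventually_happens'[OF at_neq_bot] by blast
  have "p + t *s v \<in> flat T"
    unfolding flat_iff
  proof
    fix i assume i: "i \<in> T"
    then have "i \<in> {1..m}" "i \<in> E" using T TE by auto
    then show "peval (p + t *s v) (\<alpha> i) = 0"
      using E(2) v[of i] i by (simp add: peval_affine_line[OF degree_le] del: One_nat_def)
  qed
  then show thesis using t that by blast
qed

text \<open>A term whose poles do not contain \<open>T\<close> has no pole along some \<open>H\<^sub>l\<close> with \<open>l \<in> T\<close>, so multiplication by \<open>\<alpha>\<^sub>l\<close> to
  the power \<open>K + \<beta>\<^sub>l\<close> makes it divisible by \<open>\<alpha>\<^sub>l ^ K\<close>.\<close>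

lemma polar_clear_denominators:
  assumes T: "T \<subseteq> integral" and F: "\<And>T'. T' \<in> F \<Longrightarrow> \<not> T \<subseteq> T'" and "q \<in> polar F"
  shows "\<exists>K0. \<forall>K\<ge>K0. \<exists>g. q * alpha_pow (\<lambda>i. int K + (if i \<in> T then shift i else 0))
    = frac_of_poly (\<Sum>i\<in>T. g i * \<alpha> i ^ K)"
  using assms(3)
proof induction
  case zero
  then show ?case by (intro exI[of _ 0] allI impI exI[of _ "\<lambda>_. 0"]) simp
next
  case (step q a f)
  let ?s = "\<lambda>i. if i \<in> T then shift i else 0"
  let ?c = "\<lambda>K i. int K + ?s i"
  obtain K0 where K0: "\<And>K. K \<ge> K0 \<Longrightarrow> \<exists>g. q * alpha_pow (?c K) = frac_of_poly (\<Sum>i\<in>T. g i * \<alpha> i ^ K)"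
    using step.IH by blast
  obtain K1 where K1: "\<And>K k. K \<ge> K1 \<Longrightarrow> k \<in> {1..m} \<Longrightarrow> (a k + ?s k) + int K \<ge> 0"
    using nat_lower_bound[of "{1..m}" "\<lambda>k. a k + ?s k"] by blast
  have finT: "finite T" using T finite_integral finite_subset by blast
  obtain l where l: "l \<in> T" "l \<notin> poles a" using F[OF step.hyps(2)] by blast
  have lm: "l \<in> {1..m}" using l(1) T integral_subset by blast
  have al: "a l + shift l \<ge> 0" using l T by (auto simp: poles_def)
  show ?case
  proof (intro exI[of _ "max K0 K1"] allI impI)
    fix K assume K: "max K0 K1 \<le> K"
    then obtain g where g: "q * alpha_pow (?c K) = frac_of_poly (\<Sum>i\<in>T. g i * \<alpha> i ^ K)"
      using K0[of K] by auto
    let ?e = "\<lambda>i. a i + ?c K i"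
    have P: "alpha_pow a * alpha_pow (?c K) = frac_of_poly (\<Prod>i\<in>{1..m}. \<alpha> i ^ nat (?e i))"
      unfolding alpha_pow_add[symmetric]
    proof (rule alpha_pow_nonneg)
      fix i assume "i \<in> {1..m}"
      then show "0 \<le> ?e i" using K1[of K i] K by simp
    qed
    have "\<alpha> l ^ K dvd (\<Prod>i\<in>{1..m}. \<alpha> i ^ nat (?e i))"
    proof -
      have "\<alpha> l ^ K dvd \<alpha> l ^ nat (?e l)"
        using al l(1) by (intro le_imp_power_dvd) simp
      also have "\<dots> dvd (\<Prod>i\<in>{1..m}. \<alpha> i ^ nat (?e i))"
        using lm by (intro dvd_prodI) auto
      finally show ?thesis .
    qed
    then obtain r where "(\<Prod>i\<in>{1..m}. \<alpha> i ^ nat (?e i)) = \<alpha> l ^ K * r" by (rule dvdE)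
    then have r: "alpha_pow a * alpha_pow (?c K) = frac_of_poly (r * \<alpha> l ^ K)"
      unfolding P by (simp only: mult.commute)
    let ?g = "g(l := g l + f * r)"
    have "(\<Sum>i\<in>T. ?g i * \<alpha> i ^ K) = (\<Sum>i\<in>T. g i * \<alpha> i ^ K + (if i = l then f * r * \<alpha> l ^ K else 0))"
      by (rule sum.cong) (auto simp: algebra_simps)
    also have "\<dots> = (\<Sum>i\<in>T. g i * \<alpha> i ^ K) + f * r * \<alpha> l ^ K"
      using l(1) finT by (simp add: sum.distrib)
    finally have s: "(\<Sum>i\<in>T. ?g i * \<alpha> i ^ K) = (\<Sum>i\<in>T. g i * \<alpha> i ^ K) + f * (r * \<alpha> l ^ K)" by (simp only: mult.assoc)
    have "(q + frac_of_poly f * alpha_pow a) * alpha_pow (?c K)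
        = q * alpha_pow (?c K) + frac_of_poly f * (alpha_pow a * alpha_pow (?c K))"
      by (simp only: semiring_class.distrib_right mult.assoc)
    also have "\<dots> = frac_of_poly (\<Sum>i\<in>T. ?g i * \<alpha> i ^ K)"
      unfolding g r s by (simp only: frac_of_poly_add frac_of_poly_mult)
    finally show "\<exists>g. (q + frac_of_poly f * alpha_pow a) * alpha_pow (?c K) = frac_of_poly (\<Sum>i\<in>T. g i * \<alpha> i ^ K)"
      by blast
  qed
qed

text \<open>The common denominator of the preceding lemma leaves the power \<open>K - 1\<close> of \<open>\<alpha>\<^sub>i\<close> on the left for all \<open>i\<close> in
  \<open>T\<close>, which is just too small for membership in the ideal of the \<open>K\<close>-th powers.\<close>

lemma reduced_not_in_polar:
  assumes T: "T \<subseteq> integral" and F: "\<And>T'. T' \<in> F \<Longrightarrow> \<not> T \<subseteq> T'"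
    and p: "p \<in> flat T" and w: "peval p w \<noteq> 0" and a: "reduced T a"
  shows "frac_of_poly w * alpha_pow a \<notin> polar F"
proof
  assume "frac_of_poly w * alpha_pow a \<in> polar F"
  let ?c = "\<lambda>K i. int K + (if i \<in> T then shift i else 0)"
  obtain K0 where K0: "\<And>K. K \<ge> K0 \<Longrightarrow> \<exists>g. frac_of_poly w * alpha_pow a * alpha_pow (?c K) = frac_of_poly (\<Sum>i\<in>T. g i * \<alpha> i ^ K)"
    using polar_clear_denominators[OF T F \<open>frac_of_poly w * alpha_pow a \<in> polar F\<close>] by blast
  obtain K1 where K1: "\<And>K k. K \<ge> K1 \<Longrightarrow> k \<in> {1..m} \<Longrightarrow> a k + int K \<ge> 0"
    using nat_lower_bound[of "{1..m}" a] by blast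
  define K where "K = Suc (max K0 K1)"
  have K: "K \<ge> K0" "K \<ge> K1" by (auto simp: K_def)
  obtain g where g: "frac_of_poly w * alpha_pow a * alpha_pow (?c K) = frac_of_poly (\<Sum>i\<in>T. g i * \<alpha> i ^ K)"
    using K0[OF K(1)] by blast
  have Tm: "T \<subseteq> {1..m}" using T integral_subset by blast
  let ?e = "\<lambda>i. if i \<in> T then int (K - 1) else a i + int K"
  let ?D = "\<Prod>i\<in>{1..m} - T. \<alpha> i ^ nat (a i + int K)"
  have "alpha_pow a * alpha_pow (?c K) = alpha_pow (\<lambda>i. a i + ?c K i)"
    by (rule alpha_pow_add[symmetric])
  also have "\<dots> = alpha_pow ?e"
  proof (rule alpha_pow_cong)
    fix i show "a i + ?c K i = ?e i"
      using a by (auto simp: reduced_def K_def)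
  qed
  also have "\<dots> = frac_of_poly (\<Prod>i\<in>{1..m}. \<alpha> i ^ nat (?e i))"
    by (rule alpha_pow_nonneg) (use K1[OF K(2)] in auto)
  also have "(\<Prod>i\<in>{1..m}. \<alpha> i ^ nat (?e i)) = (\<Prod>i\<in>{1..m} - T. \<alpha> i ^ nat (?e i)) * (\<Prod>i\<in>T. \<alpha> i ^ nat (?e i))"
    using Tm by (intro prod.subset_diff) auto
  also have "(\<Prod>i\<in>{1..m} - T. \<alpha> i ^ nat (?e i)) = ?D" by (rule prod.cong) auto
  also have "(\<Prod>i\<in>T. \<alpha> i ^ nat (?e i)) = (\<Prod>i\<in>T. \<alpha> i ^ (K - 1))" by (rule prod.cong) auto
  finally have "frac_of_poly (w * ?D * (\<Prod>i\<in>T. \<alpha> i ^ (K - 1))) = frac_of_poly (\<Sum>i\<in>T. g i * \<alpha> i ^ K)"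
    using g by (simp only: frac_of_poly_mult mult.assoc)
  then have eq: "w * ?D * (\<Prod>i\<in>T. \<alpha> i ^ (K - 1)) = (\<Sum>i\<in>T. g i * \<alpha> i ^ K)"
    by (simp only: frac_of_poly_inject)
  obtain x where x: "x \<in> flat T" "peval x w \<noteq> 0" "\<And>k. k \<in> {1..m} - T \<Longrightarrow> peval x (\<alpha> k) \<noteq> 0"
    using generic_point[OF Tm p w] by blast
  have "peval x (w * ?D) = 0"
    by (rule vanishes_on_flat[OF Tm x(1), of "\<lambda>_. K"]) (use eq in \<open>auto simp: K_def\<close>)
  moreover have "peval x ?D \<noteq> 0"
    using x(3) by (simp add: peval_prod peval_power del: One_nat_def)
  ultimately show False using x(2) by (simp add: peval_mult del: One_nat_def)
qed

lemma step_support_polar: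
  assumes T: "T \<subseteq> integral" and F: "\<And>T'. T' \<in> F \<Longrightarrow> \<not> T \<subseteq> T'" and proper: "\<And>T'. T' \<subset> T \<Longrightarrow> T' \<in> F"
  shows "step_support (polar F) (polar (insert T F)) = flat T"
proof (intro equalityI subsetI)
  fix p assume "p \<in> flat T"
  let ?a = "\<lambda>i. - shift i - (if i \<in> T then 1 else 0)"
  have a: "reduced T ?a" by (simp add: reduced_def)
  then have "alpha_pow ?a \<in> polar (insert T F)"
    using polar_gen[of ?a "insert T F" 1] poles_reduced[OF T a] by simp
  moreover have "frac_of_poly w * alpha_pow ?a \<notin> polar F" if "peval p w \<noteq> 0" for w
    using reduced_not_in_polar[OF T F \<open>p \<in> flat T\<close> that a] by blast
  ultimately show "p \<in> step_support (polar F) (polar (insert T F))"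
    unfolding step_support_def by blast
next
  fix p assume "p \<in> step_support (polar F) (polar (insert T F))"
  then obtain u where u: "u \<in> polar (insert T F)" "\<And>w. peval p w \<noteq> 0 \<Longrightarrow> frac_of_poly w * u \<notin> polar F"
    unfolding step_support_def by blast
  obtain r f a where rfa: "r \<in> polar F" "poles a = T" "u = r + frac_of_poly f * alpha_pow a"
    using polar_insert_decompose[OF T u(1)] by blast
  show "p \<in> flat T"
  proof (rule ccontr)
    assume "p \<notin> flat T"
    then obtain i where i: "i \<in> T" "peval p (\<alpha> i) \<noteq> 0" by (auto simp: flat_iff)
    define n where "n = nat (- (a i + shift i))"
    let ?b = "a(i := a i + int n)"
    have im: "i \<in> {1..m}" using i(1) T integral_subset by blast
    have "poles ?b = T - {i}" using rfa(2) by (auto simp: poles_def n_def)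
    then have "poles ?b \<in> F" using i(1) by (auto intro: proper)
    then have "frac_of_poly f * alpha_pow ?b \<in> polar F" by (rule polar_gen)
    then have "frac_of_poly (\<alpha> i ^ n) * r + frac_of_poly f * alpha_pow ?b \<in> polar F"
      by (rule polar_add[OF polarD(3)[OF rfa(1)]])
    also have "frac_of_poly (\<alpha> i ^ n) * r + frac_of_poly f * alpha_pow ?b = frac_of_poly (\<alpha> i ^ n) * u"
      unfolding rfa(3) alpha_pow_shift[OF im] by (simp add: frac_of_poly_power ring_distribs mult.left_commute)
    finally show False using u(2)[of "\<alpha> i ^ n"] i(2) by (simp add: peval_power)
  qed
qed

text \<open>Partial fractions: equations without a common zero generate the unit ideal, so that poles along
  hyperplanes with empty intersection can be separated.\<close>

lemma polar_nonempty_flats: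
  "polar {T. T \<subseteq> integral \<and> flat T \<noteq> {}} = poly_localization (\<Prod>i=1..m. \<alpha> i)"
proof -
  let ?F = "{T. T \<subseteq> integral \<and> flat T \<noteq> {}}"
  have gen: "alpha_pow a \<in> polar ?F" for a
  proof (induction "\<Sum>i\<in>integral. nat (- (a i + shift i))" arbitrary: a rule: less_induct)
    case less
    define J where "J = {s. frac_of_poly s * alpha_pow a \<in> polar ?F}"
    have "poly_ideal J"
      using polarD(1-3)[where F = ?F]
      by (auto simp: poly_ideal_def J_def frac_of_poly_add frac_of_poly_mult ring_distribs mult.assoc)
    show ?case
    proof (cases "flat (poles a) = {}")
      case False
      then have "poles a \<in> ?F" by (auto simp: poles_def)
      then show ?thesis using polar_gen[of a ?F 1] by simp
    next
      case True
      have "1 \<in> J"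
      proof (rule ccontr)
        assume "1 \<notin> J"
        then obtain x where x: "\<And>R. R \<subseteq> {1..m} \<Longrightarrow> (\<Prod>i\<in>R. \<alpha> i) \<in> J \<Longrightarrow> \<exists>i\<in>R. peval x (\<alpha> i) = 0"
          using affine_products_common_zero[of "{1..m}" \<alpha> J] \<open>poly_ideal J\<close> degree_le by blast
        have "peval x (\<alpha> i) = 0" if i: "i \<in> poles a" for i
        proof -
          have i': "i \<in> integral" "i \<in> {1..m}" "a i + shift i < 0"
            using i integral_subset by (auto simp: poles_def)
          have "(\<Sum>k\<in>integral. nat (- ((a(i := a i + 1)) k + shift k))) < (\<Sum>k\<in>integral. nat (- (a k + shift k)))"
            using finite_integral by (rule sum_strict_mono_ex1) (use i' in auto)
          then have "alpha_pow (a(i := a i + 1)) \<in> polar ?F" by (rule less)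
          then have "\<alpha> i \<in> J" unfolding J_def using alpha_pow_raise[OF i'(2), of a] by simp
          then show ?thesis using x[of "{i}"] i'(2) by simp
        qed
        then have "x \<in> flat (poles a)" by (simp add: flat_iff)
        then show False using True by blast
      qed
      then show ?thesis by (simp add: J_def)
    qed
  qed
  have "polar (Pow integral) \<subseteq> polar ?F"
    by (rule polar_least) (use gen polarD in blast)+
  moreover have "polar ?F \<subseteq> polar (Pow integral)" by (rule polar_mono) blast
  ultimately show ?thesis unfolding localization_eq_polar by blast
qed

lemma flat_inject:
  assumes "T \<subseteq> {1..m}" "S \<subseteq> {1..m}" "flat T = flat S" "flat S \<noteq> {}"
  shows "T = S"
proof -
  have sub: "S \<subseteq> T" if T: "T \<subseteq> {1..m}" and S: "S \<subseteq> {1..m}" and eq: "flat T = flat S" and ne: "flat S \<noteq> {}" for S T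
  proof
    fix i assume i: "i \<in> S"
    obtain p where p: "p \<in> flat S" using ne by blast
    show "i \<in> T"
    proof (rule ccontr)
      assume "i \<notin> T"
      obtain x where "x \<in> flat T" "\<And>k. k \<in> {1..m} - T \<Longrightarrow> peval x (\<alpha> k) \<noteq> 0"
        using generic_point[OF T, of p 1] p eq by auto
      moreover have "i \<in> {1..m} - T" using \<open>i \<notin> T\<close> i S by blast
      ultimately show False using i unfolding eq flat_iff by blast
    qed
  qed
  show ?thesis using sub[of T S] sub[of S T] assms by blast
qed

end

section \<open>The supports of the factors do not depend on the composition series\<close>

definition simple_chain ::
    "('n \<Rightarrow> 'n cpoly fract) \<Rightarrow> (nat \<Rightarrow> 'n::linorder cpoly fract set) \<Rightarrow> nat \<Rightarrow> bool" where
  "simple_chain \<eta> N l \<longleftrightarrow> N 0 = {0} \<and> (\<forall>i\<le>l. connection_submodule \<eta> (N i)) \<and>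
    (\<forall>i<l. simple_step \<eta> (N i) (N (Suc i)))"

text \<open>\<open>A + X\<close> lies strictly above \<open>A\<close>, so it is all of \<open>B\<close>.\<close>

lemma simple_step_plus:
  assumes "simple_step \<eta> A B" "connection_submodule \<eta> A" "connection_submodule \<eta> X"
    and "X \<subseteq> B" "\<not> X \<subseteq> A" "connection_submodule \<eta> B" "u \<in> B"
  obtains a x where "a \<in> A" "x \<in> X" "u = a + x"
proof -
  let ?S = "{a + x | a x. a \<in> A \<and> x \<in> X}"
  note A = connection_submoduleD[OF assms(2)] and X = connection_submoduleD[OF assms(3)]
    and B = connection_submoduleD[OF assms(6)]
  have AB: "A \<subseteq> B" using assms(1) by (auto simp: simple_step_def)
  have "a \<in> ?S" if "a \<in> A" for a
    using that X(1) by (intro CollectI exI[of _ a] exI[of _ 0]) simp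
  then have 1: "A \<subseteq> ?S" by blast
  have "x \<in> ?S" if "x \<in> X" for x
    using that A(1) by (intro CollectI exI[of _ 0] exI[of _ x]) simp
  then have 2: "?S \<noteq> A" using assms(5) by blast
  have "?S \<subseteq> B" using AB assms(4) B(2) by blast
  then have "?S = B"
    using assms(1) connection_submodule_plus[OF assms(2,3)] 1 2 unfolding simple_step_def by blast
  then have "u \<in> ?S" using assms(7) by simp
  then show thesis using that by blast
qed

text \<open>The Zassenhaus correspondence between the simple steps of two chains. Corresponding factors are
  both isomorphic to \<open>B \<inter> B'\<close> modulo \<open>A \<inter> B' + B \<inter> A'\<close>; on the level of supports it is enough that
  every class of either factor has a representative in \<open>B \<inter> B'\<close>.\<close>

definition steps_meet :: "'a set \<Rightarrow> 'a set \<Rightarrow> 'a set \<Rightarrow> 'a set \<Rightarrow> bool" where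
  "steps_meet A B A' B' \<longleftrightarrow> B \<inter> A' \<subseteq> A \<and> \<not> B \<inter> B' \<subseteq> A"

lemma steps_meet_sym:
  assumes sub: "connection_submodule \<eta> A" "connection_submodule \<eta> B"
      "connection_submodule \<eta> A'" "connection_submodule \<eta> B'"
    and step: "simple_step \<eta> A B" "simple_step \<eta> A' B'" and meet: "steps_meet A B A' B'"
  shows "steps_meet A' B' A B"
proof -
  have AB: "A \<subseteq> B" and A'B': "A' \<subseteq> B'" using step by (auto simp: simple_step_def)
  obtain x where x: "x \<in> B" "x \<in> B'" "x \<notin> A" using meet by (auto simp: steps_meet_def)
  then have "\<not> B' \<inter> B \<subseteq> A'" using meet by (auto simp: steps_meet_def)
  moreover have "B' \<inter> A \<subseteq> A'"
  proof (rule ccontr)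
    assume *: "\<not> B' \<inter> A \<subseteq> A'"
    obtain y z where yz: "y \<in> A'" "z \<in> B' \<inter> A" "x = y + z"
      using simple_step_plus[OF step(2) sub(3) connection_submodule_Int[OF sub(4,1)] _ * sub(4) x(2)]
      by blast
    have "x - z \<in> B" using connection_submoduleD(6)[OF sub(2) x(1)] yz(2) AB by blast
    then have "y \<in> B \<inter> A'" using yz by simp
    then have "y \<in> A" using meet by (auto simp: steps_meet_def)
    then show False using yz x(3) connection_submoduleD(2)[OF sub(1)] by blast
  qed
  ultimately show ?thesis by (simp add: steps_meet_def)
qed

lemma steps_meet_support_le:
  assumes sub: "connection_submodule \<eta> A" "connection_submodule \<eta> B"
      "connection_submodule \<eta> A'" "connection_submodule \<eta> B'"
    and step: "simple_step \<eta> A B" and meet: "steps_meet A B A' B'"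
  shows "step_support A B \<subseteq> step_support A' B'"
proof
  fix p assume "p \<in> step_support A B"
  then obtain u where u: "u \<in> B" "\<And>w. peval p w \<noteq> 0 \<Longrightarrow> frac_of_poly w * u \<notin> A"
    by (auto simp: step_support_def)
  have "\<not> B \<inter> B' \<subseteq> A" using meet by (simp add: steps_meet_def)
  then obtain a x where ax: "a \<in> A" "x \<in> B \<inter> B'" "u = a + x"
    using simple_step_plus[OF step sub(1) connection_submodule_Int[OF sub(2,4)] _ _ sub(2) u(1)] by blast
  have "frac_of_poly w * x \<notin> A'" if w: "peval p w \<noteq> 0" for w
  proof
    assume "frac_of_poly w * x \<in> A'"
    moreover have "frac_of_poly w * x \<in> B" using ax(2) connection_submoduleD(3)[OF sub(2)] by blast
    ultimately have "frac_of_poly w * x \<in> A" using meet by (auto simp: steps_meet_def)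
    moreover have "frac_of_poly w * a \<in> A" using ax(1) by (rule connection_submoduleD(3)[OF sub(1)])
    ultimately have "frac_of_poly w * a + frac_of_poly w * x \<in> A"
      using connection_submoduleD(2)[OF sub(1)] by blast
    moreover have "frac_of_poly w * u = frac_of_poly w * a + frac_of_poly w * x"
      by (simp add: ax(3) ring_distribs)
    ultimately show False using u(2)[OF w] by simp
  qed
  then show "p \<in> step_support A' B'" using ax(2) by (auto simp: step_support_def)
qed

lemma simple_chain_mono:
  assumes "simple_chain \<eta> N l" "i \<le> j" "j \<le> l"
  shows "N i \<subseteq> N j"
  using assms(2,3)
proof (induction j rule: dec_induct)
  case (step j)
  then have "simple_step \<eta> (N j) (N (Suc j))" using assms(1) by (simp add: simple_chain_def)
  then show ?case using step by (auto simp: simple_step_def)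
qed simp

text \<open>The step of the second chain is the one at which the intersections with \<open>N (Suc i)\<close> leave \<open>N i\<close>.\<close>

lemma steps_meet_exists:
  assumes N: "simple_chain \<eta> N l" and N': "simple_chain \<eta> N' l'" and eq: "N l = N' l'" and i: "i < l"
  shows "\<exists>j<l'. steps_meet (N i) (N (Suc i)) (N' j) (N' (Suc j))"
proof -
  let ?P = "\<lambda>j. N (Suc i) \<inter> N' j \<subseteq> N i"
  have "connection_submodule \<eta> (N i)" using N i by (simp add: simple_chain_def)
  then have "0 \<in> N i" by (rule connection_submoduleD(1))
  then have 0: "?P 0" using N' by (auto simp: simple_chain_def)
  have "N i \<subset> N (Suc i)" using N i by (auto simp: simple_chain_def simple_step_def)
  moreover have "N (Suc i) \<subseteq> N l" using simple_chain_mono[OF N] i by simp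
  ultimately have l: "\<not> ?P l'" using eq by blast
  define k where "k = (LEAST k. \<not> ?P k)"
  have k: "\<not> ?P k" "k \<le> l'" unfolding k_def using l by (rule LeastI, rule Least_le)
  then obtain j where j: "k = Suc j" using 0 by (cases k) auto
  then have "?P j" using not_less_Least[of j "\<lambda>k. \<not> ?P k"] by (auto simp: k_def)
  then show ?thesis using k j by (intro exI[of _ j]) (auto simp: steps_meet_def)
qed

lemma steps_meet_unique:
  assumes N': "simple_chain \<eta> N' l'" and "j < l'" "k < l'"
    and "steps_meet A B (N' j) (N' (Suc j))" "steps_meet A B (N' k) (N' (Suc k))"
  shows "j = k"
proof -
  have "\<not> j < k" if "j < l'" "k < l'" "steps_meet A B (N' j) (N' (Suc j))" "steps_meet A B (N' k) (N' (Suc k))" for j k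
  proof
    assume "j < k"
    then have "N' (Suc j) \<subseteq> N' k" using simple_chain_mono[OF N', of "Suc j" k] that(2) by simp
    then show False using that(3,4) by (auto simp: steps_meet_def)
  qed
  then show ?thesis using assms by (meson nat_neq_iff)
qed

lemma card_support_le:
  assumes N: "simple_chain \<eta> N l" and N': "simple_chain \<eta> N' l'" and eq: "N l = N' l'"
  shows "card {i. i < l \<and> step_support (N i) (N (Suc i)) = Z}
    \<le> card {j. j < l' \<and> step_support (N' j) (N' (Suc j)) = Z}"
proof -
  have sub: "connection_submodule \<eta> (N i)" "connection_submodule \<eta> (N (Suc i))"
    "simple_step \<eta> (N i) (N (Suc i))" if "i < l" for i
    using N that by (auto simp: simple_chain_def)
  have sub': "connection_submodule \<eta> (N' i)" "connection_submodule \<eta> (N' (Suc i))"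
    "simple_step \<eta> (N' i) (N' (Suc i))" if "i < l'" for i
    using N' that by (auto simp: simple_chain_def)
  define f where "f i = (SOME j. j < l' \<and> steps_meet (N i) (N (Suc i)) (N' j) (N' (Suc j)))" for i
  have f: "f i < l'" "steps_meet (N i) (N (Suc i)) (N' (f i)) (N' (Suc (f i)))" if "i < l" for i
    using someI_ex[OF steps_meet_exists[OF N N' eq that]] unfolding f_def by auto
  have f': "steps_meet (N' (f i)) (N' (Suc (f i))) (N i) (N (Suc i))" if "i < l" for i
    using steps_meet_sym[OF sub(1,2)[OF that] sub'(1,2)[OF f(1)[OF that]] sub(3)[OF that] sub'(3)[OF f(1)[OF that]] f(2)[OF that]] .
  have supp: "step_support (N' (f i)) (N' (Suc (f i))) = step_support (N i) (N (Suc i))" if "i < l" for i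
    using steps_meet_support_le[OF sub(1,2)[OF that] sub'(1,2)[OF f(1)[OF that]] sub(3)[OF that] f(2)[OF that]]
      steps_meet_support_le[OF sub'(1,2)[OF f(1)[OF that]] sub(1,2)[OF that] sub'(3)[OF f(1)[OF that]] f'[OF that]]
    by blast
  show ?thesis
  proof (rule card_inj_on_le)
    show "inj_on f {i. i < l \<and> step_support (N i) (N (Suc i)) = Z}"
    proof (rule inj_onI, clarify)
      fix i k assume ik: "i < l" "k < l" "f i = f k"
      show "i = k" using steps_meet_unique[OF N ik(1,2) f'[OF ik(1)]] f'[OF ik(2)] ik(3) by simp
    qed
    show "f ` {i. i < l \<and> step_support (N i) (N (Suc i)) = Z}
        \<subseteq> {j. j < l' \<and> step_support (N' j) (N' (Suc j)) = Z}"
      using f(1) supp by auto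
  qed simp
qed

lemma composition_series_iff:
  fixes \<alpha> :: "nat \<Rightarrow> 'n::{finite,linorder} cpoly"
  shows "composition_series (config_module m \<alpha> \<beta>) N l \<longleftrightarrow>
    simple_chain (log_form m \<alpha> \<beta>) N l \<and> N l = poly_localization (\<Prod>i=1..m. \<alpha> i)"
proof -
  let ?M = "config_module m \<alpha> \<beta>" and ?P = "poly_localization (\<Prod>i=1..m. \<alpha> i)"
  let ?\<eta> = "log_form m \<alpha> \<beta>"
  have M: "zero ?M = 0" "carrier ?M = ?P" by (simp_all add: config_module_def)
  have simple: "simple_module (chain_factor ?M N i) \<longleftrightarrow> simple_step ?\<eta> (N i) (N (Suc i))"
    if "connection_submodule ?\<eta> (N i)" "connection_submodule ?\<eta> (N (Suc i))" "N i \<subseteq> N (Suc i)" for i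
  proof -
    interpret config_factor m \<alpha> \<beta> N i by unfold_locales (fact that)+
    show ?thesis by (rule simple_factor_iff)
  qed
  show ?thesis
  proof
    assume C: "composition_series ?M N l"
    then have "connection_submodule ?\<eta> (N i)" if "i \<le> l" for i
      using that unfolding composition_series_def left_submodule_config_module_iff by blast
    moreover from this have "simple_step ?\<eta> (N i) (N (Suc i))" if "i < l" for i
      using C simple[of i] that unfolding composition_series_def by simp
    ultimately show "simple_chain ?\<eta> N l \<and> N l = ?P"
      using C M unfolding composition_series_def simple_chain_def by auto
  next
    assume C: "simple_chain ?\<eta> N l \<and> N l = ?P"
    have "left_submodule (N i) ?M" if "i \<le> l" for i
      unfolding left_submodule_config_module_iff
      using C that simple_chain_mono[of ?\<eta> N l i l] unfolding simple_chain_def by blast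
    moreover have "N i \<subseteq> N (Suc i)" "simple_module (chain_factor ?M N i)" if "i < l" for i
    proof -
      show "N i \<subseteq> N (Suc i)" using C that by (auto simp: simple_chain_def simple_step_def)
      then show "simple_module (chain_factor ?M N i)"
        using C that by (subst simple) (auto simp: simple_chain_def)
    qed
    ultimately show "composition_series ?M N l"
      using C M unfolding composition_series_def simple_chain_def by auto
  qed
qed

lemma num_factors_with_support_eq:
  fixes \<alpha> :: "nat \<Rightarrow> 'n::{finite,linorder} cpoly"
  assumes "simple_chain (log_form m \<alpha> \<beta>) N l"
  shows "num_factors_with_support (config_module m \<alpha> \<beta>) N l Z
    = card {i. i < l \<and> step_support (N i) (N (Suc i)) = Z}"
proof -
  have "module_support (chain_factor (config_module m \<alpha> \<beta>) N i) = step_support (N i) (N (Suc i))"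
    if "i < l" for i
  proof -
    interpret config_factor m \<alpha> \<beta> N i
      using assms that by unfold_locales (auto simp: simple_chain_def simple_step_def)
    show ?thesis by (rule module_support_factor)
  qed
  then have "{i. i < l \<and> module_support (chain_factor (config_module m \<alpha> \<beta>) N i) = Z}
      = {i. i < l \<and> step_support (N i) (N (Suc i)) = Z}" by auto
  then show ?thesis by (simp only: num_factors_with_support_def)
qed

section \<open>The filtration by poles is a composition series\<close>

context arrangement
begin

text \<open>Sorting by cardinality ensures that the proper subsets of a set \<open>T\<close> come before \<open>T\<close>, and sets containing
  \<open>T\<close> after it, as the two parts on simplicity and support require.\<close>

lemma pole_filtration:
  obtains N Ts where "simple_chain (log_form m \<alpha> \<beta>) N (length Ts)"
    "N (length Ts) = poly_localization (\<Prod>i=1..m. \<alpha> i)"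
    "distinct Ts" "set Ts = {T. T \<subseteq> integral \<and> flat T \<noteq> {}}"
    "\<And>j. j < length Ts \<Longrightarrow> step_support (N j) (N (Suc j)) = flat (Ts ! j)"
proof -
  let ?F = "{T. T \<subseteq> integral \<and> flat T \<noteq> {}}"
  have "finite ?F" using finite_integral by (auto intro: finite_subset[of _ "Pow integral"])
  from finite_distinct_list[OF this] obtain Xs where Xs: "set Xs = ?F \<and> distinct Xs" ..
  define Ts where "Ts = sort_key card Xs"
  have Ts: "set Ts = ?F" "distinct Ts" "sorted (map card Ts)"
    using Xs by (simp_all add: Ts_def)
  define N where "N j = polar (set (take j Ts))" for j
  have card_le: "card (Ts ! k) \<le> card (Ts ! j)" if "k \<le> j" "j < length Ts" for k j
    using sorted_nth_mono[OF Ts(3), of k j] that by simp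
  have step: "simple_step (log_form m \<alpha> \<beta>) (N j) (N (Suc j)) \<and> step_support (N j) (N (Suc j)) = flat (Ts ! j)"
    if j: "j < length Ts" for j
  proof -
    define T where "T = Ts ! j"
    let ?G = "set (take j Ts)"
    have T: "T \<subseteq> integral" "flat T \<noteq> {}" using j Ts(1) nth_mem[of j Ts] unfolding T_def by auto
    have finT: "finite T" using T(1) finite_integral finite_subset by blast
    have Suc: "N (Suc j) = polar (insert T ?G)"
      using j by (simp add: N_def take_Suc_conv_app_nth T_def)
    have proper: "T' \<in> ?G" if T': "T' \<subset> T" for T'
    proof -
      have "flat T \<subseteq> flat T'" using T' by (auto simp: hyperplane_intersection_def)
      then have "T' \<in> set Ts" using T' T Ts(1) by auto
      then obtain k where k: "k < length Ts" "T' = Ts ! k" by (auto simp: in_set_conv_nth)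
      have "card T' < card T" using finT T' by (rule psubset_card_mono)
      then have "k < j" using card_le[of j k] k by (cases "k < j") (auto simp: T_def)
      then show ?thesis using k j by (auto simp: in_set_conv_nth intro!: exI[of _ k])
    qed
    have earlier: "\<not> T \<subseteq> T'" if "T' \<in> ?G" for T'
    proof
      assume "T \<subseteq> T'"
      obtain k where k: "k < j" "T' = Ts ! k" using \<open>T' \<in> ?G\<close> by (auto simp: in_set_conv_nth)
      have "T' \<in> set Ts" using k j by simp
      then have "finite T'" using Ts(1) finite_integral finite_subset by blast
      moreover have "card T' \<le> card T" using card_le[of k j] k j by (simp add: T_def)
      ultimately have "T = T'" using \<open>T \<subseteq> T'\<close> by (intro card_seteq) auto
      then show False using k j Ts(2) by (simp add: T_def nth_eq_iff_index_eq)
    qed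
    have supp: "step_support (N j) (N (Suc j)) = flat T"
      unfolding Suc unfolding N_def using T(1) earlier proper by (rule step_support_polar)
    obtain p where p: "p \<in> flat T" using T(2) by blast
    have "simple_step (log_form m \<alpha> \<beta>) (N j) (N (Suc j))"
      unfolding simple_step_def
    proof (intro conjI allI impI)
      have "N j \<subseteq> N (Suc j)" unfolding Suc unfolding N_def by (rule polar_mono) blast
      moreover have "N j \<noteq> N (Suc j)"
      proof
        assume e: "N j = N (Suc j)"
        have "p \<in> step_support (N j) (N (Suc j))" using p supp by simp
        then obtain u where u: "u \<in> N (Suc j)" "\<And>w. peval p w \<noteq> 0 \<Longrightarrow> frac_of_poly w * u \<notin> N j"
          unfolding step_support_def by blast
        show False using u(1) u(2)[of 1] e by simp
      qed
      ultimately show "N j \<subset> N (Suc j)" by blast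
    next
      fix C assume C: "connection_submodule (log_form m \<alpha> \<beta>) C" "N j \<subseteq> C" "C \<subseteq> N (Suc j)"
      interpret polar_step m \<alpha> \<beta> T ?G p C
        using T(1) proper p C(1,2) by unfold_locales (auto simp: flat_iff N_def)
      show "C = N j \<or> C = N (Suc j)"
        using all_or_nothing C(3) unfolding Suc unfolding N_def by blast
    qed
    then show ?thesis using supp by (simp add: T_def)
  qed
  have "polar {} = {0}"
  proof (intro equalityI subsetI)
    fix q assume "q \<in> polar {}"
    then show "q \<in> {0}" by induction auto
  qed (auto intro: polar.zero)
  then have "simple_chain (log_form m \<alpha> \<beta>) N (length Ts)"
    using step polar_submodule by (auto simp: simple_chain_def N_def)
  moreover have "N (length Ts) = poly_localization (\<Prod>i=1..m. \<alpha> i)"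
    using polar_nonempty_flats by (simp add: N_def Ts(1))
  ultimately show thesis using that Ts(1,2) step by blast
qed

lemma card_steps_with_support:
  assumes N: "simple_chain (log_form m \<alpha> \<beta>) N l" "N l = poly_localization (\<Prod>i=1..m. \<alpha> i)"
    and S: "S \<subseteq> {1..m}" "flat S \<noteq> {}"
  shows "card {i. i < l \<and> step_support (N i) (N (Suc i)) = flat S} = (if S \<subseteq> integral then 1 else 0)"
proof -
  obtain N' Ts where N': "simple_chain (log_form m \<alpha> \<beta>) N' (length Ts)"
    "N' (length Ts) = poly_localization (\<Prod>i=1..m. \<alpha> i)"
    "distinct Ts" "set Ts = {T. T \<subseteq> integral \<and> flat T \<noteq> {}}"
    "\<And>j. j < length Ts \<Longrightarrow> step_support (N' j) (N' (Suc j)) = flat (Ts ! j)"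
    using pole_filtration by blast
  have "card {i. i < l \<and> step_support (N i) (N (Suc i)) = flat S}
      = card {j. j < length Ts \<and> step_support (N' j) (N' (Suc j)) = flat S}"
    using card_support_le[OF N(1) N'(1)] card_support_le[OF N'(1) N(1)] N(2) N'(2) by (intro antisym) auto
  also have "{j. j < length Ts \<and> step_support (N' j) (N' (Suc j)) = flat S} = {j. j < length Ts \<and> Ts ! j = S}"
  proof -
    have "flat (Ts ! j) = flat S \<longleftrightarrow> Ts ! j = S" if "j < length Ts" for j
    proof
      assume e: "flat (Ts ! j) = flat S"
      have "Ts ! j \<subseteq> {1..m}" using nth_mem[OF that] N'(4) integral_subset by blast
      then show "Ts ! j = S" using S e by (intro flat_inject)
    qed simp
    then show ?thesis using N'(5) by auto
  qed
  also have "card \<dots> = (if S \<subseteq> integral then 1 else 0)"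
  proof (cases "S \<subseteq> integral")
    case True
    then have "S \<in> set Ts" using S N'(4) by simp
    then obtain k where k: "k < length Ts" "Ts ! k = S" by (auto simp: in_set_conv_nth)
    then have "{j. j < length Ts \<and> Ts ! j = S} = {k}"
      using N'(3) by (auto simp: nth_eq_iff_index_eq)
    then show ?thesis using True by simp
  next
    case False
    then have "S \<notin> set Ts" using N'(4) by simp
    then have "{j. j < length Ts \<and> Ts ! j = S} = {}" by (auto simp: in_set_conv_nth)
    then show ?thesis using False by simp
  qed
  finally show ?thesis .
qed

end

theorem theorem3p2:
  fixes \<alpha> :: "nat \<Rightarrow> 'n::{finite,linorder} cpoly"
    and \<beta> :: "nat \<Rightarrow> complex"
    and m :: nat
    and S :: "nat set"
  assumes "hyperplane_configuration m \<alpha>"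
    and "inj_on (\<lambda>i. zero_locus (\<alpha> i)) {1..m}"
    and "normal_crossing m \<alpha>"
    and "S \<subseteq> {1..m}"
    and "hyperplane_intersection \<alpha> S \<noteq> {}"
  shows "finite_length (config_module m \<alpha> \<beta>) \<and>
    (\<forall>N l. composition_series (config_module m \<alpha> \<beta>) N l \<longrightarrow>
      num_factors_with_support (config_module m \<alpha> \<beta>) N l (hyperplane_intersection \<alpha> S) \<le> 1 \<and>
      (num_factors_with_support (config_module m \<alpha> \<beta>) N l (hyperplane_intersection \<alpha> S) = 1
        \<longleftrightarrow> (\<forall>i\<in>S. \<beta> i \<in> \<int>)))"
proof -
  interpret arrangement m \<alpha> \<beta> using assms(1,3) by unfold_locales
  have "finite_length (config_module m \<alpha> \<beta>)"
    unfolding finite_length_def composition_series_iff by (rule pole_filtration) blast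
  moreover have "num_factors_with_support (config_module m \<alpha> \<beta>) N l (flat S) = (if \<forall>i\<in>S. \<beta> i \<in> \<int> then 1 else 0)"
    if "composition_series (config_module m \<alpha> \<beta>) N l" for N l
  proof -
    have N: "simple_chain (log_form m \<alpha> \<beta>) N l" "N l = poly_localization (\<Prod>i=1..m. \<alpha> i)"
      using that by (simp_all add: composition_series_iff del: One_nat_def)
    have "S \<subseteq> integral \<longleftrightarrow> (\<forall>i\<in>S. \<beta> i \<in> \<int>)" using assms(4) by (auto simp: integral_def)
    then show ?thesis
      using card_steps_with_support[OF N assms(4,5)] num_factors_with_support_eq[OF N(1)] by simp
  qed
  ultimately show ?thesis by simp
qed

end
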